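(* Let $n, r$ be integers with $r \ge n+2 > 4$ and let $E\subseteq[n]\times[r]$ be such that $|E| = nr - \binom{n+1}{2} - r + 1$. Let $E'\supseteq E$ be the set satisfying $G_{E'} = \overline{\mathrm{core}}_2(G_E)$. Then $E$ is a basis of the algebraic matroid underlying $X_{n,r}$ if and only if $E'$ is spanning in $X_{n,r}$. Moreover, for a fixed $n\ge 3$, there are, up to bipartite isomorphism, only finitely many graphs that appear as $\mathrm{core}_2(G_E)$ as $r$ ranges over all integers $r\ge n+2$ and $E$ ranges over all bases of $X_{n,r}$.
   Context: Notation: $[m]=\{1,\dots,m\}$. The affine finite unit norm tight frame variety is $$X_{n,r} = \{ W \in \mathbb{C}^{n\times r} : W W^T = \tfrac{r}{n}\,\mathrm{Id}_n,\ \operatorname{diag}(W^T W) = \operatorname{diag}(\mathrm{Id}_r)\},$$ where $W^T$ is the ordinary transpose (no complex conjugation) and $\operatorname{diag}(M)$ denotes the diagonal entries of $M$. It is known that for $r \ge n+2 > 4$ the variety $X_{n,r}$ is irreducible of dimension $nr - \binom{n+1}{2} - r + 1$. For $S\subseteq [n]\times[r]$, let $\pi_S : \mathbb{C}^{n\times r}\to\mathbb{C}^S$ be the coordinate projection. For an irreducible variety $X\subseteq\mathbb{C}^{n\times r}$, the set $S$ is independent in $X$ if the only polynomial vanishing on $\pi_S(X)$ is the zero polynomial; $S$ is spanning in $X$ if $\dim \pi_S(X) = \dim X$; and $S$ is a basis of $X$ if it is both independent and spanning. For $E\subseteq[n]\times[r]$, $G_E$ denotes the bipartite graph with row vertices $[n]$,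 column vertices $[r]$ (the two vertex sets being disjoint copies), and edge set the complement $([n]\times[r])\setminus E$. For a bipartite graph $G$, its greater $2$-core $\overline{\mathrm{core}}_2(G)$ is the graph on the same vertex set obtained from $G$ by iteratively removing all edges incident to a vertex of degree one, until no vertex of degree one remains; its $2$-core $\mathrm{core}_2(G)$ is obtained from $\overline{\mathrm{core}}_2(G)$ by deleting the isolated vertices. Two bipartite graphs with ordered vertex parts $(A_1,B_1)$ and $(A_2,B_2)$ are bipartite isomorphic if there is a graph isomorphism mapping $A_1$ onto $A_2$ and $B_1$ onto $B_2$. *)

theory Defs
  imports
    "Jordan_Normal_Form.Matrix"
    "HOL-Library.Poly_Mapping"
    "HOL-Library.FuncSet"
    "HOL-Library.Extended_Nat"
    "HOL-Library.While_Combinator"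
begin

section \<open>Polynomials in variables indexed by a type\<close>

text \<open>A polynomial is a finitely supported map from monomials to complex coefficients, and a
  monomial a finitely supported map from variables to exponents.\<close>

type_synonym 'v cpoly = "('v \<Rightarrow>\<^sub>0 nat) \<Rightarrow>\<^sub>0 complex"

definition poly_vars :: "'v cpoly \<Rightarrow> 'v set" where
  "poly_vars p = (\<Union>m \<in> Poly_Mapping.keys p. Poly_Mapping.keys m)"

definition poly_eval :: "'v cpoly \<Rightarrow> ('v \<Rightarrow> complex) \<Rightarrow> complex" where
  "poly_eval p x = (\<Sum>m \<in> Poly_Mapping.keys p.
     Poly_Mapping.lookup p m * (\<Prod>v \<in> Poly_Mapping.keys m. x v ^ Poly_Mapping.lookup m v))"

section \<open>Zariski topology and dimension\<close>

text \<open>The affine space with coordinates indexed by \<open>S\<close> is the set of extensional functions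
  \<open>S \<rightarrow>\<^sub>E UNIV\<close>.\<close>

definition zariski_closed :: "'v set \<Rightarrow> ('v \<Rightarrow> complex) set \<Rightarrow> bool" where
  "zariski_closed S Z \<longleftrightarrow>
     (\<exists>P. (\<forall>p\<in>P. poly_vars p \<subseteq> S) \<and> Z = {x \<in> S \<rightarrow>\<^sub>E UNIV. \<forall>p\<in>P. poly_eval p x = 0})"

definition zariski_closure :: "'v set \<Rightarrow> ('v \<Rightarrow> complex) set \<Rightarrow> ('v \<Rightarrow> complex) set" where
  "zariski_closure S A = \<Inter> {Z. zariski_closed S Z \<and> A \<subseteq> Z}"

definition irreducible_closed :: "'v set \<Rightarrow> ('v \<Rightarrow> complex) set \<Rightarrow> bool" where
  "irreducible_closed S Z \<longleftrightarrow> zariski_closed S Z \<and> Z \<noteq> {} \<and>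
     (\<forall>Z1 Z2. zariski_closed S Z1 \<and> zariski_closed S Z2 \<and> Z = Z1 \<union> Z2 \<longrightarrow> Z1 = Z \<or> Z2 = Z)"

text \<open>A projection of a variety need not be closed; its dimension is the Krull dimension of its
  Zariski closure, that is, the supremum of the lengths of chains of irreducible closed subsets
  of the closure.\<close>

definition zariski_dim :: "'v set \<Rightarrow> ('v \<Rightarrow> complex) set \<Rightarrow> enat" where
  "zariski_dim S A = Sup {enat k | k. \<exists>Z :: nat \<Rightarrow> ('v \<Rightarrow> complex) set.
     (\<forall>i\<le>k. irreducible_closed S (Z i) \<and> Z i \<subseteq> zariski_closure S A) \<and>
     (\<forall>i<k. Z i \<subset> Z (Suc i))}"

section \<open>Algebraic matroids of sets of matrices\<close>

text \<open>Row and column indices are 0-based, as for matrices in the library, so the index set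
  \<open>[n] \<times> [r]\<close> is \<open>{..<n} \<times> {..<r}\<close>.\<close>

abbreviation grid :: "nat \<Rightarrow> nat \<Rightarrow> (nat \<times> nat) set" where
  "grid n r \<equiv> {..<n} \<times> {..<r}"

definition coord_proj :: "(nat \<times> nat) set \<Rightarrow> complex mat \<Rightarrow> (nat \<times> nat) \<Rightarrow> complex" where
  "coord_proj S W = restrict (\<lambda>e. W $$ e) S"

definition independent_in :: "complex mat set \<Rightarrow> (nat \<times> nat) set \<Rightarrow> bool" where
  "independent_in X S \<longleftrightarrow>
     (\<forall>p. poly_vars p \<subseteq> S \<and> (\<forall>x \<in> coord_proj S ` X. poly_eval p x = 0) \<longrightarrow> p = 0)"

text \<open>The dimension of \<open>X \<subseteq> carrier_mat n r\<close> is taken after reading a matrix as the function of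
  all its coordinates.\<close>

definition mat_dim :: "nat \<Rightarrow> nat \<Rightarrow> complex mat set \<Rightarrow> enat" where
  "mat_dim n r X = zariski_dim (grid n r) (coord_proj (grid n r) ` X)"

definition spanning_in :: "nat \<Rightarrow> nat \<Rightarrow> complex mat set \<Rightarrow> (nat \<times> nat) set \<Rightarrow> bool" where
  "spanning_in n r X S \<longleftrightarrow> zariski_dim S (coord_proj S ` X) = mat_dim n r X"

definition basis_of :: "nat \<Rightarrow> nat \<Rightarrow> complex mat set \<Rightarrow> (nat \<times> nat) set \<Rightarrow> bool" where
  "basis_of n r X S \<longleftrightarrow> independent_in X S \<and> spanning_in n r X S"

definition funtf :: "nat \<Rightarrow> nat \<Rightarrow> complex mat set" where
  "funtf n r = {W \<in> carrier_mat n r.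
     W * transpose_mat W = (of_nat r / of_nat n) \<cdot>\<^sub>m 1\<^sub>m n \<and>
     diag_mat (transpose_mat W * W) = diag_mat (1\<^sub>m r)}"

section \<open>Bipartite graphs and 2-cores\<close>

text \<open>The two parts are disjoint by encoding: an edge \<open>(i, j)\<close> joins row vertex \<open>i\<close> to column
  vertex \<open>j\<close>, even if \<open>i = j\<close> as numbers.\<close>

record ('a, 'b) bigraph =
  row_verts :: "'a set"
  col_verts :: "'b set"
  edges :: "('a \<times> 'b) set"

definition row_deg :: "('a, 'b) bigraph \<Rightarrow> 'a \<Rightarrow> nat" where
  "row_deg G i = card {j. (i, j) \<in> edges G}"

definition col_deg :: "('a, 'b) bigraph \<Rightarrow> 'b \<Rightarrow> nat" where
  "col_deg G j = card {i. (i, j) \<in> edges G}"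

definition has_leaf :: "('a, 'b) bigraph \<Rightarrow> bool" where
  "has_leaf G \<longleftrightarrow>
     (\<exists>i \<in> row_verts G. row_deg G i = 1) \<or> (\<exists>j \<in> col_verts G. col_deg G j = 1)"

text \<open>One round removes the edges at all current degree-one vertices simultaneously; the graph
  reached in the end does not depend on the order of removal.\<close>

definition prune :: "('a, 'b) bigraph \<Rightarrow> ('a, 'b) bigraph" where
  "prune G = G\<lparr>edges := {(i, j) \<in> edges G. row_deg G i \<noteq> 1 \<and> col_deg G j \<noteq> 1}\<rparr>"

definition greater_core2 :: "('a, 'b) bigraph \<Rightarrow> ('a, 'b) bigraph" where
  "greater_core2 G = while has_leaf prune G"

definition delete_isolated :: "('a, 'b) bigraph \<Rightarrow> ('a, 'b) bigraph" where
  "delete_isolated G = G\<lparr>row_verts := {i \<in> row_verts G. row_deg G i \<noteq> 0},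
                         col_verts := {j \<in> col_verts G. col_deg G j \<noteq> 0}\<rparr>"

definition core2 :: "('a, 'b) bigraph \<Rightarrow> ('a, 'b) bigraph" where
  "core2 G = delete_isolated (greater_core2 G)"

definition bipartite_iso :: "('a, 'b) bigraph \<Rightarrow> ('c, 'd) bigraph \<Rightarrow> bool" where
  "bipartite_iso G H \<longleftrightarrow> (\<exists>f g. bij_betw f (row_verts G) (row_verts H) \<and>
     bij_betw g (col_verts G) (col_verts H) \<and>
     (\<forall>i \<in> row_verts G. \<forall>j \<in> col_verts G. (i, j) \<in> edges G \<longleftrightarrow> (f i, g j) \<in> edges H))"

definition compl_graph :: "nat \<Rightarrow> nat \<Rightarrow> (nat \<times> nat) set \<Rightarrow> (nat, nat) bigraph" where
  "compl_graph n r E = \<lparr>row_verts = {..<n}, col_verts = {..<r}, edges = grid n r - E\<rparr>"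

text \<open>The set \<open>E'\<close> with \<open>G\<^sub>E\<^sub>'\<close> the greater 2-core of \<open>G\<^sub>E\<close> exists and is unique.\<close>

lemma greater_core2_compl_graph:
  "row_verts (greater_core2 (compl_graph n r E)) = {..<n} \<and>
   col_verts (greater_core2 (compl_graph n r E)) = {..<r} \<and>
   edges (greater_core2 (compl_graph n r E)) \<subseteq> grid n r - E \<and>
   \<not> has_leaf (greater_core2 (compl_graph n r E))"
proof -
  define I :: "(nat, nat) bigraph \<Rightarrow> bool" where
    "I G \<longleftrightarrow> row_verts G = {..<n} \<and> col_verts G = {..<r} \<and> edges G \<subseteq> grid n r - E" for G
  have fin: "finite (edges G)" if "I G" for G
    using that unfolding I_def by (meson finite_Diff finite_SigmaI finite_lessThan finite_subset)
  have less: "edges (prune G) \<subset> edges G" if "I G" "has_leaf G" for G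
  proof -
    have "\<exists>e. e \<in> edges G \<and> e \<notin> edges (prune G)"
      using that(2) unfolding has_leaf_def
    proof
      assume "\<exists>i \<in> row_verts G. row_deg G i = 1"
      then obtain i where i: "row_deg G i = 1" by blast
      then obtain j where "{j. (i, j) \<in> edges G} = {j}"
        unfolding row_deg_def by (auto simp: card_1_singleton_iff)
      with i show ?thesis by (auto simp: prune_def intro!: exI[of _ "(i, j)"])
    next
      assume "\<exists>j \<in> col_verts G. col_deg G j = 1"
      then obtain j where j: "col_deg G j = 1" by blast
      then obtain i where "{i. (i, j) \<in> edges G} = {i}"
        unfolding col_deg_def by (auto simp: card_1_singleton_iff)
      with j show ?thesis by (auto simp: prune_def intro!: exI[of _ "(i, j)"])
    qed
    then show ?thesis by (auto simp: prune_def)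
  qed
  have "I (while has_leaf prune (compl_graph n r E)) \<and>
        \<not> has_leaf (while has_leaf prune (compl_graph n r E))"
  proof (rule while_rule[where P = I and r = "measure (\<lambda>G. card (edges G))"])
    show "I (compl_graph n r E)" by (auto simp: I_def compl_graph_def)
    show "I (prune G)" if "I G" "has_leaf G" for G
      using that by (auto simp: I_def prune_def)
    show "(prune G, G) \<in> measure (\<lambda>G. card (edges G))" if "I G" "has_leaf G" for G
      using psubset_card_mono[OF fin[OF that(1)] less[OF that]] by simp
  qed auto
  then show ?thesis by (simp add: I_def greater_core2_def)
qed

lemma ex1_greater_core2_set:
  assumes "E \<subseteq> grid n r"
  shows "\<exists>!E'. E \<subseteq> E' \<and> E' \<subseteq> grid n r \<and> compl_graph n r E' = greater_core2 (compl_graph n r E)"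
proof -
  let ?C = "greater_core2 (compl_graph n r E)"
  show ?thesis
  proof (rule ex1I[of _ "grid n r - edges ?C"])
    show "E \<subseteq> grid n r - edges ?C \<and> grid n r - edges ?C \<subseteq> grid n r \<and>
          compl_graph n r (grid n r - edges ?C) = ?C"
      using greater_core2_compl_graph[of n r E] assms
      by (auto intro!: bigraph.equality simp: compl_graph_def)
  next
    fix E' assume E': "E \<subseteq> E' \<and> E' \<subseteq> grid n r \<and> compl_graph n r E' = ?C"
    then have "edges ?C = grid n r - E'"
      by (metis bigraph.select_convs(3) compl_graph_def)
    with E' show "E' = grid n r - edges ?C" by blast
  qed
qed

end

theory Submission
  imports
    Defs
    "HOL-Library.Product_Lexorder"
    "HOL-Computational_Algebra.Fundamental_Theorem_Algebra"
    "HOL-Analysis.Continuum_Not_Denumerable"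
    "HOL-Analysis.Complex_Transcendental"
    "Jordan_Normal_Form.Char_Poly"
begin

text \<open>Irreducible closed subsets of an affine space correspond to prime ideals by the
  Nullstellensatz, so all dimensions are lengths of chains of prime ideals. If the edge \<open>e\<close> is
  incident to a leaf, then \<open>x\<^sub>e\<^sup>2\<close> is a polynomial in the other coordinates on the frame variety,
  and adjoining a square root preserves the lengths of chains of primes; hence \<open>E\<close> and \<open>E'\<close>
  project to closures of equal dimension. A nonempty variety in \<open>N\<close>-space cut out by \<open>c\<close> equations has dimension at least \<open>N - c\<close>, which is \<open>|E|\<close> here because one of the frame
  equations is redundant; since chains of primes over a nonzero ideal of \<open>C[E]\<close> have length less
  than \<open>|E|\<close>, a spanning \<open>E\<close> of this size is independent.

  For the finiteness of the cores, every column meets the complement of a basis, and every column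
  of the core meets it at least twice. As the complement has at most
  \<open>(n + 1 choose 2) + r - 1\<close> elements, the core has fewer than \<open>(n + 1 choose 2)\<close> columns.\<close>

section \<open>Evaluation of polynomials\<close>

text \<open>Dimension is defined by chains, so both bounds must be proved for chains of primes. The
  upper bound counts monomials: too many polynomials are algebraically dependent, while elements
  picked from the successive steps of a chain satisfy no relation. The lower bound
  \<open>N - c\<close> is the harder one and goes through the Hilbert--Samuel function at a point of
  the variety: each equation lowers its polynomial growth by at most one degree, and growth of
  degree \<open>t\<close> forces a chain of \<open>t\<close> inclusions. This needs a point to start
  from, which is why an explicit frame is exhibited. The lower bound serves twice: it makes a
  spanning \<open>E\<close> of the expected size have full dimension in its own affine space, and it
  forces every basis to have at least the expected number of elements, which caps the complement
  when the columns of a core are counted. Quotient rings do not appear: ideals are subsets of one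
  ambient polynomial ring, so contraction to fewer variables is intersection.\<close>

definition Const :: "complex \<Rightarrow> 'v cpoly" where
  "Const c = Poly_Mapping.single 0 c"

definition Var :: "'v \<Rightarrow> 'v cpoly" where
  "Var v = Poly_Mapping.single (Poly_Mapping.single v 1) 1"

definition mono_val :: "('v \<Rightarrow> 'r::comm_ring_1) \<Rightarrow> ('v \<Rightarrow>\<^sub>0 nat) \<Rightarrow> 'r" where
  "mono_val x m = (\<Prod>v\<in>Poly_Mapping.keys m. x v ^ Poly_Mapping.lookup m v)"

text \<open>The coefficient map \<open>h\<close> lets one construction serve both for evaluation at
  complex points (\<open>h = id\<close>) and for substitution of polynomials into polynomials
  (\<open>h = Const\<close>).\<close>

definition insertion :: "(complex \<Rightarrow> 'r::comm_ring_1) \<Rightarrow> ('v \<Rightarrow> 'r) \<Rightarrow> 'v cpoly \<Rightarrow> 'r" where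
  "insertion h x p = (\<Sum>m\<in>Poly_Mapping.keys p. h (Poly_Mapping.lookup p m) * mono_val x m)"

lemma poly_eval_insertion: "poly_eval p x = insertion id x p"
  by (simp add: poly_eval_def insertion_def mono_val_def)

lemma mono_val_superset:
  assumes "finite V" "Poly_Mapping.keys m \<subseteq> V"
  shows "mono_val x m = (\<Prod>v\<in>V. x v ^ Poly_Mapping.lookup m v)"
  unfolding mono_val_def using assms
  by (intro prod.mono_neutral_left) (auto simp: in_keys_iff)

lemma mono_val_add: "mono_val x (m + m') = mono_val x m * mono_val x m'"
proof -
  let ?V = "Poly_Mapping.keys m \<union> Poly_Mapping.keys m'"
  have "mono_val x (m + m') = (\<Prod>v\<in>?V. x v ^ Poly_Mapping.lookup (m + m') v)"
    by (intro mono_val_superset) (auto simp: Poly_Mapping.keys_add)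
  also have "\<dots> = (\<Prod>v\<in>?V. x v ^ Poly_Mapping.lookup m v) * (\<Prod>v\<in>?V. x v ^ Poly_Mapping.lookup m' v)"
    by (simp add: lookup_add power_add prod.distrib)
  also have "\<dots> = mono_val x m * mono_val x m'"
    by (subst (1 2) mono_val_superset[of ?V]) auto
  finally show ?thesis .
qed

lemma mono_val_zero [simp]: "mono_val x 0 = 1"
  by (simp add: mono_val_def)

lemma mono_val_single: "mono_val x (Poly_Mapping.single v k) = x v ^ k"
  by (cases "k = 0") (auto simp: mono_val_def)

lemma cpoly_induct [case_names zero single_plus]:
  fixes p :: "'v cpoly"
  assumes "Q 0" and "\<And>m c p. Q p \<Longrightarrow> m \<notin> Poly_Mapping.keys p \<Longrightarrow> c \<noteq> 0 \<Longrightarrow> Q (Poly_Mapping.single m c + p)"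
  shows "Q p"
proof (induction p rule: update_induct)
  case const
  show ?case using assms(1) .
next
  case (update f a b)
  have "Poly_Mapping.update a b f = Poly_Mapping.single a b + f"
    using update by (intro poly_mapping_eqI)
      (auto simp: lookup_update lookup_add lookup_single when_def in_keys_iff)
  then show ?case using assms(2)[of f a b] update by auto
qed

context
  fixes h :: "complex \<Rightarrow> 'r::comm_ring_1"
  assumes h: "comm_ring_hom h"
begin

interpretation comm_ring_hom h by (rule h)

lemma insertion_superset:
  assumes "finite M" "Poly_Mapping.keys p \<subseteq> M"
  shows "insertion h x p = (\<Sum>m\<in>M. h (Poly_Mapping.lookup p m) * mono_val x m)"
  unfolding insertion_def using assms
  by (intro sum.mono_neutral_left) (auto simp: in_keys_iff)

lemma insertion_add: "insertion h x (p + q) = insertion h x p + insertion h x q"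
proof -
  let ?M = "Poly_Mapping.keys p \<union> Poly_Mapping.keys q"
  have "insertion h x (p + q) = (\<Sum>m\<in>?M. h (Poly_Mapping.lookup (p + q) m) * mono_val x m)"
    by (intro insertion_superset) (auto simp: Poly_Mapping.keys_add)
  also have "\<dots> = (\<Sum>m\<in>?M. h (Poly_Mapping.lookup p m) * mono_val x m) +
      (\<Sum>m\<in>?M. h (Poly_Mapping.lookup q m) * mono_val x m)"
    by (simp add: lookup_add hom_add algebra_simps sum.distrib)
  also have "\<dots> = insertion h x p + insertion h x q"
    by (subst (1 2) insertion_superset[of ?M]) auto
  finally show ?thesis .
qed

lemma insertion_zero: "insertion h x 0 = 0"
  by (simp add: insertion_def)

lemma insertion_single: "insertion h x (Poly_Mapping.single m c) = h c * mono_val x m"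
  by (cases "c = 0") (auto simp: insertion_def)

lemma insertion_single_mult:
  "insertion h x (Poly_Mapping.single m c * p) = h c * mono_val x m * insertion h x p"
proof (induction p rule: cpoly_induct)
  case zero
  then show ?case by (simp add: insertion_zero)
next
  case (single_plus m' c' p)
  then show ?case
    by (simp add: distrib_left insertion_add mult_single insertion_single mono_val_add hom_mult)
qed

lemma insertion_mult: "insertion h x (p * q) = insertion h x p * insertion h x q"
proof (induction p rule: cpoly_induct)
  case zero
  then show ?case by (simp add: insertion_zero)
next
  case (single_plus m' c' p)
  then show ?case
    by (simp add: distrib_right insertion_add insertion_single insertion_single_mult)
qed

lemma insertion_comm_ring_hom: "comm_ring_hom (insertion h x)"
  by unfold_locales
    (auto simp: insertion_zero insertion_add insertion_mult insertion_single simp flip: single_one)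

lemma insertion_Const: "insertion h x (Const c) = h c"
  by (simp add: Const_def insertion_single)

lemma insertion_Var: "insertion h x (Var v) = x v"
  by (simp add: Var_def insertion_single mono_val_single)

end

lemma comm_ring_hom_id: "comm_ring_hom (id :: complex \<Rightarrow> complex)"
  by unfold_locales auto

lemma comm_ring_hom_Const: "comm_ring_hom (Const :: complex \<Rightarrow> 'v cpoly)"
  by unfold_locales (auto simp: Const_def single_add mult_single single_zero)

interpretation Const: comm_ring_hom "Const :: complex \<Rightarrow> 'v cpoly"
  by (rule comm_ring_hom_Const)

interpretation poly_eval: comm_ring_hom "\<lambda>p. poly_eval p x"
  unfolding poly_eval_insertion by (rule insertion_comm_ring_hom[OF comm_ring_hom_id])

lemma poly_eval_Const [simp]: "poly_eval (Const c) x = c"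
  by (simp add: poly_eval_insertion insertion_Const[OF comm_ring_hom_id])

lemma poly_eval_Var [simp]: "poly_eval (Var v) x = x v"
  by (simp add: poly_eval_insertion insertion_Var[OF comm_ring_hom_id])

lemma insertion_cong:
  assumes "\<And>v. v \<in> poly_vars p \<Longrightarrow> x v = y v"
  shows "insertion h x p = insertion h y p"
proof -
  have "x v = y v" if "m \<in> Poly_Mapping.keys p" "v \<in> Poly_Mapping.keys m" for m v
    using assms that by (auto simp: poly_vars_def)
  then show ?thesis
    unfolding insertion_def mono_val_def by (auto intro!: sum.cong prod.cong)
qed

lemma poly_eval_cong:
  assumes "\<And>v. v \<in> poly_vars p \<Longrightarrow> x v = y v"
  shows "poly_eval p x = poly_eval p y"
  unfolding poly_eval_insertion by (rule insertion_cong[OF assms])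

section \<open>Subrings of polynomials\<close>

text \<open>The polynomial ring in the variables \<open>S\<close>, kept as a subset of one ambient
  ring so that the rings for different \<open>S\<close> can be compared. Ideals below are therefore
  relative to a carrier \<open>K\<close>.\<close>

definition polys :: "'v set \<Rightarrow> 'v cpoly set" where
  "polys S = {p. poly_vars p \<subseteq> S}"

lemma polys_iff: "p \<in> polys S \<longleftrightarrow> (\<forall>m\<in>Poly_Mapping.keys p. Poly_Mapping.keys m \<subseteq> S)"
  by (auto simp: polys_def poly_vars_def)

lemma polys_mono: "S \<subseteq> T \<Longrightarrow> polys S \<subseteq> polys T"
  by (auto simp: polys_def)

lemma polys_zero [simp]: "0 \<in> polys S"
  by (simp add: polys_iff)

lemma polys_Const [simp]: "Const c \<in> polys S"
  by (simp add: polys_iff Const_def)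

lemma polys_one [simp]: "1 \<in> polys S"
  by (simp add: polys_iff)

lemma polys_Var [simp]: "Var v \<in> polys S \<longleftrightarrow> v \<in> S"
  by (simp add: polys_iff Var_def)

lemma polys_add: "p \<in> polys S \<Longrightarrow> q \<in> polys S \<Longrightarrow> p + q \<in> polys S"
  unfolding polys_iff using Poly_Mapping.keys_add[of p q] by auto

lemma polys_uminus: "p \<in> polys S \<Longrightarrow> - p \<in> polys S"
  by (simp add: polys_iff keys_def)

lemma polys_diff: "p \<in> polys S \<Longrightarrow> q \<in> polys S \<Longrightarrow> p - q \<in> polys S"
  using polys_add[of p S "- q"] polys_uminus[of q S] by simp

lemma polys_mult: "p \<in> polys S \<Longrightarrow> q \<in> polys S \<Longrightarrow> p * q \<in> polys S"
proof (unfold polys_iff, rule ballI)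
  fix m
  assume *: "\<forall>m\<in>Poly_Mapping.keys p. Poly_Mapping.keys m \<subseteq> S"
    "\<forall>m\<in>Poly_Mapping.keys q. Poly_Mapping.keys m \<subseteq> S" "m \<in> Poly_Mapping.keys (p * q)"
  then obtain a b where "m = a + b" "a \<in> Poly_Mapping.keys p" "b \<in> Poly_Mapping.keys q"
    using keys_mult by blast
  then show "Poly_Mapping.keys m \<subseteq> S"
    using * Poly_Mapping.keys_add[of a b] by blast
qed

lemma polys_power: "p \<in> polys S \<Longrightarrow> p ^ k \<in> polys S"
  by (induction k) (auto intro: polys_mult)

lemma polys_sum: "(\<And>i. i \<in> I \<Longrightarrow> f i \<in> polys S) \<Longrightarrow> sum f I \<in> polys S"
  by (induction I rule: infinite_finite_induct) (auto intro: polys_add)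

lemma polys_prod: "(\<And>i. i \<in> I \<Longrightarrow> f i \<in> polys S) \<Longrightarrow> prod f I \<in> polys S"
  by (induction I rule: infinite_finite_induct) (auto intro: polys_mult)

lemma mono_val_Var: "mono_val Var m = Poly_Mapping.single m 1"
proof -
  have single_power: "Poly_Mapping.single (Poly_Mapping.single v 1) 1 ^ k =
      (Poly_Mapping.single (Poly_Mapping.single v k) 1 :: 'a cpoly)" for v :: 'a and k
    by (induction k) (auto simp: mult_single simp flip: single_add)
  have "(\<Prod>v\<in>V. Poly_Mapping.single (Poly_Mapping.single v (e v)) 1) =
      (Poly_Mapping.single (\<Sum>v\<in>V. Poly_Mapping.single v (e v)) 1 :: 'a cpoly)"
    for V :: "'a set" and e
    by (induction V rule: infinite_finite_induct) (auto simp: mult_single)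
  then have "mono_val Var m = (Poly_Mapping.single (\<Sum>v\<in>Poly_Mapping.keys m.
      Poly_Mapping.single v (Poly_Mapping.lookup m v)) 1 :: 'a cpoly)"
    by (simp add: mono_val_def Var_def single_power del: One_nat_def)
  moreover have "(\<Sum>v\<in>Poly_Mapping.keys m. Poly_Mapping.single v (Poly_Mapping.lookup m v)) = m"
    by (intro poly_mapping_eqI) (auto simp: lookup_sum lookup_single when_def in_keys_iff)
  ultimately show ?thesis by simp
qed

text \<open>Writes a polynomial as an expression in constants and variables;
  \<open>comm_ring_hom_eqI\<close> and the induction rule \<open>polys_induct\<close> rest on this
  form.\<close>

lemma insertion_Const_Var: "insertion Const Var p = p"
proof (induction p rule: cpoly_induct)
  case zero
  then show ?case by (simp add: insertion_def)
next
  case (single_plus m c p)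
  then show ?case
    by (simp add: insertion_add[OF comm_ring_hom_Const] insertion_single[OF comm_ring_hom_Const]
        mono_val_Var) (simp add: Const_def mult_single)
qed

lemma insertion_polys:
  assumes "p \<in> polys S" "\<And>v. v \<in> S \<Longrightarrow> x v \<in> polys T"
  shows "insertion Const x p \<in> polys T"
proof -
  have "x v \<in> polys T" if "m \<in> Poly_Mapping.keys p" "v \<in> Poly_Mapping.keys m" for m v
    using assms that unfolding polys_iff[of p] by blast
  then show ?thesis
    unfolding insertion_def mono_val_def
    by (intro polys_sum polys_mult polys_Const polys_prod polys_power)
qed

lemma comm_ring_hom_eqI:
  assumes f: "comm_ring_hom f" and g: "comm_ring_hom g"
    and "\<And>c. f (Const c) = g (Const c)" and "\<And>v. v \<in> S \<Longrightarrow> f (Var v) = g (Var v)" "p \<in> polys S"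
  shows "f p = g p"
proof -
  interpret f: comm_ring_hom f by (rule f)
  interpret g: comm_ring_hom g by (rule g)
  have "f (Var v) = g (Var v)" if "m \<in> Poly_Mapping.keys p" "v \<in> Poly_Mapping.keys m" for m v
    using assms(4,5) that unfolding polys_iff[of p] by blast
  then have "f (insertion Const Var p) = g (insertion Const Var p)"
    unfolding insertion_def mono_val_def using assms(3)
    by (auto simp: f.hom_sum g.hom_sum f.hom_mult g.hom_mult f.hom_prod g.hom_prod
        f.hom_power g.hom_power intro!: sum.cong prod.cong arg_cong2[where f = "(*)"])
  then show ?thesis by (simp add: insertion_Const_Var)
qed

section \<open>Linear algebra of polynomials\<close>

interpretation cpoly: vector_space "\<lambda>c (p :: 'v cpoly). Const c * p"
  by unfold_locales (auto simp: algebra_simps Const.hom_add Const.hom_mult)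

text \<open>Indexed rather than set-valued, because distinct indices may give equal polynomials;
  such a coincidence is itself a relation, with coefficients 1 and -1.\<close>

lemma family_dependent:
  fixes f :: "'i \<Rightarrow> 'v cpoly"
  assumes "finite I" "finite B" "\<And>i. i \<in> I \<Longrightarrow> f i \<in> cpoly.span B" "card B < card I"
  shows "\<exists>c. (\<exists>i\<in>I. c i \<noteq> 0) \<and> (\<Sum>i\<in>I. Const (c i) * f i) = 0"
proof (cases "inj_on f I")
  case False
  then obtain i j where ij: "i \<in> I" "j \<in> I" "i \<noteq> j" "f i = f j"
    by (auto simp: inj_on_def)
  let ?c = "\<lambda>k. if k = i then 1 else if k = j then -1 else (0::complex)"
  have "(\<Sum>k\<in>I. Const (?c k) * f k) = (\<Sum>k\<in>{i, j}. Const (?c k) * f k)"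
    using ij assms(1) by (intro sum.mono_neutral_right) auto
  also have "\<dots> = 0" using ij by (simp add: Const.hom_uminus)
  finally show ?thesis using ij by (intro exI[of _ ?c]) auto
next
  case True
  have "cpoly.dependent (f ` I)"
  proof (rule ccontr)
    assume "\<not> cpoly.dependent (f ` I)"
    from cpoly.independent_span_bound[OF assms(2) this] assms(3)
    have "card (f ` I) \<le> card B" by auto
    then show False using assms(4) True by (simp add: card_image)
  qed
  then obtain u where u: "\<exists>v\<in>f ` I. u v \<noteq> 0" "(\<Sum>v\<in>f ` I. Const (u v) * v) = 0"
    using cpoly.dependent_finite[of "f ` I"] assms(1) by auto
  then show ?thesis
    by (intro exI[of _ "u \<circ> f"]) (auto simp: sum.reindex[OF True])
qed

text \<open>Each exponent is bounded separately, instead of the total degree, so that the count is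
  exactly \<open>(D + 1) ^ card S\<close>.\<close>

definition box :: "'v set \<Rightarrow> nat \<Rightarrow> ('v \<Rightarrow>\<^sub>0 nat) set" where
  "box S D = {m. Poly_Mapping.keys m \<subseteq> S \<and> (\<forall>v. Poly_Mapping.lookup m v \<le> D)}"

lemma bij_betw_box:
  assumes "finite S"
  shows "bij_betw (\<lambda>m. restrict (Poly_Mapping.lookup m) S) (box S D) (S \<rightarrow>\<^sub>E {..D})"
proof (rule bij_betwI')
  fix m m' assume mm: "m \<in> box S D" "m' \<in> box S D"
  show "(restrict (Poly_Mapping.lookup m) S = restrict (Poly_Mapping.lookup m') S) = (m = m')"
  proof
    assume *: "restrict (Poly_Mapping.lookup m) S = restrict (Poly_Mapping.lookup m') S"
    show "m = m'"
    proof (rule poly_mapping_eqI)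
      fix k show "Poly_Mapping.lookup m k = Poly_Mapping.lookup m' k"
        using mm fun_cong[OF *, of k]
        by (cases "k \<in> S") (simp_all add: box_def in_keys_iff subset_iff restrict_def, metis bot_nat_0.not_eq_extremum)
    qed
  qed simp
next
  fix m assume "m \<in> box S D"
  then show "restrict (Poly_Mapping.lookup m) S \<in> S \<rightarrow>\<^sub>E {..D}" by (auto simp: box_def)
next
  fix e assume e: "e \<in> S \<rightarrow>\<^sub>E {..D}"
  define m where "m = Abs_poly_mapping (\<lambda>v. if v \<in> S then e v else (0::nat))"
  have l: "Poly_Mapping.lookup m = (\<lambda>v. if v \<in> S then e v else 0)"
    unfolding m_def by (rule lookup_Abs_poly_mapping) (use assms in auto)
  then have "m \<in> box S D" using e by (auto simp: box_def in_keys_iff split: if_splits)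
  moreover have "e = restrict (Poly_Mapping.lookup m) S"
    using e by (auto simp: l restrict_def fun_eq_iff PiE_def extensional_def)
  ultimately show "\<exists>m\<in>box S D. e = restrict (Poly_Mapping.lookup m) S" by blast
qed

lemma finite_box: "finite S \<Longrightarrow> finite (box S D)"
  using bij_betw_finite[OF bij_betw_box[of S D]] by (auto intro: finite_PiE)

lemma card_box: "finite S \<Longrightarrow> card (box S D) = (D + 1) ^ card S"
  using bij_betw_same_card[OF bij_betw_box[of S D]] by (simp add: card_PiE)

lemma box_zero [simp]: "0 \<in> box S D"
  by (simp add: box_def)

lemma box_add: "m \<in> box S D \<Longrightarrow> m' \<in> box S D' \<Longrightarrow> m + m' \<in> box S (D + D')"
  using Poly_Mapping.keys_add[of m m'] by (auto simp: box_def lookup_add intro: add_mono)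

lemma box_mono: "D \<le> D' \<Longrightarrow> box S D \<subseteq> box S D'"
  by (auto simp: box_def intro: order_trans)

lemma polys_keys_box:
  assumes "p \<in> polys S"
  obtains D where "Poly_Mapping.keys p \<subseteq> box S D"
proof -
  have "finite (\<Union>m\<in>Poly_Mapping.keys p. Poly_Mapping.lookup m ` Poly_Mapping.keys m)" (is "finite ?F")
    by auto
  then obtain D where D: "\<forall>k\<in>?F. k \<le> D" using finite_nat_set_iff_bounded_le by blast
  have "Poly_Mapping.lookup m v \<le> D" if "m \<in> Poly_Mapping.keys p" for m v
    using D that by (cases "v \<in> Poly_Mapping.keys m") (auto simp: in_keys_iff)
  then show thesis using assms by (intro that[of D]) (auto simp: box_def polys_iff)
qed

lemma keys_mult_box:
  assumes "Poly_Mapping.keys p \<subseteq> box S D" "Poly_Mapping.keys q \<subseteq> box S D'"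
  shows "Poly_Mapping.keys (p * q) \<subseteq> box S (D + D')"
proof
  fix m assume "m \<in> Poly_Mapping.keys (p * q)"
  then obtain a b where "m = a + b" "a \<in> Poly_Mapping.keys p" "b \<in> Poly_Mapping.keys q"
    using keys_mult[of p q] by auto
  then show "m \<in> box S (D + D')" using assms box_add[of a S D b D'] by auto
qed

lemma keys_power_box:
  assumes "Poly_Mapping.keys p \<subseteq> box S D"
  shows "Poly_Mapping.keys (p ^ k) \<subseteq> box S (k * D)"
proof (induction k)
  case (Suc k)
  then show ?case using keys_mult_box[OF assms Suc] by (simp add: add.commute)
qed simp

lemma keys_prod_box:
  assumes "\<And>i. i \<in> I \<Longrightarrow> Poly_Mapping.keys (f i) \<subseteq> box S (D i)"
  shows "Poly_Mapping.keys (prod f I) \<subseteq> box S (sum D I)"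
  using assms
proof (induction I rule: infinite_finite_induct)
  case (insert i I)
  then show ?case using keys_mult_box[of "f i" S "D i" "prod f I"] by simp
qed auto

definition monomials :: "('v \<Rightarrow>\<^sub>0 nat) set \<Rightarrow> 'v cpoly set" where
  "monomials M = (\<lambda>m. Poly_Mapping.single m 1) ` M"

lemma card_monomials: "card (monomials M) = card M"
proof -
  have "m = m'" if "Poly_Mapping.single m (1::complex) = Poly_Mapping.single m' 1"
    for m m' :: "'a \<Rightarrow>\<^sub>0 nat"
    using arg_cong[OF that, of Poly_Mapping.keys] by simp
  then show ?thesis unfolding monomials_def by (intro card_image) (auto simp: inj_on_def)
qed

lemma span_monomials: "cpoly.span (monomials M) = {p. Poly_Mapping.keys p \<subseteq> M}"
proof (intro equalityI subsetI)
  fix p assume "p \<in> cpoly.span (monomials M)"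
  then show "p \<in> {p. Poly_Mapping.keys p \<subseteq> M}"
  proof (induction rule: cpoly.span_induct_alt)
    case (step c x y)
    then obtain m where "x = Poly_Mapping.single m 1" "m \<in> M" by (auto simp: monomials_def)
    then have "Poly_Mapping.keys (Const c * x) \<subseteq> M" by (auto simp: Const_def mult_single)
    then show ?case using step Poly_Mapping.keys_add[of "Const c * x" y] by blast
  qed auto
next
  fix p :: "'a cpoly" assume "p \<in> {p. Poly_Mapping.keys p \<subseteq> M}"
  moreover have "p = (\<Sum>m\<in>Poly_Mapping.keys p. Const (Poly_Mapping.lookup p m) * Poly_Mapping.single m 1)"
    using insertion_Const_Var[of p] by (simp add: insertion_def mono_val_Var)
  moreover have "(\<Sum>m\<in>Poly_Mapping.keys p. Const (Poly_Mapping.lookup p m) * Poly_Mapping.single m 1)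
      \<in> cpoly.span (monomials M)" if "Poly_Mapping.keys p \<subseteq> M"
    using that by (intro cpoly.span_sum cpoly.span_scale cpoly.span_base) (auto simp: monomials_def)
  ultimately show "p \<in> cpoly.span (monomials M)" by simp
qed

section \<open>Prime ideals in subrings\<close>

definition subring_of :: "'a::comm_ring_1 set \<Rightarrow> bool" where
  "subring_of K \<longleftrightarrow> 1 \<in> K \<and> (\<forall>a\<in>K. \<forall>b\<in>K. a - b \<in> K \<and> a * b \<in> K)"

definition ideal_in :: "'a::comm_ring_1 set \<Rightarrow> 'a set \<Rightarrow> bool" where
  "ideal_in K I \<longleftrightarrow> I \<subseteq> K \<and> 0 \<in> I \<and> (\<forall>a\<in>I. \<forall>b\<in>I. a + b \<in> I) \<and> (\<forall>a\<in>K. \<forall>b\<in>I. a * b \<in> I)"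

definition prime_in :: "'a::comm_ring_1 set \<Rightarrow> 'a set \<Rightarrow> bool" where
  "prime_in K P \<longleftrightarrow> ideal_in K P \<and> 1 \<notin> P \<and> (\<forall>a\<in>K. \<forall>b\<in>K. a * b \<in> P \<longrightarrow> a \<in> P \<or> b \<in> P)"

definition ideal_adjoin :: "'a::comm_ring_1 set \<Rightarrow> 'a set \<Rightarrow> 'a \<Rightarrow> 'a set" where
  "ideal_adjoin K I f = {i + a * f | i a. i \<in> I \<and> a \<in> K}"

text \<open>\<open>k\<close> counts strict inclusions, so there are \<open>k + 1\<close> primes, the
  convention of \<open>zariski_dim\<close>. Requiring \<open>I \<subseteq> P i\<close> replaces the
  passage to the quotient by \<open>I\<close>.\<close>

definition prime_chain :: "'a::comm_ring_1 set \<Rightarrow> 'a set \<Rightarrow> nat \<Rightarrow> (nat \<Rightarrow> 'a set) \<Rightarrow> bool" where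
  "prime_chain K I k P \<longleftrightarrow> (\<forall>i\<le>k. prime_in K (P i) \<and> I \<subseteq> P i) \<and> (\<forall>i<k. P i \<subset> P (Suc i))"

lemma subring_of_polys: "subring_of (polys S)"
  by (auto simp: subring_of_def intro: polys_diff polys_mult)

locale subring =
  fixes K :: "'a::comm_ring_1 set"
  assumes subring: "subring_of K"
begin

lemma one: "1 \<in> K" and diff: "a \<in> K \<Longrightarrow> b \<in> K \<Longrightarrow> a - b \<in> K"
  and mult: "a \<in> K \<Longrightarrow> b \<in> K \<Longrightarrow> a * b \<in> K"
  using subring by (auto simp: subring_of_def)

lemma zero: "0 \<in> K"
  using diff[OF one one] by simp

lemma uminus: "a \<in> K \<Longrightarrow> - a \<in> K"
  using diff[OF zero] by force

lemma add: "a \<in> K \<Longrightarrow> b \<in> K \<Longrightarrow> a + b \<in> K"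
  using diff[of a "- b"] uminus by force

lemma power: "a \<in> K \<Longrightarrow> a ^ n \<in> K"
  by (induction n) (auto intro: one mult)

end

locale ring_ideal = subring K for K :: "'a::comm_ring_1 set" +
  fixes I :: "'a set"
  assumes ideal: "ideal_in K I"
begin

lemma I_sub: "a \<in> I \<Longrightarrow> a \<in> K" and I_zero: "0 \<in> I"
  and I_add: "a \<in> I \<Longrightarrow> b \<in> I \<Longrightarrow> a + b \<in> I"
  and I_mult: "c \<in> K \<Longrightarrow> a \<in> I \<Longrightarrow> c * a \<in> I"
  using ideal by (auto simp: ideal_in_def)

lemma I_mult': "c \<in> K \<Longrightarrow> a \<in> I \<Longrightarrow> a * c \<in> I"
  using I_mult[of c a] by (simp add: mult.commute)

lemma I_uminus: "a \<in> I \<Longrightarrow> - a \<in> I"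
  using I_mult[of "-1" a] one uminus by simp

lemma I_diff: "a \<in> I \<Longrightarrow> b \<in> I \<Longrightarrow> a - b \<in> I"
  using I_add[of a "- b"] I_uminus by simp

lemma I_sum: "(\<And>i. i \<in> A \<Longrightarrow> f i \<in> I) \<Longrightarrow> sum f A \<in> I"
  by (induction A rule: infinite_finite_induct) (auto intro: I_zero I_add)

lemma mem_congI: "a - b \<in> I \<Longrightarrow> b \<in> I \<Longrightarrow> a \<in> I"
  using I_add[of "a - b" b] by simp

lemma adjoin_ideal:
  assumes "f \<in> K"
  shows "ideal_in K (ideal_adjoin K I f)"
  unfolding ideal_in_def
proof (intro conjI ballI subsetI)
  fix x assume "x \<in> ideal_adjoin K I f"
  then show "x \<in> K" using assms by (auto simp: ideal_adjoin_def intro: add mult I_sub)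
next
  show "0 \<in> ideal_adjoin K I f"
    unfolding ideal_adjoin_def by (intro CollectI exI[of _ 0]) (auto intro: zero I_zero)
next
  fix x y assume "x \<in> ideal_adjoin K I f" "y \<in> ideal_adjoin K I f"
  then obtain i a j b where *: "x = i + a * f" "y = j + b * f" "i \<in> I" "j \<in> I" "a \<in> K" "b \<in> K"
    unfolding ideal_adjoin_def by blast
  show "x + y \<in> ideal_adjoin K I f" unfolding ideal_adjoin_def
    by (rule CollectI, rule exI[of _ "i + j"], rule exI[of _ "a + b"])
      (use * in \<open>auto simp: algebra_simps intro: add I_add\<close>)
next
  fix c x assume "c \<in> K" "x \<in> ideal_adjoin K I f"
  then obtain i a where *: "x = i + a * f" "i \<in> I" "a \<in> K" "c \<in> K"
    unfolding ideal_adjoin_def by blast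
  show "c * x \<in> ideal_adjoin K I f" unfolding ideal_adjoin_def
    by (rule CollectI, rule exI[of _ "c * i"], rule exI[of _ "c * a"])
      (use * in \<open>auto simp: algebra_simps intro: mult I_mult\<close>)
qed

lemma adjoin_superset: "I \<subseteq> ideal_adjoin K I f"
proof
  fix i assume "i \<in> I"
  then show "i \<in> ideal_adjoin K I f"
    unfolding ideal_adjoin_def by (intro CollectI exI[of _ i] exI[of _ 0]) (auto intro: zero)
qed

lemma adjoin_mem: "f \<in> ideal_adjoin K I f"
  unfolding ideal_adjoin_def by (intro CollectI exI[of _ 0] exI[of _ 1]) (auto intro: one I_zero)

end

lemma prime_in_ideal: "prime_in K P \<Longrightarrow> ideal_in K P"
  by (simp add: prime_in_def)

context subring
begin

lemma ring_idealI: "ideal_in K I \<Longrightarrow> ring_ideal K I"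
  using subring by (simp add: ring_ideal_def ring_ideal_axioms_def subring_def)

lemma prime_power: "prime_in K P \<Longrightarrow> f \<in> K \<Longrightarrow> f ^ n \<in> P \<Longrightarrow> f \<in> P"
proof (induction n)
  case (Suc n)
  then show ?case using power[of f n] by (auto simp: prime_in_def)
qed (auto simp: prime_in_def)

lemma maximal_avoiding:
  assumes I: "ideal_in K I" and M: "I \<inter> M = {}"
  obtains P where "ideal_in K P" "I \<subseteq> P" "P \<inter> M = {}"
    "\<And>J. ideal_in K J \<Longrightarrow> P \<subseteq> J \<Longrightarrow> J \<inter> M = {} \<Longrightarrow> J = P"
proof -
  let ?F = "{J. ideal_in K J \<and> I \<subseteq> J \<and> J \<inter> M = {}}"
  have "\<exists>P\<in>?F. \<forall>J\<in>?F. P \<subseteq> J \<longrightarrow> J = P"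
  proof (rule subset_Zorn_nonempty)
    show "?F \<noteq> {}" using assms by auto
  next
    fix C assume C: "C \<noteq> {}" "subset.chain ?F C"
    have id: "ideal_in K J" if "J \<in> C" for J using C that by (auto simp: subset.chain_def)
    have "ideal_in K (\<Union>C)" unfolding ideal_in_def
    proof (intro conjI ballI subsetI)
      fix x y assume "x \<in> \<Union>C" "y \<in> \<Union>C"
      then obtain J J' where J: "J \<in> C" "J' \<in> C" "x \<in> J" "y \<in> J'" by auto
      then have "J \<subseteq> J' \<or> J' \<subseteq> J" using C unfolding subset.chain_def by blast
      then have "\<exists>J\<in>C. x \<in> J \<and> y \<in> J" using J by blast
      then show "x + y \<in> \<Union>C" using id by (auto simp: ideal_in_def)
    qed (use C(1) id[unfolded ideal_in_def] in blast)+
    then show "\<Union>C \<in> ?F" using C by (auto simp: subset.chain_def)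
  qed
  then obtain P where P: "P \<in> ?F" "\<forall>J\<in>?F. P \<subseteq> J \<longrightarrow> J = P" by blast
  show thesis using P(1) P(2)[rule_format] by (intro that[of P]) auto
qed

lemma adjoin_meets:
  assumes P: "ideal_in K P"
    and max: "\<And>J. ideal_in K J \<Longrightarrow> P \<subseteq> J \<Longrightarrow> J \<inter> M = {} \<Longrightarrow> J = P"
    and f: "f \<in> K" "f \<notin> P"
  shows "\<exists>i\<in>P. \<exists>c\<in>K. i + c * f \<in> M"
proof (rule ccontr)
  interpret P: ring_ideal K P by (rule ring_idealI[OF P])
  assume "\<not> ?thesis"
  then have "ideal_adjoin K P f \<inter> M = {}" by (auto simp: ideal_adjoin_def)
  then show False
    using max[OF P.adjoin_ideal P.adjoin_superset] P.adjoin_mem f by blast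
qed

text \<open>Krull's argument: if neither factor lies in \<open>P\<close>, both enlarged ideals meet
  \<open>M\<close>, and the product of the two elements found there lies in \<open>P\<close>.
  Applied with \<open>M = A - P\<close> for lying over and with the powers of \<open>f\<close> for
  the Nullstellensatz.\<close>

lemma maximal_avoiding_prime:
  assumes P: "ideal_in K P" and PM: "P \<inter> M = {}"
    and max: "\<And>J. ideal_in K J \<Longrightarrow> P \<subseteq> J \<Longrightarrow> J \<inter> M = {} \<Longrightarrow> J = P"
    and M: "1 \<in> M" "\<And>a b. a \<in> M \<Longrightarrow> b \<in> M \<Longrightarrow> a * b \<in> M"
  shows "prime_in K P"
proof -
  interpret P: ring_ideal K P by (rule ring_idealI[OF P])
  have "a \<in> P \<or> b \<in> P" if ab: "a \<in> K" "b \<in> K" "a * b \<in> P" for a b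
  proof (rule ccontr)
    assume *: "\<not> (a \<in> P \<or> b \<in> P)"
    obtain i c j d where e: "i \<in> P" "c \<in> K" "i + c * a \<in> M" "j \<in> P" "d \<in> K" "j + d * b \<in> M"
    proof -
      have "\<exists>i\<in>P. \<exists>c\<in>K. i + c * f \<in> M" if "f \<in> K" "f \<notin> P" for f
        by (rule adjoin_meets[OF P max that])
      from this[of a] this[of b] show ?thesis using that ab * by blast
    qed
    have "(i + c * a) * (j + d * b) = i * (j + d * b) + c * a * j + c * d * (a * b)"
      by (simp add: algebra_simps)
    also have "\<dots> \<in> P"
    proof (intro P.I_add)
      show "i * (j + d * b) \<in> P" using e ab by (intro P.I_mult') (auto intro: add mult P.I_sub)
      show "c * a * j \<in> P" "c * d * (a * b) \<in> P" using e ab by (auto intro: P.I_mult mult)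
    qed
    finally show False using M(2)[OF e(3,6)] PM by blast
  qed
  then show ?thesis using P PM M(1) by (auto simp: prime_in_def)
qed

end

section \<open>Adjoining a square root\<close>

text \<open>Modulo \<open>Q\<close>, the ring \<open>B\<close> is \<open>A + A y\<close> with
  \<open>y * y = q\<close>. Over such an extension lying over and incomparability reduce to
  computations with norms, without a general theory of integral extensions.\<close>

locale square_root_extension = A: subring A + B: subring B for A B :: "'a::comm_ring_1 set" +
  fixes Q :: "'a set" and y q :: 'a
  assumes AB: "A \<subseteq> B" and Q: "ideal_in B Q" and y: "y \<in> B" and q: "q \<in> A"
    and y2: "y * y - q \<in> Q"
    and gen: "\<And>b. b \<in> B \<Longrightarrow> \<exists>a\<in>A. \<exists>a'\<in>A. b - (a + a' * y) \<in> Q"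
begin

sublocale Q: ring_ideal B Q by (rule B.ring_idealI[OF Q])

lemma contract_ideal: "ideal_in B J \<Longrightarrow> ideal_in A (J \<inter> A)"
  using AB by (auto simp: ideal_in_def intro: A.add A.mult A.zero)

lemma contract_prime: "prime_in B J \<Longrightarrow> prime_in A (J \<inter> A)"
  using AB contract_ideal by (auto simp: prime_in_def intro: A.mult)

text \<open>With \<open>x = i + u + v * y\<close>, the square of \<open>x - u\<close> is congruent
  to \<open>v * v * q\<close> modulo \<open>Q\<close>, hence lies in \<open>P\<close>; primality of
  \<open>P\<close> then gives \<open>x - u \<in> P\<close>.\<close>

lemma extended_prime_contracts:
  assumes P: "prime_in A P" and QP: "Q \<inter> A \<subseteq> P"
    and i: "i \<in> Q" and u: "u \<in> P" and v: "v \<in> P" and x: "i + u + v * y \<in> A"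
  shows "i + u + v * y \<in> P"
proof -
  interpret P: ring_ideal A P using P by (intro A.ring_idealI prime_in_ideal)
  let ?x = "i + u + v * y"
  have uv: "u \<in> A" "v \<in> A" using u v P.I_sub by auto
  have "(?x - u) * (?x - u) - v * v * q = i * (i + v * y + v * y) + v * v * (y * y - q)"
    by (simp add: algebra_simps)
  also have "\<dots> \<in> Q"
  proof (rule Q.I_add)
    show "i * (i + v * y + v * y) \<in> Q"
      using i uv AB y by (intro Q.I_mult' B.add B.mult) (auto intro: Q.I_sub)
    show "v * v * (y * y - q) \<in> Q" using uv AB y2 by (intro Q.I_mult B.mult) auto
  qed
  finally have "(?x - u) * (?x - u) - v * v * q \<in> P"
    using QP A.diff[OF A.mult[OF A.diff[OF x uv(1)] A.diff[OF x uv(1)]]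
      A.mult[OF A.mult[OF uv(2) uv(2)] q]] by blast
  moreover have "v * v * q \<in> P" using v uv q by (auto intro: P.I_mult')
  ultimately have "(?x - u) * (?x - u) \<in> P" by (rule P.mem_congI)
  then have "?x - u \<in> P" using P A.diff[OF x uv(1)] unfolding prime_in_def by blast
  then show ?thesis using u by (rule P.mem_congI)
qed

text \<open>The extended ideal \<open>Q + P + P y\<close> meets \<open>A\<close> only in
  \<open>P\<close>, so it avoids \<open>A - P\<close>; an ideal above it that is maximal with this
  property is prime and contracts to \<open>P\<close>.\<close>

lemma lying_over:
  assumes P: "prime_in A P" and QP: "Q \<inter> A \<subseteq> P"
  obtains P' where "prime_in B P'" "Q \<subseteq> P'" "P' \<inter> A = P"
proof -
  interpret P: ring_ideal A P using P by (intro A.ring_idealI prime_in_ideal)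
  define E where "E = {i + u + v * y | i u v. i \<in> Q \<and> u \<in> P \<and> v \<in> P}"
  have EI: "i + u + v * y \<in> E" if "i \<in> Q" "u \<in> P" "v \<in> P" for i u v
    using that by (auto simp: E_def)
  have E: "ideal_in B E" unfolding ideal_in_def
  proof (intro conjI ballI subsetI)
    fix x assume "x \<in> E"
    then obtain i u v where "x = i + u + v * y" "i \<in> Q" "u \<in> P" "v \<in> P"
      unfolding E_def by blast
    moreover from this have "i \<in> B" "u \<in> B" "v \<in> B" using AB P.I_sub Q.I_sub by auto
    ultimately show "x \<in> B" using y by (auto intro: B.add B.mult)
  next
    show "0 \<in> E" using EI[OF Q.I_zero P.I_zero P.I_zero] by simp
  next
    fix x x' assume "x \<in> E" "x' \<in> E"
    then obtain i u v i' u' v' where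
      *: "x = i + u + v * y" "x' = i' + u' + v' * y" "i \<in> Q" "i' \<in> Q" "u \<in> P" "u' \<in> P" "v \<in> P" "v' \<in> P"
      unfolding E_def by blast
    have "x + x' = (i + i') + (u + u') + (v + v') * y" by (simp add: * algebra_simps)
    also have "\<dots> \<in> E" by (intro EI Q.I_add P.I_add *)
    finally show "x + x' \<in> E" .
  next
    fix b x assume b: "b \<in> B" and "x \<in> E"
    then obtain i u v where *: "x = i + u + v * y" "i \<in> Q" "u \<in> P" "v \<in> P"
      unfolding E_def by blast
    obtain a a' where a: "a \<in> A" "a' \<in> A" "b - (a + a' * y) \<in> Q" using gen[OF b] by blast
    have uv: "u \<in> B" "v \<in> B" "a \<in> B" "a' \<in> B" using * a AB P.I_sub by auto
    \<comment> \<open>\<open>i'\<close> collects the errors in \<open>Q\<close> made by replacing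
      \<open>b\<close> by \<open>a + a' * y\<close> and \<open>y * y\<close> by
      \<open>q\<close>.\<close>
    define i' where "i' = b * i + (b - (a + a' * y)) * (u + v * y) + (a' * v) * (y * y - q)"
    have "b * x = i' + (a * u + a' * v * q) + (a * v + a' * u) * y"
      by (simp add: * i'_def algebra_simps)
    moreover have "i' \<in> Q" unfolding i'_def
    proof (intro Q.I_add)
      show "b * i \<in> Q" using b *(2) by (rule Q.I_mult)
      show "(b - (a + a' * y)) * (u + v * y) \<in> Q"
        using uv y by (intro Q.I_mult'[OF _ a(3)] B.add B.mult)
      show "a' * v * (y * y - q) \<in> Q" using uv y2 by (intro Q.I_mult B.mult)
    qed
    moreover have "a * u + a' * v * q \<in> P"
      by (rule P.I_add[OF P.I_mult[OF a(1) *(3)] P.I_mult'[OF q P.I_mult[OF a(2) *(4)]]])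
    moreover have "a * v + a' * u \<in> P"
      by (rule P.I_add[OF P.I_mult[OF a(1) *(4)] P.I_mult[OF a(2) *(3)]])
    ultimately show "b * x \<in> E" using EI by simp
  qed
  have "P \<subseteq> E" using EI[OF Q.I_zero _ P.I_zero] by auto
  have "Q \<subseteq> E" using EI[OF _ P.I_zero P.I_zero] by auto
  have EP: "E \<inter> (A - P) = {}"
    using extended_prime_contracts[OF P QP] by (auto simp: E_def)
  obtain P' where P': "ideal_in B P'" "E \<subseteq> P'" "P' \<inter> (A - P) = {}"
    "\<And>J. ideal_in B J \<Longrightarrow> P' \<subseteq> J \<Longrightarrow> J \<inter> (A - P) = {} \<Longrightarrow> J = P'"
    using B.maximal_avoiding[OF E EP] by blast
  have "prime_in B P'"
    by (rule B.maximal_avoiding_prime[OF P'(1,3,4)])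
      (use P A.one A.mult in \<open>auto simp: prime_in_def\<close>)
  moreover have "P' \<inter> A = P" using P'(2,3) \<open>P \<subseteq> E\<close> P.I_sub by blast
  ultimately show thesis using that \<open>Q \<subseteq> E\<close> P'(2) by blast
qed

text \<open>For \<open>b\<close> in \<open>P' - P\<close>, congruent to \<open>a + a' * y\<close>,
  the conjugate is congruent to \<open>a + a - b\<close> and the product of the two to the norm
  \<open>N \<in> A\<close>. The norm lies in \<open>P'\<close>, hence in \<open>P\<close>, so
  primality puts the conjugate into \<open>P\<close>; then \<open>a + a \<in> P'\<close>, and
  halving yields \<open>a \<in> P\<close> and finally \<open>b \<in> P\<close>.\<close>

lemma incomparable:
  assumes P: "prime_in B P" and P': "prime_in B P'" and "Q \<subseteq> P" "P \<subseteq> P'" "P \<inter> A = P' \<inter> A"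
    and two: "\<And>a. a \<in> A \<Longrightarrow> a + a \<in> P' \<Longrightarrow> a \<in> P'"
  shows "P = P'"
proof (rule ccontr)
  interpret P: ring_ideal B P using P by (intro B.ring_idealI prime_in_ideal)
  interpret P': ring_ideal B P' using P' by (intro B.ring_idealI prime_in_ideal)
  assume "P \<noteq> P'"
  then obtain b where b: "b \<in> P'" "b \<notin> P" using assms by auto
  then have bB: "b \<in> B" using P'.I_sub by auto
  obtain a a' where a: "a \<in> A" "a' \<in> A" "b - (a + a' * y) \<in> Q" using gen[OF bB] by blast
  define N where "N = a * a - a' * a' * q"
  have aB: "a \<in> B" "a' \<in> B" using a AB by auto
  have NA: "N \<in> A" unfolding N_def using a q by (intro A.diff A.mult)
  have "b * (a + a - b) - N =
      (b - (a + a' * y)) * (a - b - a' * y) - (a' * a') * (y * y - q)"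
    by (simp add: N_def algebra_simps)
  also have "\<dots> \<in> Q"
  proof (rule Q.I_diff)
    show "(b - (a + a' * y)) * (a - b - a' * y) \<in> Q"
      using aB bB y by (intro Q.I_mult'[OF _ a(3)] B.diff B.mult)
    show "a' * a' * (y * y - q) \<in> Q" using aB y2 by (intro Q.I_mult B.mult)
  qed
  finally have N: "b * (a + a - b) - N \<in> Q" .
  have ab: "a + a - b \<in> B" using aB bB by (intro B.diff B.add)
  have "N = b * (a + a - b) - (b * (a + a - b) - N)" by simp
  also have "\<dots> \<in> P'"
  proof (rule P'.I_diff)
    show "b * (a + a - b) \<in> P'" using ab b(1) by (rule P'.I_mult')
    show "b * (a + a - b) - N \<in> P'" using N assms(3,4) by blast
  qed
  finally have "N \<in> P" using NA assms(5) by blast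
  have "b * (a + a - b) - N \<in> P" using N assms(3) by blast
  then have "b * (a + a - b) \<in> P" using \<open>N \<in> P\<close> by (rule P.mem_congI)
  then have *: "a + a - b \<in> P" using P b bB ab unfolding prime_in_def by blast
  then have "a + a - b \<in> P'" using assms(4) by auto
  then have "a + a \<in> P'" using b(1) by (rule P'.mem_congI)
  then have "a \<in> P" using two a assms(5) by blast
  then have "a + a - (a + a - b) \<in> P" by (intro P.I_diff P.I_add *)
  then show False using b by simp
qed

lemma square_root_extension_mono:
  assumes "ideal_in B Q'" "Q \<subseteq> Q'"
  shows "square_root_extension A B Q' y q"
  by unfold_locales (use assms AB y q y2 gen in \<open>auto, blast\<close>)

theorem prime_chain_contract:
  assumes two: "\<And>a P. prime_in B P \<Longrightarrow> a \<in> A \<Longrightarrow> a + a \<in> P \<Longrightarrow> a \<in> P"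
    and P: "prime_chain B Q k P"
  shows "prime_chain A (Q \<inter> A) k (\<lambda>i. P i \<inter> A)"
  unfolding prime_chain_def
proof (intro conjI allI impI)
  fix i assume "i \<le> k"
  then show "prime_in A (P i \<inter> A)" "Q \<inter> A \<subseteq> P i \<inter> A"
    using P contract_prime by (auto simp: prime_chain_def)
next
  fix i assume "i < k"
  then have "prime_in B (P i)" "prime_in B (P (Suc i))" "Q \<subseteq> P i" "P i \<subset> P (Suc i)"
    using P by (auto simp: prime_chain_def)
  then show "P i \<inter> A \<subset> P (Suc i) \<inter> A"
    using incomparable[of "P i" "P (Suc i)"] two by blast
qed

text \<open>Going up: at each step lying over is applied with the last prime \<open>P' k\<close> in
  the role of \<open>Q\<close>, so the new prime contains it.\<close>

theorem prime_chain_lift: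
  assumes "prime_chain A (Q \<inter> A) k P"
  shows "\<exists>P'. prime_chain B Q k P' \<and> (\<forall>i\<le>k. P' i \<inter> A = P i)"
  using assms
proof (induction k)
  case 0
  then have "prime_in A (P 0)" "Q \<inter> A \<subseteq> P 0" by (auto simp: prime_chain_def)
  then obtain P' where "prime_in B P'" "Q \<subseteq> P'" "P' \<inter> A = P 0" by (rule lying_over)
  then show ?case by (intro exI[of _ "\<lambda>_. P'"]) (auto simp: prime_chain_def)
next
  case (Suc k)
  have "prime_chain A (Q \<inter> A) k P" using Suc.prems by (auto simp: prime_chain_def)
  then obtain P' where P': "prime_chain B Q k P'" "\<forall>i\<le>k. P' i \<inter> A = P i"
    using Suc.IH by blast
  have k: "prime_in B (P' k)" "Q \<subseteq> P' k" "P' k \<inter> A = P k" using P' by (auto simp: prime_chain_def)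
  have PS: "prime_in A (P (Suc k))" "P k \<subset> P (Suc k)"
    using Suc.prems by (auto simp: prime_chain_def)
  interpret k: square_root_extension A B "P' k" y q
    by (rule square_root_extension_mono[OF prime_in_ideal[OF k(1)] k(2)])
  have "P' k \<inter> A \<subseteq> P (Suc k)" using k PS by auto
  then obtain R where R: "prime_in B R" "P' k \<subseteq> R" "R \<inter> A = P (Suc k)"
    using k.lying_over[OF PS(1)] by blast
  have RR: "P' k \<subset> R" using R PS k by blast
  have "prime_chain B Q (Suc k) (P'(Suc k := R))"
    using P'(1) R RR k(2) unfolding prime_chain_def by (simp add: less_Suc_eq le_Suc_eq) blast
  moreover have "\<forall>i\<le>Suc k. (P'(Suc k := R)) i \<inter> A = P i"
    using P'(2) R by (auto simp: le_Suc_eq)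
  ultimately show ?case by blast
qed

end

section \<open>The Nullstellensatz over the complex numbers\<close>

text \<open>Countably many finite fibres cannot cover the uncountable set of complex numbers. This
  is the form in which uncountability enters the Nullstellensatz.\<close>

lemma infinite_fibre:
  fixes f :: "complex \<Rightarrow> 'b::countable"
  obtains b where "infinite {c. f c = b}"
proof -
  have "\<exists>b. infinite {c. f c = b}"
  proof (rule ccontr)
    assume "\<nexists>b. infinite {c. f c = b}"
    then have "countable (\<Union>b. {c. f c = b})" by (intro countable_UN) (auto intro: countable_finite)
    moreover have "(\<Union>b. {c. f c = b}) = UNIV" by auto
    ultimately show False using uncountable_UNIV_complex by simp
  qed
  then show thesis using that by blast
qed

definition univariate :: "'v \<Rightarrow> complex poly \<Rightarrow> 'v cpoly" where
  "univariate v G = poly (map_poly Const G) (Var v)"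

lemma univariate_hom: "comm_ring_hom (univariate v)"
proof -
  interpret m: map_poly_comm_ring_hom "Const :: complex \<Rightarrow> 'a cpoly" ..
  show ?thesis
    by unfold_locales
      (auto simp: univariate_def m.hom_add m.hom_mult)
qed

lemma univariate_pCons: "univariate v (pCons a G) = Const a + Var v * univariate v G"
  by (cases "pCons a G = 0") (auto simp: univariate_def map_poly_pCons)

lemma univariate_polys: "v \<in> S \<Longrightarrow> univariate v G \<in> polys S"
proof (induction G)
  case 0
  then show ?case by (simp add: univariate_def)
next
  case (pCons a G)
  then show ?case unfolding univariate_pCons by (intro polys_add polys_mult) auto
qed

text \<open>The fundamental theorem of algebra splits off a linear factor; primality puts either
  this factor or the cofactor, of smaller degree, into \<open>P\<close>.\<close>

lemma prime_univariate_root: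
  assumes P: "prime_in (polys S) P" and v: "v \<in> S" and "G \<noteq> 0" "univariate v G \<in> P"
  shows "\<exists>a. Var v - Const a \<in> P"
  using assms(3-)
proof (induction "Polynomial.degree G" arbitrary: G rule: less_induct)
  case less
  interpret u: comm_ring_hom "univariate v :: complex poly \<Rightarrow> 'a cpoly" by (rule univariate_hom)
  interpret K: subring "polys S" by unfold_locales (rule subring_of_polys)
  interpret P: ring_ideal "polys S" P using P by (intro K.ring_idealI prime_in_ideal)
  show ?case
  proof (cases "Polynomial.degree G = 0")
    case True
    then obtain c where c: "G = [:c:]" using degree_eq_zeroE by blast
    then have "Const c \<in> P" "c \<noteq> 0" using less.prems by (auto simp: univariate_pCons)
    then have "Const (inverse c) * Const c \<in> P" by (intro P.I_mult) auto
    then have "1 \<in> P" using \<open>c \<noteq> 0\<close> by (simp flip: Const.hom_mult)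
    then show ?thesis using P by (auto simp: prime_in_def)
  next
    case False
    then have "\<not> constant (poly G)" by (simp add: constant_degree)
    then obtain a where "poly G a = 0" using fundamental_theorem_of_algebra by blast
    then obtain H where H: "G = [:- a, 1:] * H" by (auto simp: poly_eq_0_iff_dvd elim: dvdE)
    then have "H \<noteq> 0" using less.prems(1) by auto
    then have "Polynomial.degree H < Polynomial.degree G"
      unfolding H by (subst degree_mult_eq) auto
    have "univariate v G = (Var v - Const a) * univariate v H"
      by (simp only: H u.hom_mult) (simp add: univariate_pCons u.hom_zero Const.hom_uminus algebra_simps)
    then have "Var v - Const a \<in> P \<or> univariate v H \<in> P"
      using less.prems P v univariate_polys[OF v, of H] polys_diff[of "Var v" S "Const a"]
      unfolding prime_in_def by auto
    then show ?thesis
      using less.hyps[OF \<open>Polynomial.degree H < Polynomial.degree G\<close> \<open>H \<noteq> 0\<close>] by blast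
  qed
qed

text \<open>If no \<open>x\<^sub>v - c\<close> were in \<open>M\<close>, then uncountably many \<open>x\<^sub>v - c\<close> would have inverses modulo
  \<open>M\<close> up to a power of \<open>f\<close>; infinitely many of these share a finite-dimensional space.\<close>

lemma maximal_avoiding_powers_coordinate:
  fixes f :: "'v cpoly"
  assumes S: "finite S" and v: "v \<in> S" and f: "f \<in> polys S"
    and M: "prime_in (polys S) M" and fM: "f \<notin> M"
    and inv: "\<And>g. g \<in> polys S \<Longrightarrow> g \<notin> M \<Longrightarrow> \<exists>i\<in>M. \<exists>q\<in>polys S. i + q * g \<in> range (\<lambda>k. f ^ k)"
  shows "\<exists>a. Var v - Const a \<in> M"
proof (rule ccontr)
  assume no: "\<nexists>a. Var v - Const a \<in> M"
  let ?X = "\<lambda>c. Var v - Const c"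
  interpret u: comm_ring_hom "univariate v :: complex poly \<Rightarrow> 'v cpoly" by (rule univariate_hom)
  interpret K: subring "polys S" by unfold_locales (rule subring_of_polys)
  interpret M: ring_ideal "polys S" M using M by (intro K.ring_idealI prime_in_ideal)
  have X: "?X c \<in> polys S" for c using v by (intro polys_diff) auto
  have "\<exists>i q k D. i \<in> M \<and> q \<in> polys S \<and> i + q * ?X c = f ^ k \<and> Poly_Mapping.keys q \<subseteq> box S D" for c
  proof -
    obtain i q k where iq: "i \<in> M" "q \<in> polys S" "i + q * ?X c = f ^ k"
      using inv[OF X, of c] no by (auto simp: image_iff)
    obtain D where "Poly_Mapping.keys q \<subseteq> box S D" using polys_keys_box[OF iq(2)] .
    then show ?thesis using iq by blast
  qed
  then obtain i q k D where iq: "\<And>c. i c \<in> M" "\<And>c. q c \<in> polys S"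
      "\<And>c. i c + q c * ?X c = f ^ k c" "\<And>c. Poly_Mapping.keys (q c) \<subseteq> box S (D c)"
    by metis
  \<comment> \<open>Exponents of \<open>f\<close> and box sizes range over a countable set, so one
    pair serves infinitely many \<open>c\<close>, more than the dimension of the space containing
    the \<open>q c\<close>.\<close>
  obtain k0 D0 where kD: "infinite {c. (k c, D c) = (k0, D0)}"
    using infinite_fibre[of "\<lambda>c. (k c, D c)"] by (metis surj_pair)
  then obtain C where C: "C \<subseteq> {c. (k c, D c) = (k0, D0)}" "finite C"
      "card C = Suc (card (monomials (box S (D0))))"
    using infinite_arbitrarily_large[OF kD, of "Suc (card (monomials (box S (D0))))"] by blast
  have "\<exists>l. (\<exists>c\<in>C. l c \<noteq> 0) \<and> (\<Sum>c\<in>C. Const (l c) * q c) = 0"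
  proof (rule family_dependent)
    show "finite C" by (rule C)
    show "finite (monomials (box S (D0)))" using S by (simp add: monomials_def finite_box)
    show "card (monomials (box S (D0))) < card C" using C by simp
    show "q c \<in> cpoly.span (monomials (box S (D0)))" if "c \<in> C" for c
    proof -
      have "D c = D0" using C(1) that by auto
      then show ?thesis using iq(4)[of c] unfolding span_monomials by simp
    qed
  qed
  then obtain l c0 where l: "c0 \<in> C" "l c0 \<noteq> 0" "(\<Sum>c\<in>C. Const (l c) * q c) = 0" by blast
  \<comment> \<open>The numerator of the sum of \<open>l c / (x - c)\<close> over the common
    denominator. At \<open>c0\<close> only the summand of \<open>c0\<close> survives, so
    \<open>G\<close> is nonzero.\<close>
  define G where "G = (\<Sum>c\<in>C. [:l c:] * (\<Prod>d\<in>C - {c}. [:- d, 1:]))"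
  have "poly G c0 = (\<Sum>c\<in>C. l c * (\<Prod>d\<in>C - {c}. c0 - d))"
    by (simp add: G_def poly_sum poly_prod)
  also have "\<dots> = (\<Sum>c\<in>{c0}. l c * (\<Prod>d\<in>C - {c}. c0 - d))"
    using C(2) l(1) by (intro sum.mono_neutral_right) auto
  also have "\<dots> \<noteq> 0" using l C(2) by auto
  finally have "G \<noteq> 0" by auto
  have uG: "univariate v G = (\<Sum>c\<in>C. Const (l c) * (\<Prod>d\<in>C - {c}. ?X d))"
    by (simp only: G_def u.hom_sum u.hom_mult u.hom_prod)
      (simp add: univariate_pCons u.hom_zero Const.hom_uminus)
  \<comment> \<open>Substituting \<open>f ^ k0 = i c + q c * ?X c\<close> for each \<open>c\<close>,
    the \<open>q\<close> terms all carry the full product and cancel by the linear relation;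
    multiples of the \<open>i c \<in> M\<close> remain.\<close>
  have "univariate v G * f ^ k0 = (\<Sum>c\<in>C. Const (l c) * (\<Prod>d\<in>C - {c}. ?X d) * (i c + q c * ?X c))"
    unfolding uG sum_distrib_right using C(1) iq(3) by (intro sum.cong) auto
  also have "\<dots> = (\<Sum>c\<in>C. Const (l c) * (\<Prod>d\<in>C - {c}. ?X d) * i c + Const (l c) * q c * (\<Prod>d\<in>C. ?X d))"
  proof (intro sum.cong refl)
    fix c assume "c \<in> C"
    then have "(\<Prod>d\<in>C. ?X d) = ?X c * (\<Prod>d\<in>C - {c}. ?X d)" by (rule prod.remove[OF C(2)])
    then show "Const (l c) * (\<Prod>d\<in>C - {c}. ?X d) * (i c + q c * ?X c) =
        Const (l c) * (\<Prod>d\<in>C - {c}. ?X d) * i c + Const (l c) * q c * (\<Prod>d\<in>C. ?X d)"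
      by (simp only: ring_distribs mult_ac)
  qed
  also have "\<dots> = (\<Sum>c\<in>C. Const (l c) * (\<Prod>d\<in>C - {c}. ?X d) * i c)"
    by (simp add: sum.distrib l(3) flip: sum_distrib_right)
  also have "\<dots> \<in> M"
    by (intro M.I_sum M.I_mult iq(1) polys_mult polys_prod X polys_Const)
  finally have "univariate v G * f ^ k0 \<in> M" .
  then have "univariate v G \<in> M \<or> f ^ k0 \<in> M"
    using M univariate_polys[OF v, of G] polys_power[OF f] unfolding prime_in_def by blast
  then have "univariate v G \<in> M" using K.prime_power[OF M f] fM by blast
  then show False using prime_univariate_root[OF M v \<open>G \<noteq> 0\<close>] no by blast
qed

text \<open>The powers of \<open>f\<close> take the place of Rabinowitsch's extra variable: an ideal
  above \<open>P\<close> that is maximal among those avoiding them turns out to be the ideal of a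
  point, at which \<open>f\<close> cannot vanish.\<close>

theorem nullstellensatz_prime:
  fixes f :: "'v cpoly"
  assumes S: "finite S" and P: "prime_in (polys S) P" and f: "f \<in> polys S" "f \<notin> P"
  obtains a where "a \<in> S \<rightarrow>\<^sub>E UNIV" "\<And>p. p \<in> P \<Longrightarrow> poly_eval p a = 0" "poly_eval f a \<noteq> 0"
proof -
  interpret K: subring "polys S" by unfold_locales (rule subring_of_polys)
  let ?R = "range (\<lambda>k. f ^ k)"
  have "P \<inter> ?R = {}" using K.prime_power[OF P f(1)] f(2) by auto
  then obtain M where M: "ideal_in (polys S) M" "P \<subseteq> M" "M \<inter> ?R = {}"
    "\<And>J. ideal_in (polys S) J \<Longrightarrow> M \<subseteq> J \<Longrightarrow> J \<inter> ?R = {} \<Longrightarrow> J = M"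
    using K.maximal_avoiding[OF prime_in_ideal[OF P]] by blast
  have one: "1 \<in> ?R" by (rule range_eqI[of _ _ 0]) simp
  have "prime_in (polys S) M"
  proof (rule K.maximal_avoiding_prime[OF M(1,3,4) one])
    show "a * b \<in> ?R" if "a \<in> ?R" "b \<in> ?R" for a b
      using that by (auto simp: power_add[symmetric])
  qed
  interpret M: ring_ideal "polys S" M by (rule K.ring_idealI[OF M(1)])
  have "f \<in> ?R" by (rule range_eqI[of _ _ 1]) simp
  then have "f \<notin> M" using M(3) by blast
  have "\<exists>a. Var v - Const a \<in> M" if "v \<in> S" for v
    by (rule maximal_avoiding_powers_coordinate[OF S that f(1) \<open>prime_in (polys S) M\<close> \<open>f \<notin> M\<close>])
      (rule K.adjoin_meets[OF M(1,4)])
  then obtain a0 where a0: "\<And>v. v \<in> S \<Longrightarrow> Var v - Const (a0 v) \<in> M" by metis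
  define a where "a = restrict a0 S"
  have a: "Var v - Const (a v) \<in> M" if "v \<in> S" for v using a0 that by (simp add: a_def)
  \<comment> \<open>Each variable is congruent to a constant modulo \<open>M\<close>, hence each
    polynomial to its value at \<open>a\<close>. Together with \<open>1 \<notin> M\<close> this
    identifies \<open>M\<close> as the ideal of \<open>a\<close>.\<close>
  have ev: "g - Const (poly_eval g a) \<in> M" if "g \<in> polys S" for g
  proof -
    have mono: "mono_val Var m - mono_val (\<lambda>v. Const (a v)) m \<in> M" if m: "Poly_Mapping.keys m \<subseteq> S" for m
    proof -
      have "x * y - x' * y' \<in> M" if "x - x' \<in> M" "y - y' \<in> M" "x' \<in> polys S" "y \<in> polys S" for x x' y y' :: "'v cpoly"
      proof -
        have "x * y - x' * y' = (x - x') * y + x' * (y - y')" by (simp add: algebra_simps)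
        then show ?thesis using M.I_add[OF M.I_mult'[OF that(4,1)] M.I_mult[OF that(3,2)]] by simp
      qed
      note mult = this
      have pow: "Var v ^ k - Const (a v) ^ k \<in> M" if "v \<in> S" for v k
      proof (induction k)
        case (Suc k)
        then show ?case unfolding power_Suc using that by (intro mult a polys_power) auto
      qed (simp add: M.I_zero)
      have "(\<Prod>v\<in>V. Var v ^ e v) - (\<Prod>v\<in>V. Const (a v) ^ e v) \<in> M" if "V \<subseteq> S" for V e
        using that
      proof (induction V rule: infinite_finite_induct)
        case (insert v V)
        then show ?case
          unfolding prod.insert[OF insert.hyps] by (intro mult pow polys_power polys_prod) auto
      qed (auto intro: M.I_zero)
      then show ?thesis unfolding mono_val_def using m .
    qed
    have "g - Const (poly_eval g a) = insertion Const Var g - insertion Const (\<lambda>v. Const (a v)) g"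
      by (simp add: insertion_Const_Var)
        (simp add: insertion_def poly_eval_def mono_val_def Const.hom_sum Const.hom_mult
          Const.hom_prod Const.hom_power)
    also have "\<dots> = (\<Sum>m\<in>Poly_Mapping.keys g. Const (Poly_Mapping.lookup g m) *
        (mono_val Var m - mono_val (\<lambda>v. Const (a v)) m))"
      by (simp add: insertion_def sum_subtractf right_diff_distrib)
    also have "\<dots> \<in> M"
      using that by (intro M.I_sum M.I_mult mono polys_Const) (auto simp: polys_iff)
    finally show ?thesis .
  qed
  have *: "poly_eval g a = 0 \<longleftrightarrow> g \<in> M" if "g \<in> polys S" for g
  proof
    assume "poly_eval g a = 0"
    then show "g \<in> M" using ev[OF that] by simp
  next
    assume "g \<in> M"
    then have "g - (g - Const (poly_eval g a)) \<in> M" using ev[OF that] by (rule M.I_diff)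
    then have c: "Const (poly_eval g a) \<in> M" by simp
    show "poly_eval g a = 0"
    proof (rule ccontr)
      assume nz: "poly_eval g a \<noteq> 0"
      have "Const (inverse (poly_eval g a)) * Const (poly_eval g a) \<in> M"
        using c by (intro M.I_mult) auto
      then have "1 \<in> M" using nz by (simp flip: Const.hom_mult)
      then show False using M(3) one by blast
    qed
  qed
  show thesis
  proof (rule that)
    show "a \<in> S \<rightarrow>\<^sub>E UNIV" by (auto simp: a_def)
    show "poly_eval p a = 0" if "p \<in> P" for p using * that M(2) M.I_sub by blast
    show "poly_eval f a \<noteq> 0" using * f(1) \<open>f \<notin> M\<close> by blast
  qed
qed

section \<open>Dimension and chains of prime ideals\<close>

definition vanishing :: "'v set \<Rightarrow> ('v \<Rightarrow> complex) set \<Rightarrow> 'v cpoly set" where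
  "vanishing S A = {p \<in> polys S. \<forall>x\<in>A. poly_eval p x = 0}"

definition zero_set :: "'v set \<Rightarrow> 'v cpoly set \<Rightarrow> ('v \<Rightarrow> complex) set" where
  "zero_set S P = {x \<in> S \<rightarrow>\<^sub>E UNIV. \<forall>p\<in>P. poly_eval p x = 0}"

lemma zariski_closed_iff: "zariski_closed S Z \<longleftrightarrow> (\<exists>P\<subseteq>polys S. Z = zero_set S P)"
  unfolding zariski_closed_def zero_set_def polys_def by auto

lemma zero_set_vanishing:
  assumes "zariski_closed S Z" shows "zero_set S (vanishing S Z) = Z"
proof -
  obtain P where "P \<subseteq> polys S" "Z = zero_set S P" using assms by (auto simp: zariski_closed_iff)
  then show ?thesis by (auto simp: zero_set_def vanishing_def)
qed

lemma ideal_vanishing: "ideal_in (polys S) (vanishing S A)"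
  by (auto simp: ideal_in_def vanishing_def poly_eval.hom_add poly_eval.hom_mult
      intro: polys_add polys_mult)

lemma closure_superset: "A \<subseteq> zariski_closure S A"
  by (auto simp: zariski_closure_def)

text \<open>Lets the dimension of a projection be read off from the polynomials vanishing on the
  projection itself, closed or not.\<close>

lemma vanishing_closure:
  assumes "A \<subseteq> S \<rightarrow>\<^sub>E UNIV" shows "vanishing S (zariski_closure S A) = vanishing S A"
proof
  show "vanishing S (zariski_closure S A) \<subseteq> vanishing S A"
    using closure_superset[of A S] by (auto simp: vanishing_def)
next
  have "zariski_closure S A \<subseteq> zero_set S (vanishing S A)"
    unfolding zariski_closure_def
  proof (intro Inter_lower CollectI conjI)
    show "zariski_closed S (zero_set S (vanishing S A))"
      unfolding zariski_closed_iff by (intro exI[of _ "vanishing S A"]) (auto simp: vanishing_def)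
    show "A \<subseteq> zero_set S (vanishing S A)" using assms by (auto simp: zero_set_def vanishing_def)
  qed
  then show "vanishing S A \<subseteq> vanishing S (zariski_closure S A)"
    by (auto simp: zero_set_def vanishing_def)
qed

lemma irreducible_vanishing_prime:
  assumes "irreducible_closed S Z" shows "prime_in (polys S) (vanishing S Z)"
proof -
  have Z: "zariski_closed S Z" "Z \<noteq> {}" using assms by (auto simp: irreducible_closed_def)
  have "a \<in> vanishing S Z \<or> b \<in> vanishing S Z"
    if ab: "a \<in> polys S" "b \<in> polys S" "a * b \<in> vanishing S Z" for a b
  proof -
    let ?Z = "\<lambda>f. zero_set S (insert f (vanishing S Z))"
    have "zariski_closed S (?Z f)" if "f \<in> polys S" for f
      unfolding zariski_closed_iff
      using that by (intro exI[of _ "insert f (vanishing S Z)"]) (auto simp: vanishing_def)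
    moreover have eq: "?Z f = {x \<in> Z. poly_eval f x = 0}" for f
      using zero_set_vanishing[OF Z(1)] by (auto simp: zero_set_def)
    moreover have "Z = ?Z a \<union> ?Z b"
      unfolding eq using ab(3) by (auto simp: vanishing_def poly_eval.hom_mult)
    ultimately have "?Z a = Z \<or> ?Z b = Z"
      using assms ab(1,2) unfolding irreducible_closed_def by blast
    then show ?thesis unfolding eq using ab by (auto simp: vanishing_def)
  qed
  moreover have "1 \<notin> vanishing S Z" using Z by (auto simp: vanishing_def)
  ultimately show ?thesis using ideal_vanishing by (auto simp: prime_in_def)
qed

lemma vanishing_zero_set_prime:
  assumes "finite S" "prime_in (polys S) P" shows "vanishing S (zero_set S P) = P"
proof (intro equalityI subsetI)
  fix p assume p: "p \<in> vanishing S (zero_set S P)"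
  show "p \<in> P"
  proof (rule ccontr)
    assume "p \<notin> P"
    then obtain a where "a \<in> S \<rightarrow>\<^sub>E UNIV" "\<And>p. p \<in> P \<Longrightarrow> poly_eval p a = 0" "poly_eval p a \<noteq> 0"
      using nullstellensatz_prime[OF assms, of p] p by (auto simp: vanishing_def)
    then show False using p by (auto simp: vanishing_def zero_set_def)
  qed
qed (use assms(2) in \<open>auto simp: vanishing_def zero_set_def prime_in_def ideal_in_def\<close>)

lemma irreducible_zero_set_prime:
  assumes S: "finite S" and P: "prime_in (polys S) P" shows "irreducible_closed S (zero_set S P)"
  unfolding irreducible_closed_def
proof (intro conjI allI impI)
  have PS: "P \<subseteq> polys S" using P by (auto simp: prime_in_def ideal_in_def)
  show "zariski_closed S (zero_set S P)" using PS by (auto simp: zariski_closed_iff)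
  obtain a where "a \<in> S \<rightarrow>\<^sub>E UNIV" "\<And>p. p \<in> P \<Longrightarrow> poly_eval p a = 0"
    using nullstellensatz_prime[OF S P, of 1] P by (auto simp: prime_in_def)
  then show "zero_set S P \<noteq> {}" by (auto simp: zero_set_def)
  fix Z1 Z2 assume Z: "zariski_closed S Z1 \<and> zariski_closed S Z2 \<and> zero_set S P = Z1 \<union> Z2"
  show "Z1 = zero_set S P \<or> Z2 = zero_set S P"
  proof (rule ccontr)
    assume no: "\<not> ?thesis"
    have ex: "\<exists>p\<in>polys S. p \<notin> P \<and> (\<forall>x\<in>Y. poly_eval p x = 0)"
      if Y: "zariski_closed S Y" "Y \<subseteq> zero_set S P" "Y \<noteq> zero_set S P" for Y
    proof (rule ccontr)
      assume "\<not> ?thesis"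
      then have "vanishing S Y \<subseteq> P" by (auto simp: vanishing_def)
      then have "zero_set S P \<subseteq> zero_set S (vanishing S Y)" by (auto simp: zero_set_def)
      then show False using zero_set_vanishing[OF Y(1)] Y by blast
    qed
    obtain p1 p2 where p: "p1 \<in> polys S" "p1 \<notin> P" "\<forall>x\<in>Z1. poly_eval p1 x = 0"
      "p2 \<in> polys S" "p2 \<notin> P" "\<forall>x\<in>Z2. poly_eval p2 x = 0"
      using ex[of Z1] ex[of Z2] Z no by blast
    then have "p1 * p2 \<in> vanishing S (zero_set S P)"
      using Z by (auto simp: vanishing_def poly_eval.hom_mult intro: polys_mult)
    then show False using p P vanishing_zero_set_prime[OF S P] by (auto simp: prime_in_def)
  qed
qed

lemma zero_set_subset_closure:
  assumes "vanishing S A \<subseteq> P" shows "zero_set S P \<subseteq> zariski_closure S A"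
  unfolding zariski_closure_def
proof (rule Inter_greatest)
  fix Y assume "Y \<in> {Z. zariski_closed S Z \<and> A \<subseteq> Z}"
  then have Y: "zariski_closed S Y" "A \<subseteq> Y" by auto
  have "vanishing S Y \<subseteq> P" using assms Y(2) by (auto simp: vanishing_def)
  then have "zero_set S P \<subseteq> zero_set S (vanishing S Y)" by (auto simp: zero_set_def)
  then show "zero_set S P \<subseteq> Y" using zero_set_vanishing[OF Y(1)] by simp
qed

text \<open>Zero sets and vanishing ideals reverse inclusions, hence the index \<open>k - i\<close>
  in both directions. Strictness survives because closed sets and primes are recovered from their
  partners.\<close>

lemma irreducible_chain_iff_prime_chain:
  assumes S: "finite S" and A: "A \<subseteq> S \<rightarrow>\<^sub>E UNIV"
  shows "(\<exists>Z. (\<forall>i\<le>k. irreducible_closed S (Z i) \<and> Z i \<subseteq> zariski_closure S A) \<and>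
      (\<forall>i<k. Z i \<subset> Z (Suc i))) \<longleftrightarrow> (\<exists>P. prime_chain (polys S) (vanishing S A) k P)"
    (is "?L \<longleftrightarrow> ?R")
proof
  assume ?L
  then obtain Z where Z: "\<And>i. i \<le> k \<Longrightarrow> irreducible_closed S (Z i)"
    "\<And>i. i \<le> k \<Longrightarrow> Z i \<subseteq> zariski_closure S A" "\<And>i. i < k \<Longrightarrow> Z i \<subset> Z (Suc i)" by blast
  have "prime_chain (polys S) (vanishing S A) k (\<lambda>i. vanishing S (Z (k - i)))"
    unfolding prime_chain_def
  proof (intro conjI allI impI)
    fix i
    show "prime_in (polys S) (vanishing S (Z (k - i)))"
      using Z(1) by (intro irreducible_vanishing_prime) auto
    show "vanishing S A \<subseteq> vanishing S (Z (k - i))"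
      using Z(2)[of "k - i"] vanishing_closure[OF A] by (auto simp: vanishing_def)
  next
    fix i assume i: "i < k"
    then have sub: "Z (k - Suc i) \<subset> Z (k - i)" using Z(3)[of "k - Suc i"] by (simp add: Suc_diff_Suc)
    have c: "zariski_closed S (Z j)" if "j \<le> k" for j
      using Z(1)[OF that] by (simp add: irreducible_closed_def)
    have "vanishing S (Z (k - i)) \<subseteq> vanishing S (Z (k - Suc i))"
      using sub by (auto simp: vanishing_def)
    moreover have "vanishing S (Z (k - i)) \<noteq> vanishing S (Z (k - Suc i))"
      using zero_set_vanishing[OF c[of "k - i"]] zero_set_vanishing[OF c[of "k - Suc i"]] sub
      by (metis diff_le_self psubset_eq)
    ultimately show "vanishing S (Z (k - i)) \<subset> vanishing S (Z (k - Suc i))" by blast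
  qed
  then show ?R by blast
next
  assume ?R
  then obtain P where P: "\<And>i. i \<le> k \<Longrightarrow> prime_in (polys S) (P i)"
    "\<And>i. i \<le> k \<Longrightarrow> vanishing S A \<subseteq> P i" "\<And>i. i < k \<Longrightarrow> P i \<subset> P (Suc i)"
    unfolding prime_chain_def by blast
  let ?Z = "\<lambda>i. zero_set S (P (k - i))"
  have "irreducible_closed S (?Z i)" "?Z i \<subseteq> zariski_closure S A" if "i \<le> k" for i
    using P(1,2)[of "k - i"] S
    by (auto intro: irreducible_zero_set_prime zero_set_subset_closure[THEN subsetD])
  moreover have "?Z i \<subset> ?Z (Suc i)" if i: "i < k" for i
  proof -
    have sub: "P (k - Suc i) \<subset> P (k - i)" using P(3)[of "k - Suc i"] i by (simp add: Suc_diff_Suc)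
    then have "?Z i \<subseteq> ?Z (Suc i)" by (auto simp: zero_set_def)
    moreover have "?Z i \<noteq> ?Z (Suc i)"
      using vanishing_zero_set_prime[OF S P(1)[of "k - i"]]
        vanishing_zero_set_prime[OF S P(1)[of "k - Suc i"]] sub
      by (metis diff_le_self psubset_eq)
    ultimately show ?thesis by blast
  qed
  ultimately show ?L by (intro exI[of _ ?Z]) auto
qed

theorem zariski_dim_prime_chain:
  assumes "finite S" "A \<subseteq> S \<rightarrow>\<^sub>E UNIV"
  shows "zariski_dim S A = Sup {enat k | k. \<exists>P. prime_chain (polys S) (vanishing S A) k P}"
  unfolding zariski_dim_def irreducible_chain_iff_prime_chain[OF assms] ..

section \<open>Chains of primes in polynomial rings\<close>

lemma prime_chain_subset: "prime_chain K I k P \<Longrightarrow> i \<le> k \<Longrightarrow> P i \<subseteq> K"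
  by (auto simp: prime_chain_def prime_in_def ideal_in_def)

text \<open>Pigeonhole on dimensions: exponents up to \<open>N\<close> give
  \<open>(N + 1) ^ l\<close> products, while their monomials lie in a box whose size grows only like
  \<open>N ^ card S\<close>.\<close>

lemma algebraically_dependent:
  fixes x :: "nat \<Rightarrow> 'v cpoly"
  assumes S: "finite S" and x: "\<And>i. i < l \<Longrightarrow> x i \<in> polys S" and l: "card S < l"
  obtains A c where "finite A" "A \<noteq> {}" "A \<subseteq> {..<l} \<rightarrow>\<^sub>E UNIV" "\<And>e. e \<in> A \<Longrightarrow> c e \<noteq> 0"
    "(\<Sum>e\<in>A. Const (c e) * (\<Prod>i<l. x i ^ e i)) = 0"
proof -
  have "\<exists>D. \<forall>i<l. Poly_Mapping.keys (x i) \<subseteq> box S D"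
  proof -
    have "\<exists>D. Poly_Mapping.keys (x i) \<subseteq> box S D" if "i < l" for i
      using polys_keys_box[OF x[OF that]] by metis
    then obtain D where D: "\<And>i. i < l \<Longrightarrow> Poly_Mapping.keys (x i) \<subseteq> box S (D i)" by metis
    have "D i \<le> (\<Sum>j<l. D j)" if "i < l" for i using that by (intro member_le_sum) auto
    then show ?thesis using D box_mono by (meson order_trans)
  qed
  then obtain D where D: "\<And>i. i < l \<Longrightarrow> Poly_Mapping.keys (x i) \<subseteq> box S D" by blast
  \<comment> \<open>Chosen so that the bound \<open>((l * D + 1) * (N + 1)) ^ card S\<close> on the
    number of monomials becomes \<open>N * (N + 1) ^ card S\<close>, which is below
    \<open>(N + 1) ^ l\<close>.\<close>
  define N where "N = (l * D + 1) ^ card S"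
  define E where "E = {..<l} \<rightarrow>\<^sub>E {..N}"
  define B where "B = monomials (box S (l * N * D))"
  have E: "finite E" "card E = (N + 1) ^ l"
    by (auto simp: E_def card_PiE intro!: finite_PiE)
  have "card B = (l * N * D + 1) ^ card S" using S by (simp add: B_def card_monomials card_box)
  also have "\<dots> \<le> ((l * D + 1) * (N + 1)) ^ card S" by (intro power_mono) (auto simp: algebra_simps)
  also have "\<dots> = N * (N + 1) ^ card S" by (simp only: power_mult_distrib N_def)
  also have "\<dots> < (N + 1) ^ Suc (card S)" by simp
  also have "\<dots> \<le> (N + 1) ^ l" using l by (intro power_increasing) auto
  finally have "card B < card E" using E by simp
  moreover have "(\<Prod>i<l. x i ^ e i) \<in> cpoly.span B" if e: "e \<in> E" for e
  proof -
    have "Poly_Mapping.keys (\<Prod>i<l. x i ^ e i) \<subseteq> box S (\<Sum>i<l. e i * D)"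
      using D by (intro keys_prod_box keys_power_box) auto
    also have "(\<Sum>i<l. e i * D) \<le> (\<Sum>i<l. N * D)"
      using e by (intro sum_mono mult_right_mono) (auto simp: E_def)
    then have "box S (\<Sum>i<l. e i * D) \<subseteq> box S (l * N * D)" by (intro box_mono) simp
    finally show ?thesis by (simp add: B_def span_monomials)
  qed
  ultimately obtain c where c: "\<exists>e\<in>E. c e \<noteq> 0" "(\<Sum>e\<in>E. Const (c e) * (\<Prod>i<l. x i ^ e i)) = 0"
    using family_dependent[of E B "\<lambda>e. \<Prod>i<l. x i ^ e i"] E(1) S
    by (auto simp: B_def monomials_def finite_box)
  \<comment> \<open>Exponent vectors with coefficient zero are dropped: the search for lowest terms
    in \<open>prime_chain_no_relation\<close> must not end at a vacuous term.\<close>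
  show thesis
  proof (rule that[of "{e\<in>E. c e \<noteq> 0}" c])
    have "(\<Sum>e\<in>{e\<in>E. c e \<noteq> 0}. Const (c e) * (\<Prod>i<l. x i ^ e i)) =
        (\<Sum>e\<in>E. Const (c e) * (\<Prod>i<l. x i ^ e i))"
      using E(1) by (intro sum.mono_neutral_left) auto
    then show "(\<Sum>e\<in>{e\<in>E. c e \<noteq> 0}. Const (c e) * (\<Prod>i<l. x i ^ e i)) = 0" using c by simp
  qed (use E c in \<open>auto simp: E_def\<close>)
qed

text \<open>The terms of lowest degree in \<open>x\<^sub>j\<close> survive the passage from \<open>P\<^sub>j\<close> to \<open>P\<^sub>j\<^sub>+\<^sub>1\<close>.\<close>

lemma prime_chain_no_relation:
  fixes x :: "nat \<Rightarrow> 'v cpoly"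
  assumes P: "prime_chain (polys S) I l P" and x: "\<And>i. i < l \<Longrightarrow> x i \<in> P (Suc i) - P i"
    and "j \<le> l" "finite A" "A \<noteq> {}" "inj_on (\<lambda>e. restrict e {j..<l}) A" "\<And>e. e \<in> A \<Longrightarrow> c e \<noteq> 0"
  shows "(\<Sum>e\<in>A. Const (c e) * (\<Prod>i\<in>{j..<l}. x i ^ e i)) \<notin> P j"
  using assms(3-)
proof (induction j arbitrary: A rule: inc_induct)
  case base
  interpret K: subring "polys S" by unfold_locales (rule subring_of_polys)
  have Pl: "prime_in (polys S) (P l)" using P by (auto simp: prime_chain_def)
  interpret Pl: ring_ideal "polys S" "P l" using Pl by (intro K.ring_idealI prime_in_ideal)
  obtain e where e: "e \<in> A" using base by auto
  \<comment> \<open>The range \<open>{l..<l}\<close> is empty, so injectivity of the restriction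
    leaves a single exponent vector, whose term is a nonzero constant.\<close>
  have "e' = e" if "e' \<in> A" for e'
    using inj_onD[OF base(3) _ that e] by (simp add: restrict_def)
  then have A: "A = {e}" using e by blast
  show ?case
  proof
    assume "(\<Sum>e\<in>A. Const (c e) * (\<Prod>i\<in>{l..<l}. x i ^ e i)) \<in> P l"
    then have "Const (c e) \<in> P l" by (simp add: A)
    then have "Const (inverse (c e)) * Const (c e) \<in> P l" by (intro Pl.I_mult) auto
    then have "1 \<in> P l" using base(4)[OF e] by (simp flip: Const.hom_mult)
    then show False using Pl by (auto simp: prime_in_def)
  qed
next
  case (step j)
  interpret K: subring "polys S" by unfold_locales (rule subring_of_polys)
  have Pj: "prime_in (polys S) (P j)" "prime_in (polys S) (P (Suc j))" "P j \<subset> P (Suc j)"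
    using P step.hyps by (auto simp: prime_chain_def)
  interpret Pj: ring_ideal "polys S" "P j" using Pj by (intro K.ring_idealI prime_in_ideal)
  interpret Q: ring_ideal "polys S" "P (Suc j)" using Pj by (intro K.ring_idealI prime_in_ideal)
  have xS: "x i \<in> polys S" if "i < l" for i
    using x[OF that] prime_chain_subset[OF P, of "Suc i"] that by auto
  define a where "a = Min ((\<lambda>e. e j) ` A)"
  have a: "a \<le> e j" if "e \<in> A" for e using that step.prems by (simp add: a_def)
  define A' where "A' = {e\<in>A. e j = a}"
  have "a \<in> (\<lambda>e. e j) ` A" unfolding a_def using step.prems by (intro Min_in) auto
  then have A': "finite A'" "A' \<noteq> {}" "A' \<subseteq> A" using step.prems by (auto simp: A'_def)
  let ?r = "\<lambda>e. Const (c e) * (\<Prod>i\<in>{Suc j..<l}. x i ^ e i)"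
  have r: "?r e \<in> polys S" for e using xS by (intro polys_mult polys_prod polys_power) auto
  define R where "R = (\<Sum>e\<in>A - A'. ?r e * x j ^ (e j - a - 1))"
  have RS: "R \<in> polys S" unfolding R_def
    using xS step.hyps by (intro polys_sum polys_mult[OF r] polys_power) auto
  have "inj_on (\<lambda>e. restrict e {Suc j..<l}) A'"
  proof (rule inj_onI)
    fix e e' assume *: "e \<in> A'" "e' \<in> A'" "restrict e {Suc j..<l} = restrict e' {Suc j..<l}"
    have "e i = e' i" if "Suc j \<le> i" "i < l" for i using fun_cong[OF *(3), of i] that by simp
    moreover have "e j = e' j" using * by (simp add: A'_def)
    ultimately have "restrict e {j..<l} = restrict e' {j..<l}"
      by (intro restrict_ext) (metis atLeastLessThan_iff le_eq_less_or_eq Suc_leI)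
    then show "e = e'" using inj_onD[OF step.prems(3)] * A'(3) by blast
  qed
  then have IH: "(\<Sum>e\<in>A'. ?r e) \<notin> P (Suc j)"
    by (rule step.IH[OF A'(1,2)]) (use step.prems A'(3) in blast)
  have "(\<Sum>e\<in>A. Const (c e) * (\<Prod>i\<in>{j..<l}. x i ^ e i)) = (\<Sum>e\<in>A. ?r e * x j ^ e j)"
    using step.hyps by (intro sum.cong) (auto simp: prod.atLeast_Suc_lessThan algebra_simps)
  also have "\<dots> = (\<Sum>e\<in>A'. ?r e * x j ^ e j) + (\<Sum>e\<in>A - A'. ?r e * x j ^ e j)"
    using sum.subset_diff[OF A'(3) step.prems(1)] by (simp add: add.commute)
  also have "(\<Sum>e\<in>A'. ?r e * x j ^ e j) = x j ^ a * (\<Sum>e\<in>A'. ?r e)"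
    unfolding sum_distrib_left by (intro sum.cong) (auto simp: A'_def mult.commute)
  also have "(\<Sum>e\<in>A - A'. ?r e * x j ^ e j) = x j ^ a * (x j * R)"
    unfolding R_def sum_distrib_left
  proof (intro sum.cong refl)
    fix e assume e: "e \<in> A - A'"
    then have "a < e j" using a[of e] by (auto simp: A'_def)
    then have "e j = a + Suc (e j - a - 1)" by simp
    then have "x j ^ e j = x j ^ a * (x j * x j ^ (e j - a - 1))"
      by (metis power_add power_Suc)
    then show "?r e * x j ^ e j = x j ^ a * (x j * (?r e * x j ^ (e j - a - 1)))"
      by (simp add: algebra_simps)
  qed
  also have "x j ^ a * (\<Sum>e\<in>A'. ?r e) + x j ^ a * (x j * R) = x j ^ a * ((\<Sum>e\<in>A'. ?r e) + x j * R)"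
    by (simp add: algebra_simps)
  finally have eq: "(\<Sum>e\<in>A. Const (c e) * (\<Prod>i\<in>{j..<l}. x i ^ e i)) = x j ^ a * ((\<Sum>e\<in>A'. ?r e) + x j * R)" .
  have xj: "x j \<in> polys S" "x j \<notin> P j" "x j \<in> P (Suc j)" using x[OF step.hyps(2)] xS[OF step.hyps(2)] by auto
  \<comment> \<open>The factor \<open>x j ^ a\<close> is cancelled modulo the prime
    \<open>P j\<close>. As \<open>x j * R\<close> lies in \<open>P (Suc j)\<close>, the sum over
    \<open>A'\<close> would lie there too, against the induction hypothesis.\<close>
  show ?case
  proof
    assume "(\<Sum>e\<in>A. Const (c e) * (\<Prod>i\<in>{j..<l}. x i ^ e i)) \<in> P j"
    moreover have "x j ^ a \<notin> P j" using K.prime_power[OF Pj(1) xj(1)] xj(2) by blast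
    moreover have "x j ^ a \<in> polys S" "(\<Sum>e\<in>A'. ?r e) + x j * R \<in> polys S"
      by (intro polys_add polys_power polys_sum r polys_mult[OF xj(1) RS] xj(1))+
    ultimately have "(\<Sum>e\<in>A'. ?r e) + x j * R \<in> P j"
      using Pj(1) unfolding eq prime_in_def by blast
    then have *: "(\<Sum>e\<in>A'. ?r e) - - (x j * R) \<in> P (Suc j)" using Pj(3) by auto
    have "- (x j * R) \<in> P (Suc j)" using xj RS by (intro Q.I_uminus Q.I_mult')
    then show False using Q.mem_congI[OF *] IH by blast
  qed
qed

text \<open>Elements chosen in the successive differences of the chain satisfy no relation by
  \<open>prime_chain_no_relation\<close>, whereas more than \<open>card S\<close> polynomials are
  algebraically dependent.\<close>

theorem prime_chain_polys_le:
  fixes S :: "'v set"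
  assumes S: "finite S" and P: "prime_chain (polys S) I k P"
  shows "k \<le> card S"
proof (rule ccontr)
  assume "\<not> k \<le> card S"
  then have k: "card S < k" by simp
  have "\<exists>y. y \<in> P (Suc i) - P i" if "i < k" for i using P that by (auto simp: prime_chain_def)
  then obtain x where x: "\<And>i. i < k \<Longrightarrow> x i \<in> P (Suc i) - P i" by metis
  have xS: "x i \<in> polys S" if "i < k" for i
    using x[OF that] prime_chain_subset[OF P, of "Suc i"] that by auto
  obtain A c where A: "finite A" "A \<noteq> {}" "A \<subseteq> {..<k} \<rightarrow>\<^sub>E UNIV" "\<And>e. e \<in> A \<Longrightarrow> c e \<noteq> 0"
    "(\<Sum>e\<in>A. Const (c e) * (\<Prod>i<k. x i ^ e i)) = 0"
    using algebraically_dependent[of S k x, OF S xS k] by blast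
  have "inj_on (\<lambda>e. restrict e {0..<k}) A"
  proof (rule inj_onI)
    fix e e' assume *: "e \<in> A" "e' \<in> A" "restrict e {0..<k} = restrict e' {0..<k}"
    have "restrict e {0..<k} = e" if "e \<in> A" for e
      using A(3) that by (intro PiE_restrict[of e _ "\<lambda>_. UNIV"]) (auto simp: lessThan_atLeast0)
    then show "e = e'" using * by simp
  qed
  from prime_chain_no_relation[OF P x _ A(1,2) this, of c] A(4,5)
  have "0 \<notin> P 0" by (simp add: lessThan_atLeast0)
  then show False using P by (auto simp: prime_chain_def prime_in_def ideal_in_def)
qed

text \<open>The polynomial ring is a domain, so \<open>{0}\<close> can be put in front of the chain,
  properly since \<open>f\<close> lies in every member. The linear order on variables orders the
  monomials, from which the absence of zero divisors comes.\<close>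

theorem prime_chain_polys_less:
  fixes S :: "'v::linorder set"
  assumes S: "finite S" and P: "prime_chain (polys S) I k P" and f: "f \<in> I" "f \<noteq> 0"
  shows "k < card S"
proof -
  have "prime_in (polys S) {0}" by (auto simp: prime_in_def ideal_in_def)
  then have "prime_chain (polys S) {0} (Suc k) (\<lambda>i. case i of 0 \<Rightarrow> {0} | Suc i \<Rightarrow> P i)"
    unfolding prime_chain_def
  proof (intro conjI allI impI)
    fix i assume "i \<le> Suc k"
    then show "prime_in (polys S) (case i of 0 \<Rightarrow> {0} | Suc i \<Rightarrow> P i)"
      "{0} \<subseteq> (case i of 0 \<Rightarrow> {0} | Suc i \<Rightarrow> P i)"
      using P \<open>prime_in (polys S) {0}\<close>
      by (cases i; simp add: prime_chain_def prime_in_def ideal_in_def)+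
  next
    fix i assume "i < Suc k"
    have "0 \<in> P 0" "f \<in> P 0" using P f by (auto simp: prime_chain_def prime_in_def ideal_in_def)
    then show "(case i of 0 \<Rightarrow> {0} | Suc i \<Rightarrow> P i) \<subset> (case Suc i of 0 \<Rightarrow> {0} | Suc i \<Rightarrow> P i)"
      using P f \<open>i < Suc k\<close> by (cases i) (auto simp: prime_chain_def)
  qed
  from prime_chain_polys_le[OF S this] show ?thesis by simp
qed

lemma zariski_dim_le_card:
  assumes "finite S" "A \<subseteq> S \<rightarrow>\<^sub>E UNIV" shows "zariski_dim S A \<le> enat (card S)"
  unfolding zariski_dim_prime_chain[OF assms]
  using prime_chain_polys_le[OF assms(1)] by (auto intro!: Sup_least)

lemma zariski_dim_ge:
  assumes "finite S" "A \<subseteq> S \<rightarrow>\<^sub>E UNIV" "prime_chain (polys S) (vanishing S A) k P"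
  shows "enat k \<le> zariski_dim S A"
  unfolding zariski_dim_prime_chain[OF assms(1,2)] using assms(3) by (intro Sup_upper) auto

text \<open>A nonzero element of the vanishing ideal would bound all chains by
  \<open>card S - 1\<close>; the condition \<open>S \<noteq> {}\<close> makes this subtraction
  strict.\<close>

lemma zariski_dim_full:
  fixes S :: "'v::linorder set"
  assumes S: "finite S" "S \<noteq> {}" and A: "A \<subseteq> S \<rightarrow>\<^sub>E UNIV" and dim: "enat (card S) \<le> zariski_dim S A"
  shows "vanishing S A = {0}"
proof (rule ccontr)
  assume "vanishing S A \<noteq> {0}"
  moreover have "0 \<in> vanishing S A" by (simp add: vanishing_def)
  ultimately obtain f where f: "f \<in> vanishing S A" "f \<noteq> 0" by blast
  have "zariski_dim S A \<le> enat (card S - 1)"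
    unfolding zariski_dim_prime_chain[OF S(1) A]
    using prime_chain_polys_less[OF S(1) _ f] by (force intro!: Sup_least)
  then have "enat (card S) \<le> enat (card S - 1)" using dim by (rule order_trans[rotated])
  moreover have "0 < card S" using S by (simp add: card_gt_0_iff)
  ultimately show False by simp
qed

section \<open>Noetherianity\<close>

lemma nat_seq_mono_subseq:
  fixes a :: "nat \<Rightarrow> nat"
  obtains r :: "nat \<Rightarrow> nat" where "strict_mono r" "mono (a \<circ> r)"
proof -
  obtain f where f: "strict_mono f" "monoseq (\<lambda>n. a (f n))" using seq_monosub by blast
  show thesis
  proof (cases "\<forall>m. \<forall>n\<ge>m. a (f m) \<le> a (f n)")
    case True
    then show thesis using that[of f] f(1) by (simp add: mono_def)
  next
    case False
    then have dec: "\<And>m n. m \<le> n \<Longrightarrow> a (f n) \<le> a (f m)" using f(2) by (auto simp: monoseq_def)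
    \<comment> \<open>A weakly decreasing sequence of naturals is constant from any index at which
      its least value occurs.\<close>
    obtain i0 where i0: "\<And>i. a (f i0) \<le> a (f i)"
      using ex_has_least_nat[of "\<lambda>_. True" 0 "\<lambda>i. a (f i)"] by auto
    have "a (f (i0 + i)) = a (f i0)" for i using dec[of i0 "i0 + i"] i0[of "i0 + i"] by simp
    moreover have "strict_mono (\<lambda>i. f (i0 + i))" using f(1) by (simp add: strict_mono_def)
    ultimately show thesis using that[of "\<lambda>i. f (i0 + i)"] by (simp add: mono_def)
  qed
qed

lemma dickson_subseq:
  fixes m :: "nat \<Rightarrow> 'v \<Rightarrow> nat"
  assumes "finite S"
  shows "\<exists>r :: nat \<Rightarrow> nat. strict_mono r \<and> (\<forall>v\<in>S. mono (\<lambda>i. m (r i) v))"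
  using assms
proof (induction S rule: finite_induct)
  case empty
  show ?case by (rule exI[of _ "\<lambda>i. i"]) (simp add: strict_mono_def)
next
  case (insert v S)
  then obtain r :: "nat \<Rightarrow> nat" where r: "strict_mono r" "\<forall>v\<in>S. mono (\<lambda>i. m (r i) v)" by blast
  obtain s :: "nat \<Rightarrow> nat" where s: "strict_mono s" "mono ((\<lambda>i. m (r i) v) \<circ> s)"
    by (rule nat_seq_mono_subseq)
  have "strict_mono (r \<circ> s)" using r(1) s(1) by (rule strict_mono_o)
  moreover have "mono (\<lambda>i. m ((r \<circ> s) i) w)" if "w \<in> insert v S" for w
    using that r(2) s strict_mono_mono[OF s(1)] by (auto simp: mono_def o_def)
  ultimately show ?case by blast
qed

lemma dickson:
  fixes m :: "nat \<Rightarrow> 'v \<Rightarrow>\<^sub>0 nat"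
  assumes "finite S" "\<And>i. Poly_Mapping.keys (m i) \<subseteq> S"
  obtains i j d where "i < j" "m j = m i + d" "Poly_Mapping.keys d \<subseteq> S"
proof -
  obtain r :: "nat \<Rightarrow> nat" where r: "strict_mono r" "\<forall>v\<in>S. mono (\<lambda>i. Poly_Mapping.lookup (m (r i)) v)"
    using dickson_subseq[OF assms(1), of "\<lambda>i. Poly_Mapping.lookup (m i)"] by blast
  let ?d = "m (r 1) - m (r 0)"
  have le: "Poly_Mapping.lookup (m (r 0)) v \<le> Poly_Mapping.lookup (m (r 1)) v" for v
  proof (cases "v \<in> S")
    case True
    then show ?thesis using r(2) by (auto simp: mono_def)
  next
    case False
    then have "Poly_Mapping.lookup (m (r 0)) v = 0"
      using assms(2)[of "r 0"] by (metis in_keys_iff subsetD)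
    then show ?thesis by simp
  qed
  show thesis
  proof (rule that)
    show "r 0 < r 1" using r(1) by (simp add: strict_mono_def)
    show "m (r 1) = m (r 0) + ?d"
      using le by (intro poly_mapping_eqI) (simp add: lookup_add lookup_minus)
    have "Poly_Mapping.keys ?d \<subseteq> Poly_Mapping.keys (m (r 1))"
      by (auto simp: in_keys_iff lookup_minus)
    then show "Poly_Mapping.keys ?d \<subseteq> S" using assms(2)[of "r 1"] by blast
  qed
qed

section \<open>Leading monomials and the ascending chain condition\<close>

definition lmon :: "'v::linorder cpoly \<Rightarrow> 'v \<Rightarrow>\<^sub>0 nat" where
  "lmon p = Max (Poly_Mapping.keys p)"

lemma lmon_in_keys: "p \<noteq> 0 \<Longrightarrow> lmon p \<in> Poly_Mapping.keys p"
  unfolding lmon_def by (intro Max_in) auto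

lemma lmon_max: "m \<in> Poly_Mapping.keys p \<Longrightarrow> m \<le> lmon p"
  unfolding lmon_def by (intro Max_ge) auto

lemma lookup_single_mult:
  "Poly_Mapping.lookup (Poly_Mapping.single d c * (q :: 'v cpoly)) (d + k) = c * Poly_Mapping.lookup q k"
proof (induction q rule: cpoly_induct)
  case (single_plus m a p)
  then show ?case
    by (simp add: distrib_left mult_single lookup_add lookup_single when_def)
qed simp

lemma keys_single_mult:
  "Poly_Mapping.keys (Poly_Mapping.single d c * (q :: 'v cpoly)) \<subseteq> (+) d ` Poly_Mapping.keys q"
  using keys_mult[of "Poly_Mapping.single d c" q] by (auto split: if_splits)

lemma zero_le_monomial: "(0 :: 'v::linorder \<Rightarrow>\<^sub>0 nat) \<le> d"
proof -
  have "\<not> d < 0" by transfer (auto simp: less_fun_def)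
  then show ?thesis by simp
qed

lemma lmon_cancel:
  fixes p q :: "'v::linorder cpoly"
  assumes "p \<noteq> 0" "q \<noteq> 0" "lmon p = lmon q + d"
  defines "c \<equiv> Poly_Mapping.lookup p (lmon p) / Poly_Mapping.lookup q (lmon q)"
  defines "p' \<equiv> p - Poly_Mapping.single d c * q"
  shows "p' = 0 \<or> lmon p' < lmon p"
proof (rule disjCI)
  assume "\<not> lmon p' < lmon p"
  have qn: "Poly_Mapping.lookup q (lmon q) \<noteq> 0" using lmon_in_keys[OF assms(2)] by (simp add: in_keys_iff)
  have le: "m \<le> lmon p" if "m \<in> Poly_Mapping.keys p'" for m
  proof -
    have "m \<in> Poly_Mapping.keys p \<or> m \<in> (+) d ` Poly_Mapping.keys q"
      using that keys_diff[of p "Poly_Mapping.single d c * q"] keys_single_mult[of d c q]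
      by (auto simp: p'_def in_keys_iff lookup_minus)
    then show ?thesis
    proof
      assume "m \<in> (+) d ` Poly_Mapping.keys q"
      then obtain k where k: "m = d + k" "k \<in> Poly_Mapping.keys q" by auto
      have "d + k \<le> d + lmon q" using lmon_max[OF k(2)] by (rule add_left_mono)
      then show ?thesis using k(1) assms(3) by (simp add: add.commute)
    qed (rule lmon_max)
  qed
  have "Poly_Mapping.lookup p' (lmon p) = 0"
    using qn lookup_single_mult[of d c q "lmon q"] assms(3)
    by (simp add: p'_def lookup_minus c_def add.commute)
  then have *: "lmon p \<notin> Poly_Mapping.keys p'" by (simp add: in_keys_iff)
  show "p' = 0"
  proof (rule ccontr)
    assume "p' \<noteq> 0"
    then have "lmon p' \<in> Poly_Mapping.keys p'" by (rule lmon_in_keys)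
    then have "lmon p' \<le> lmon p" "lmon p' \<noteq> lmon p" using le * by auto
    then show False using \<open>\<not> lmon p' < lmon p\<close> by simp
  qed
qed

text \<open>By Dickson's lemma an infinite descending sequence would contain
  \<open>m j = m i + d\<close> with \<open>i < j\<close>, and adding \<open>d\<close> never makes a
  monomial smaller.\<close>

lemma wf_monomials:
  assumes "finite (S :: 'v::linorder set)"
  shows "wf {(a, b :: 'v \<Rightarrow>\<^sub>0 nat). Poly_Mapping.keys a \<subseteq> S \<and> Poly_Mapping.keys b \<subseteq> S \<and> a < b}"
  unfolding wf_iff_no_infinite_down_chain
proof
  assume "\<exists>m. \<forall>i. (m (Suc i), m i) \<in> {(a, b :: 'v \<Rightarrow>\<^sub>0 nat). Poly_Mapping.keys a \<subseteq> S \<and> Poly_Mapping.keys b \<subseteq> S \<and> a < b}"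
  then obtain m where m: "\<And>i. Poly_Mapping.keys (m i :: 'v \<Rightarrow>\<^sub>0 nat) \<subseteq> S" "\<And>i. m (Suc i) < m i"
    by blast
  obtain i j d where ij: "i < j" "m j = m i + d" by (rule dickson[of S m, OF assms m(1)])
  have "m j < m i" using ij(1)
  proof (induction rule: strict_inc_induct)
    case (base i)
    then show ?case using m(2)[of i] by simp
  next
    case (step i)
    then show ?case using m(2)[of i] by (meson less_trans)
  qed
  moreover have "m i + 0 \<le> m i + d" by (rule add_left_mono[OF zero_le_monomial])
  ultimately show False using ij(2) by simp
qed

text \<open>Division without a finite basis: subtracting a monomial multiple of some
  \<open>q \<in> I\<close> from \<open>p \<in> J\<close> cancels the leading term, and leading
  monomials decrease in a well-founded order.\<close>

lemma ideal_eq_by_lmon: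
  fixes I J :: "'v::linorder cpoly set"
  assumes S: "finite S" and I: "ideal_in (polys S) I" and J: "ideal_in (polys S) J" and "I \<subseteq> J"
    and lm: "\<And>p. p \<in> J \<Longrightarrow> p \<noteq> 0 \<Longrightarrow>
      \<exists>q\<in>I. \<exists>d. q \<noteq> 0 \<and> lmon p = lmon q + d \<and> Poly_Mapping.keys d \<subseteq> S"
  shows "I = J"
proof -
  interpret K: subring "polys S" by unfold_locales (rule subring_of_polys)
  interpret I: ring_ideal "polys S" I by (rule K.ring_idealI[OF I])
  interpret J: ring_ideal "polys S" J by (rule K.ring_idealI[OF J])
  have kS: "Poly_Mapping.keys (lmon p) \<subseteq> S" if "p \<in> J" "p \<noteq> 0" for p
    using J.I_sub[OF that(1)] lmon_in_keys[OF that(2)] by (auto simp: polys_iff)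
  have "p \<in> J \<longrightarrow> p \<noteq> 0 \<longrightarrow> lmon p = m \<longrightarrow> p \<in> I" for p m
  proof (induction m arbitrary: p rule: wf_induct_rule[OF wf_monomials[OF S]])
    case (1 m)
    show ?case
    proof (intro impI)
      assume p: "p \<in> J" "p \<noteq> 0" "lmon p = m"
      obtain q d where q: "q \<in> I" "q \<noteq> 0" "lmon p = lmon q + d" "Poly_Mapping.keys d \<subseteq> S"
        using lm[OF p(1,2)] by blast
      define c where "c = Poly_Mapping.lookup p (lmon p) / Poly_Mapping.lookup q (lmon q)"
      define p' where "p' = p - Poly_Mapping.single d c * q"
      have "Poly_Mapping.single d c \<in> polys S" using q(4) by (auto simp: polys_iff)
      then have sI: "Poly_Mapping.single d c * q \<in> I" using q(1) by (rule I.I_mult)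
      then have p'J: "p' \<in> J" unfolding p'_def using p(1) assms(4) by (intro J.I_diff) auto
      have "p' = 0 \<or> lmon p' < lmon p" unfolding p'_def c_def by (rule lmon_cancel[OF p(2) q(2,3)])
      then have "p' \<in> I"
      proof
        assume "p' = 0" then show ?thesis by (simp add: I.I_zero)
      next
        assume *: "lmon p' < lmon p"
        show ?thesis
        proof (cases "p' = 0")
          case False
          then show ?thesis
            using 1[of "lmon p'" p'] kS[OF p'J] kS[OF p(1,2)] * p p'J by auto
        qed (simp add: I.I_zero)
      qed
      then show "p \<in> I" using sI I.mem_congI[of p "Poly_Mapping.single d c * q"] by (simp add: p'_def)
    qed
  qed
  then show ?thesis using \<open>I \<subseteq> J\<close> I.I_zero by blast
qed

text \<open>In a strictly increasing sequence of ideals, \<open>ideal_eq_by_lmon\<close> provides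
  elements of \<open>I (Suc n)\<close> whose leading monomial is divisible by none from
  \<open>I n\<close>; Dickson's lemma excludes this.\<close>

theorem polys_noetherian:
  fixes S :: "'v::linorder set"
  assumes S: "finite S" and F: "F \<noteq> {}" "\<And>I. I \<in> F \<Longrightarrow> ideal_in (polys S) I"
  obtains P where "P \<in> F" "\<And>J. J \<in> F \<Longrightarrow> P \<subseteq> J \<Longrightarrow> J = P"
proof (rule ccontr)
  assume "\<not> thesis"
  with that have step: "\<exists>J\<in>F. P \<subset> J" if "P \<in> F" for P using \<open>P \<in> F\<close> by blast
  obtain I0 where "I0 \<in> F" using F by blast
  then obtain I where I: "\<And>n. I n \<in> F" "\<And>n. I n \<subset> I (Suc n)"
    using dependent_nat_choice[of "\<lambda>_ J. J \<in> F" "\<lambda>_ J J'. J \<subset> J'"] step by metis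
  have "\<exists>p. p \<in> I (Suc n) \<and> p \<noteq> 0 \<and>
      (\<forall>q\<in>I n. \<forall>d. q \<noteq> 0 \<longrightarrow> lmon p = lmon q + d \<longrightarrow> \<not> Poly_Mapping.keys d \<subseteq> S)" for n
  proof (rule ccontr)
    assume *: "\<not> ?thesis"
    have "I n = I (Suc n)"
      by (rule ideal_eq_by_lmon[OF S F(2)[OF I(1)] F(2)[OF I(1)]]) (use I(2)[of n] * in blast)+
    then show False using I(2)[of n] by blast
  qed
  then obtain p where p: "\<And>n. p n \<in> I (Suc n)" "\<And>n. p n \<noteq> 0"
    "\<And>n q d. q \<in> I n \<Longrightarrow> q \<noteq> 0 \<Longrightarrow> lmon (p n) = lmon q + d \<Longrightarrow> \<not> Poly_Mapping.keys d \<subseteq> S"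
    by metis
  have pS: "Poly_Mapping.keys (lmon (p n)) \<subseteq> S" for n
  proof -
    have "p n \<in> polys S" using F(2)[OF I(1), of "Suc n"] p(1)[of n] by (auto simp: ideal_in_def)
    then show ?thesis using lmon_in_keys[OF p(2)[of n]] by (auto simp: polys_iff)
  qed
  obtain i j d where ij: "i < j" "lmon (p j) = lmon (p i) + d" "Poly_Mapping.keys d \<subseteq> S"
    by (rule dickson[of S "\<lambda>n. lmon (p n)", OF S pS])
  have "I n \<subseteq> I (Suc n)" for n using I(2)[of n] by blast
  then have "I (Suc i) \<subseteq> I j" by (rule lift_Suc_mono_le) (use ij(1) in simp)
  then have "p i \<in> I j" using p(1)[of i] by blast
  from p(3)[OF this p(2) ij(2)] ij(3) show False by simp
qed

section \<open>Codimension and order of vanishing at the origin\<close>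

definition mdeg :: "('v \<Rightarrow>\<^sub>0 nat) \<Rightarrow> nat" where
  "mdeg m = (\<Sum>v\<in>Poly_Mapping.keys m. Poly_Mapping.lookup m v)"

lemma mdeg_superset:
  assumes "finite V" "Poly_Mapping.keys m \<subseteq> V"
  shows "mdeg m = (\<Sum>v\<in>V. Poly_Mapping.lookup m v)"
  unfolding mdeg_def using assms by (intro sum.mono_neutral_left) (auto simp: in_keys_iff)

lemma mdeg_add: "mdeg (m + m') = mdeg m + mdeg m'"
proof -
  let ?V = "Poly_Mapping.keys m \<union> Poly_Mapping.keys m'"
  have "mdeg (m + m') = (\<Sum>v\<in>?V. Poly_Mapping.lookup (m + m') v)"
    by (intro mdeg_superset) (auto simp: Poly_Mapping.keys_add)
  also have "\<dots> = mdeg m + mdeg m'"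
    by (simp add: lookup_add sum.distrib) (subst (1 2) mdeg_superset[of ?V], auto)
  finally show ?thesis .
qed

lemma mdeg_eq_0_iff: "mdeg m = 0 \<longleftrightarrow> m = 0"
proof
  assume "mdeg m = 0"
  then show "m = 0" by (intro poly_mapping_eqI) (auto simp: mdeg_def in_keys_iff)
qed (simp add: mdeg_def)

text \<open>The \<open>k\<close>-th power of the maximal ideal of the origin, described through its
  monomials.\<close>

definition order_ge :: "'v set \<Rightarrow> nat \<Rightarrow> 'v cpoly set" where
  "order_ge S k = {p \<in> polys S. \<forall>m\<in>Poly_Mapping.keys p. k \<le> mdeg m}"

lemma order_ge_0: "order_ge S 0 = polys S"
  by (simp add: order_ge_def)

lemma order_ge_antimono: "k \<le> k' \<Longrightarrow> order_ge S k' \<subseteq> order_ge S k"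
  by (auto simp: order_ge_def)

lemma order_ge_mult: "p \<in> order_ge S j \<Longrightarrow> q \<in> order_ge S k \<Longrightarrow> p * q \<in> order_ge S (j + k)"
  unfolding order_ge_def
proof (intro CollectI conjI ballI)
  assume *: "p \<in> {p \<in> polys S. \<forall>m\<in>Poly_Mapping.keys p. j \<le> mdeg m}"
    "q \<in> {p \<in> polys S. \<forall>m\<in>Poly_Mapping.keys p. k \<le> mdeg m}"
  then show "p * q \<in> polys S" by (auto intro: polys_mult)
  fix m assume "m \<in> Poly_Mapping.keys (p * q)"
  then obtain a b where "m = a + b" "a \<in> Poly_Mapping.keys p" "b \<in> Poly_Mapping.keys q"
    using keys_mult[of p q] by auto
  then show "j + k \<le> mdeg m" using * by (auto simp: mdeg_add intro: add_mono)
qed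

text \<open>\<open>A\<close> is only a generating set, so that the union
  \<open>I \<union> order_ge S k\<close> can stand for the sum of the two ideals.\<close>

definition codim_le :: "'v set \<Rightarrow> 'v cpoly set \<Rightarrow> nat \<Rightarrow> bool" where
  "codim_le S A n \<longleftrightarrow> (\<exists>B. finite B \<and> card B \<le> n \<and> polys S \<subseteq> cpoly.span (A \<union> B))"

lemma codim_le_mono:
  assumes "codim_le S A n" "A \<subseteq> A'" "n \<le> n'" shows "codim_le S A' n'"
proof -
  obtain B where B: "finite B" "card B \<le> n" "polys S \<subseteq> cpoly.span (A \<union> B)"
    using assms(1) by (auto simp: codim_le_def)
  have "cpoly.span (A \<union> B) \<subseteq> cpoly.span (A' \<union> B)" using assms(2) by (intro cpoly.span_mono) auto
  then show ?thesis using B assms(3) unfolding codim_le_def by (intro exI[of _ B]) auto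
qed

text \<open>Dimension count for multiplication by \<open>f\<close>: modulo \<open>A\<close>, the
  multiples of \<open>f\<close> are an image of \<open>polys S\<close> modulo \<open>A2\<close> and
  contribute at most \<open>b\<close>; modulo these multiples as well, at most \<open>a\<close>
  dimensions are left.\<close>

lemma codim_le_add:
  assumes A1: "codim_le S A1 a" "\<And>x. x \<in> A1 \<Longrightarrow> \<exists>g\<in>polys S. x - g * f \<in> cpoly.span A"
    and A2: "codim_le S A2 b" "\<And>g. g \<in> A2 \<Longrightarrow> g * f \<in> cpoly.span A"
  shows "codim_le S A (a + b)"
proof -
  obtain B1 where B1: "finite B1" "card B1 \<le> a" "polys S \<subseteq> cpoly.span (A1 \<union> B1)"
    using A1(1) by (auto simp: codim_le_def)
  obtain B2 where B2: "finite B2" "card B2 \<le> b" "polys S \<subseteq> cpoly.span (A2 \<union> B2)"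
    using A2(1) by (auto simp: codim_le_def)
  define B where "B = B1 \<union> (\<lambda>g. g * f) ` B2"
  have sub: "cpoly.span A \<subseteq> cpoly.span (A \<union> B)" by (intro cpoly.span_mono) auto
  have gf: "g * f \<in> cpoly.span (A \<union> B)" if "g \<in> cpoly.span (A2 \<union> B2)" for g
    using that
  proof (induction rule: cpoly.span_induct_alt)
    case base
    then show ?case by (simp add: cpoly.span_zero)
  next
    case (step c x y)
    have "x * f \<in> cpoly.span (A \<union> B)"
      using step(1) A2(2) sub by (auto simp: B_def intro: cpoly.span_base)
    then have "Const c * (x * f) + y * f \<in> cpoly.span (A \<union> B)"
      using step(2) by (intro cpoly.span_add cpoly.span_scale)
    then show ?case by (simp add: algebra_simps)
  qed
  have "x \<in> cpoly.span (A \<union> B)" if x: "x \<in> A1 \<union> B1" for x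
  proof (cases "x \<in> B1")
    case True
    then show ?thesis by (auto simp: B_def intro: cpoly.span_base)
  next
    case False
    then obtain g where g: "g \<in> polys S" "x - g * f \<in> cpoly.span A" using A1(2) x by blast
    have "(x - g * f) + g * f \<in> cpoly.span (A \<union> B)"
      using g sub gf B2(3) by (intro cpoly.span_add) auto
    then show ?thesis by simp
  qed
  then have "cpoly.span (A1 \<union> B1) \<subseteq> cpoly.span (A \<union> B)"
    by (intro cpoly.span_minimal cpoly.subspace_span) auto
  then have "polys S \<subseteq> cpoly.span (A \<union> B)" using B1(3) by blast
  moreover have "card B \<le> a + b"
    unfolding B_def using card_Un_le[of B1 "(\<lambda>g. g * f) ` B2"] card_image_le[OF B2(1), of "\<lambda>g. g * f"]
      B1(2) B2(2) by linarith
  moreover have "finite B" using B1 B2 by (simp add: B_def)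
  ultimately show ?thesis unfolding codim_le_def by blast
qed

definition codim :: "'v set \<Rightarrow> 'v cpoly set \<Rightarrow> nat" where
  "codim S A = (LEAST n. codim_le S A n)"

text \<open>The finitely many monomials of degree below \<open>k\<close> span a complement. This is
  the witness that makes the \<open>LEAST\<close> in \<open>codim\<close> meaningful for all ideals
  considered.\<close>

lemma codim_le_order_ge_ex:
  assumes S: "finite S" shows "\<exists>n. codim_le S (order_ge S k) n"
proof -
  define M where "M = {m \<in> box S k. mdeg m < k}"
  let ?B = "monomials M"
  have "p \<in> cpoly.span (order_ge S k \<union> ?B)" if p: "p \<in> polys S" for p
  proof -
    have "Poly_Mapping.single m 1 \<in> order_ge S k \<union> ?B" if m: "m \<in> Poly_Mapping.keys p" for m
    proof (cases "k \<le> mdeg m")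
      case True
      then show ?thesis using m p by (auto simp: order_ge_def polys_iff)
    next
      case False
      have "Poly_Mapping.lookup m v \<le> k" for v
      proof (cases "v \<in> Poly_Mapping.keys m")
        case True
        then have "Poly_Mapping.lookup m v \<le> mdeg m" unfolding mdeg_def by (intro member_le_sum) auto
        then show ?thesis using False by simp
      qed (simp add: in_keys_iff)
      then show ?thesis using m p False by (auto simp: M_def monomials_def box_def polys_iff)
    qed
    then have "monomials (Poly_Mapping.keys p) \<subseteq> order_ge S k \<union> ?B" by (auto simp: monomials_def)
    then have "cpoly.span (monomials (Poly_Mapping.keys p)) \<subseteq> cpoly.span (order_ge S k \<union> ?B)"
      by (rule cpoly.span_mono)
    then show ?thesis by (auto simp: span_monomials)
  qed
  moreover have "finite ?B" using S by (simp add: monomials_def M_def finite_box)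
  ultimately show ?thesis unfolding codim_le_def by blast
qed

definition trunc :: "nat \<Rightarrow> 'v cpoly \<Rightarrow> 'v cpoly" where
  "trunc k p = Abs_poly_mapping (\<lambda>m. if mdeg m < k then Poly_Mapping.lookup p m else 0)"

lemma lookup_trunc: "Poly_Mapping.lookup (trunc k p) m = (if mdeg m < k then Poly_Mapping.lookup p m else 0)"
proof -
  have "finite {m. (if mdeg m < k then Poly_Mapping.lookup p m else 0) \<noteq> 0}"
    by (rule finite_subset[of _ "Poly_Mapping.keys p"]) (auto simp: in_keys_iff)
  then show ?thesis by (simp add: trunc_def lookup_Abs_poly_mapping)
qed

lemma lookup_Const_mult: "Poly_Mapping.lookup (Const c * (p :: 'v cpoly)) m = c * Poly_Mapping.lookup p m"
  using lookup_single_mult[of 0 c p m] by (simp add: Const_def)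

text \<open>Truncation kills \<open>order_ge S k\<close> and fixes monomials of degree below
  \<open>k\<close>, so these lie in the span of the truncated complement. All of
  \<open>box S D\<close> qualifies, its degrees being at most \<open>card S * D\<close>.\<close>

lemma order_ge_codim_lower:
  fixes S :: "'v set"
  assumes S: "finite S" and n: "codim_le S (order_ge S k) n" and D: "card S * D < k"
  shows "(D + 1) ^ card S \<le> n"
proof (rule ccontr)
  assume no: "\<not> ?thesis"
  obtain B where B: "finite B" "card B \<le> n" "polys S \<subseteq> cpoly.span (order_ge S k \<union> B)"
    using n by (auto simp: codim_le_def)
  have tr: "trunc k p \<in> cpoly.span (trunc k ` B)" if "p \<in> cpoly.span (order_ge S k \<union> B)" for p
    using that
  proof (induction rule: cpoly.span_induct_alt)
    case base
    have "trunc k (0 :: 'v cpoly) = 0" by (intro poly_mapping_eqI) (simp add: lookup_trunc)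
    then show ?case by (simp only: cpoly.span_zero)
  next
    case (step c x y)
    have "trunc k x \<in> cpoly.span (trunc k ` B)"
    proof (cases "x \<in> B")
      case False
      then have "trunc k x = 0"
        using step(1) by (intro poly_mapping_eqI)
          (auto simp: lookup_trunc order_ge_def simp flip: not_in_keys_iff_lookup_eq_zero)
      then show ?thesis by (simp add: cpoly.span_zero)
    qed (simp add: cpoly.span_base)
    moreover have "trunc k (Const c * x + y) = Const c * trunc k x + trunc k y"
      by (intro poly_mapping_eqI) (simp add: lookup_trunc lookup_add lookup_Const_mult)
    ultimately show ?case using step(2) by (auto intro: cpoly.span_add cpoly.span_scale)
  qed
  have "Poly_Mapping.single m 1 \<in> cpoly.span (trunc k ` B)" if m: "m \<in> box S D" for m
  proof -
    have "mdeg m = (\<Sum>v\<in>S. Poly_Mapping.lookup m v)"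
      using m S by (intro mdeg_superset) (auto simp: box_def)
    also have "\<dots> \<le> card S * D" using m by (intro sum_bounded_above[THEN order_trans]) (auto simp: box_def)
    finally have "mdeg m < k" using D by simp
    then have "trunc k (Poly_Mapping.single m 1) = Poly_Mapping.single m 1"
      by (intro poly_mapping_eqI) (auto simp: lookup_trunc lookup_single when_def)
    moreover have "Poly_Mapping.single m 1 \<in> polys S" using m by (auto simp: polys_iff box_def)
    ultimately show ?thesis using tr[of "Poly_Mapping.single m 1"] B(3) by auto
  qed
  moreover have "card (trunc k ` B) < card (box S D)"
    using card_image_le[OF B(1), of "trunc k"] B(2) no S by (simp add: card_box)
  ultimately obtain c where c: "\<exists>m\<in>box S D. c m \<noteq> 0"
      "(\<Sum>m\<in>box S D. Const (c m) * Poly_Mapping.single m 1) = 0"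
    using family_dependent[of "box S D" "trunc k ` B" "\<lambda>m. Poly_Mapping.single m 1"] S B(1) finite_box
    by blast
  then obtain m where m: "m \<in> box S D" "c m \<noteq> 0" by blast
  have "(\<Sum>m'\<in>box S D. Poly_Mapping.lookup (Const (c m') * Poly_Mapping.single m' 1) m) = 0"
    using arg_cong[OF c(2), of "\<lambda>p. Poly_Mapping.lookup p m"] by (simp add: lookup_sum)
  then show False
    using m S finite_box[OF S] by (simp add: lookup_Const_mult lookup_single when_def if_distrib
        sum.delta' cong: if_cong)
qed

text \<open>The Hilbert--Samuel function of an ideal at the origin.\<close>

definition hs :: "'v set \<Rightarrow> 'v cpoly set \<Rightarrow> nat \<Rightarrow> nat" where
  "hs S I k = codim S (I \<union> order_ge S k)"

context
  fixes S :: "'v set"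
  assumes S: "finite S"
begin

lemma hs_codim_le: "codim_le S (I \<union> order_ge S k) (hs S I k)"
proof -
  obtain n where "codim_le S (order_ge S k) n" using codim_le_order_ge_ex[OF S] by blast
  then have "codim_le S (I \<union> order_ge S k) n" by (rule codim_le_mono) auto
  then show ?thesis unfolding hs_def codim_def by (rule LeastI)
qed

lemma hs_le: "codim_le S (I \<union> order_ge S k) n \<Longrightarrow> hs S I k \<le> n"
  unfolding hs_def codim_def by (rule Least_le)

lemma hs_mono: "k \<le> k' \<Longrightarrow> hs S I k \<le> hs S I k'"
  by (rule hs_le, rule codim_le_mono[OF hs_codim_le[of I k']]) (use order_ge_antimono in auto)

lemma hs_le_1:
  assumes "order_ge S 1 \<subseteq> I" shows "hs S I k \<le> 1"
proof (rule hs_le)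
  have "p \<in> cpoly.span ((I \<union> order_ge S k) \<union> {1})" if p: "p \<in> polys S" for p
  proof -
    define c where "c = Poly_Mapping.lookup p 0"
    have "p - Const c \<in> polys S" using p by (intro polys_diff) auto
    moreover have "Poly_Mapping.lookup (p - Const c) 0 = 0" by (simp add: lookup_minus Const_def c_def)
    then have "1 \<le> mdeg m" if "m \<in> Poly_Mapping.keys (p - Const c)" for m
      using that mdeg_eq_0_iff[of m] by (cases "m = 0") (auto simp: in_keys_iff)
    ultimately have "p - Const c \<in> order_ge S 1" by (auto simp: order_ge_def)
    then have "(p - Const c) + Const c * 1 \<in> cpoly.span ((I \<union> order_ge S k) \<union> {1})"
      using assms by (intro cpoly.span_add cpoly.span_scale cpoly.span_base) auto
    then show ?thesis by simp
  qed
  then show "codim_le S (I \<union> order_ge S k) 1" unfolding codim_le_def by (intro exI[of _ "{1}"]) auto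
qed

lemma hs_eq_0:
  assumes "polys S \<subseteq> I \<union> order_ge S k" shows "hs S I k = 0"
proof -
  have "polys S \<subseteq> cpoly.span (I \<union> order_ge S k \<union> {})"
    using assms cpoly.span_superset[of "I \<union> order_ge S k"] by auto
  then have "codim_le S (I \<union> order_ge S k) 0" unfolding codim_le_def by (intro exI[of _ "{}"]) auto
  then show ?thesis using hs_le by fastforce
qed

context
  fixes I f
  assumes I: "ideal_in (polys S) I" and f: "f \<in> polys S"
begin

interpretation K: subring "polys S" by unfold_locales (rule subring_of_polys)
interpretation I: ring_ideal "polys S" I by (rule K.ring_idealI[OF I])

lemma adjoin_mod:
  assumes "x \<in> ideal_adjoin (polys S) I f \<union> order_ge S k"
  shows "\<exists>g\<in>polys S. x - g * f \<in> cpoly.span (I \<union> order_ge S k)"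
proof (cases "x \<in> order_ge S k")
  case True
  then show ?thesis by (intro bexI[of _ 0]) (auto intro: cpoly.span_base)
next
  case False
  then obtain i a where "x = i + a * f" "i \<in> I" "a \<in> polys S"
    using assms by (auto simp: ideal_adjoin_def)
  then show ?thesis by (intro bexI[of _ a]) (auto intro: cpoly.span_base)
qed

text \<open>Multiplication by \<open>f\<close> embeds the quotient by the colon ideal
  \<open>I : f\<close> into the quotient by \<open>I\<close>, with cokernel the quotient by
  \<open>I + (f)\<close>; cutting off at order \<open>k\<close> leaves an inequality.\<close>

lemma hs_colon: "hs S I k \<le> hs S (ideal_adjoin (polys S) I f) k + hs S {g \<in> polys S. g * f \<in> I} k"
proof (rule hs_le, rule codim_le_add[OF hs_codim_le adjoin_mod hs_codim_le])
  fix g assume "g \<in> {g \<in> polys S. g * f \<in> I} \<union> order_ge S k"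
  moreover have "f \<in> order_ge S 0" using f by (simp add: order_ge_0)
  ultimately have "g * f \<in> I \<union> order_ge S k" using order_ge_mult[of g S k f 0] by auto
  then show "g * f \<in> cpoly.span (I \<union> order_ge S k)" by (rule cpoly.span_base)
qed

text \<open>Multiplication by an \<open>f\<close> vanishing at the origin raises the order by one,
  so the multiples of \<open>f\<close> are controlled already by \<open>hs S I k\<close>.\<close>

lemma hs_Suc:
  assumes f1: "f \<in> order_ge S 1"
  shows "hs S I (Suc k) \<le> hs S (ideal_adjoin (polys S) I f) (Suc k) + hs S I k"
proof (rule hs_le, rule codim_le_add[OF hs_codim_le adjoin_mod hs_codim_le])
  fix g assume "g \<in> I \<union> order_ge S k"
  then have "g * f \<in> I \<union> order_ge S (Suc k)"
    using order_ge_mult[OF _ f1, of g k] I.I_mult'[OF f] by auto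
  then show "g * f \<in> cpoly.span (I \<union> order_ge S (Suc k))" by (rule cpoly.span_base)
qed

text \<open>Iterates \<open>hs_Suc\<close> and uses monotonicity in the order. In effect, one
  equation lowers the degree of growth by at most one, the counterpart of Krull's principal ideal
  theorem.\<close>

lemma hs_adjoin:
  assumes f1: "f \<in> order_ge S 1"
  shows "hs S I k \<le> k * hs S (ideal_adjoin (polys S) I f) k"
proof (induction k)
  case 0
  show ?case using hs_eq_0[of I 0] by (simp add: order_ge_0)
next
  case (Suc k)
  let ?J = "ideal_adjoin (polys S) I f"
  have "hs S I (Suc k) \<le> hs S ?J (Suc k) + k * hs S ?J k" using hs_Suc[OF f1, of k] Suc by simp
  also have "\<dots> \<le> hs S ?J (Suc k) + k * hs S ?J (Suc k)"
    using hs_mono[of k "Suc k" ?J] by simp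
  finally show ?case by simp
qed

end

text \<open>The bound is asked for infinitely many \<open>k\<close> only, so no Hilbert polynomial
  has to exist, and its failure is a strict upper bound for all large \<open>k\<close>, as used in
  \<open>growth_colon\<close>.\<close>

definition growth :: "nat \<Rightarrow> 'v cpoly set \<Rightarrow> bool" where
  "growth t I \<longleftrightarrow> (\<exists>c>0. \<forall>m. \<exists>k>m. c * real k ^ t \<le> real (hs S I k))"

lemma growth_zero: "growth (card S) {0}"
proof -
  define N where "N = max 1 (card S)"
  have N: "N > 0" "card S \<le> N" by (auto simp: N_def)
  have "(1 / real N ^ card S) * real k ^ card S \<le> real (hs S {0} k)" if k: "k > 0" for k
  proof -
    \<comment> \<open>The choice gives \<open>card S * D < k\<close> and
      \<open>k \<le> N * (D + 1)\<close>, so \<open>D + 1\<close> is at least \<open>k / N\<close>;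
      the maximum in \<open>N\<close> guards the division when \<open>S\<close> is empty.\<close>
    define D where "D = (k - 1) div N"
    have "card S * D \<le> N * D" using N by simp
    also have "\<dots> \<le> k - 1" by (simp add: D_def)
    finally have D: "card S * D < k" using k by simp
    have "0 \<in> order_ge S k" by (simp add: order_ge_def)
    then have "{0} \<union> order_ge S k = order_ge S k" by auto
    then have h: "(D + 1) ^ card S \<le> hs S {0} k"
      using order_ge_codim_lower[OF S _ D] hs_codim_le[of "{0}" k] by simp
    have "k \<le> N * (D + 1)"
      using dividend_less_div_times[of N "k - 1"] N(1) k by (simp add: D_def algebra_simps)
    then have "real k \<le> real (D + 1) * real N" by (simp only: of_nat_le_iff mult.commute flip: of_nat_mult)
    then have "real k / real N \<le> real (D + 1)"
      using N(1) by (simp only: divide_le_eq of_nat_0_less_iff) simp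
    then have "(real k / real N) ^ card S \<le> real (D + 1) ^ card S" by (intro power_mono) auto
    also have "real (D + 1) ^ card S = real ((D + 1) ^ card S)" by simp
    also have "\<dots> \<le> real (hs S {0} k)" using h by (rule of_nat_mono)
    finally have "(real k / real N) ^ card S \<le> real (hs S {0} k)" .
    then show ?thesis by (simp add: power_divide)
  qed
  then have "\<forall>m. \<exists>k>m. (1 / real N ^ card S) * real k ^ card S \<le> real (hs S {0} k)"
    by (meson lessI zero_less_Suc)
  moreover have "0 < 1 / real N ^ card S" using N(1) by simp
  ultimately show ?thesis unfolding growth_def by blast
qed

lemma growth_adjoin:
  assumes "ideal_in (polys S) I" "f \<in> order_ge S 1" "growth (Suc t) I"
  shows "growth t (ideal_adjoin (polys S) I f)"
proof -
  have f: "f \<in> polys S" using assms(2) by (simp add: order_ge_def)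
  obtain c where c: "c > 0" "\<And>m. \<exists>k>m. c * real k ^ Suc t \<le> real (hs S I k)"
    using assms(3) by (auto simp: growth_def)
  let ?J = "ideal_adjoin (polys S) I f"
  have "\<exists>k>m. c * real k ^ t \<le> real (hs S ?J k)" for m
  proof -
    obtain k where k: "k > m" "c * real k ^ Suc t \<le> real (hs S I k)" using c(2) by blast
    have "real (hs S I k) \<le> real k * real (hs S ?J k)"
      using hs_adjoin[OF assms(1) f assms(2), of k] by (simp flip: of_nat_mult)
    then have "real k * (c * real k ^ t) \<le> real k * real (hs S ?J k)" using k(2) by (simp add: algebra_simps)
    then show ?thesis using k(1) by (intro exI[of _ k]) (simp add: mult_le_cancel_left)
  qed
  then show ?thesis unfolding growth_def using c(1) by blast
qed

lemma growth_colon: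
  assumes "ideal_in (polys S) I" "f \<in> polys S" "growth t I"
  shows "growth t (ideal_adjoin (polys S) I f) \<or> growth t {g \<in> polys S. g * f \<in> I}"
    (is "growth t ?J \<or> growth t ?Q")
proof (rule ccontr)
  assume no: "\<not> ?thesis"
  obtain c where c: "c > 0" "\<And>m. \<exists>k>m. c * real k ^ t \<le> real (hs S I k)"
    using assms(3) by (auto simp: growth_def)
  \<comment> \<open>With the constant \<open>c / 2\<close> for both ideals, the sum of their values
    eventually stays below \<open>c * real k ^ t\<close>, which \<open>hs S I k\<close> reaches
    infinitely often.\<close>
  have ex: "\<exists>m. \<forall>k>m. real (hs S J k) < c / 2 * real k ^ t" if "\<not> growth t J" for J
    using that c(1) unfolding growth_def by (meson half_gt_zero not_le)
  obtain m m' where m: "\<And>k. k > m \<Longrightarrow> real (hs S ?J k) < c / 2 * real k ^ t"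
    "\<And>k. k > m' \<Longrightarrow> real (hs S ?Q k) < c / 2 * real k ^ t"
    using ex[of ?J] ex[of ?Q] no by blast
  obtain k where k: "k > max m m'" "c * real k ^ t \<le> real (hs S I k)" using c(2) by blast
  have "real (hs S I k) \<le> real (hs S ?J k) + real (hs S ?Q k)"
    using hs_colon[OF assms(1,2), of k] by (simp flip: of_nat_add)
  then show False using m(1)[of k] m(2)[of k] k by simp
qed

lemma growth_proper:
  assumes "growth t I" shows "1 \<notin> I \<or> \<not> ideal_in (polys S) I"
proof (rule ccontr)
  assume *: "\<not> ?thesis"
  then have "polys S \<subseteq> I" unfolding ideal_in_def by (metis mult.right_neutral subsetI)
  then have hs0: "hs S I k = 0" for k by (intro hs_eq_0) auto
  obtain c where c: "c > 0" "\<And>m. \<exists>k>m. c * real k ^ t \<le> real (hs S I k)"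
    using assms by (auto simp: growth_def)
  obtain k where k: "k > 0" "c * real k ^ t \<le> 0" using c(2)[of 0] by (auto simp: hs0)
  have "0 < c * real k ^ t" using c(1) k(1) by simp
  then show False using k(2) by simp
qed

end

text \<open>\<open>P\<close> is maximal among the ideals above \<open>I\<close> with growth
  \<open>t\<close>. If \<open>a * b \<in> P\<close>, growth passes to \<open>P + (a)\<close> or to
  the colon ideal \<open>P : a\<close>, so one of these equals \<open>P\<close>: the first gives
  \<open>a \<in> P\<close>, the second \<open>b \<in> P\<close>.\<close>

lemma growth_prime:
  fixes S :: "'v::linorder set"
  assumes S: "finite S" and I: "ideal_in (polys S) I" and g: "growth S t I"
  obtains P where "prime_in (polys S) P" "I \<subseteq> P" "growth S t P"
proof -
  let ?F = "{J. ideal_in (polys S) J \<and> I \<subseteq> J \<and> growth S t J}"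
  have "?F \<noteq> {}" using I g by blast
  then obtain P where P: "P \<in> ?F" "\<And>J. J \<in> ?F \<Longrightarrow> P \<subseteq> J \<Longrightarrow> J = P"
    by (rule polys_noetherian[OF S, of ?F]) auto
  interpret K: subring "polys S" by unfold_locales (rule subring_of_polys)
  interpret P: ring_ideal "polys S" P using P(1) by (intro K.ring_idealI) auto
  have "a \<in> P \<or> b \<in> P" if ab: "a \<in> polys S" "b \<in> polys S" "a * b \<in> P" for a b
  proof -
    have Q: "ideal_in (polys S) {g \<in> polys S. g * a \<in> P}"
      using ab(1) by (auto simp: ideal_in_def distrib_right mult.assoc
          intro: polys_add polys_mult P.I_add P.I_mult P.I_zero)
    have PQ: "P \<subseteq> {g \<in> polys S. g * a \<in> P}" using P.I_mult'[OF ab(1)] P.I_sub by auto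
    from growth_colon[OF S P.ideal ab(1), of t] P(1)
    consider "growth S t (ideal_adjoin (polys S) P a)" | "growth S t {g \<in> polys S. g * a \<in> P}" by blast
    then show ?thesis
    proof cases
      case 1
      then have "ideal_adjoin (polys S) P a = P"
        using P.adjoin_ideal[OF ab(1)] P.adjoin_superset[of a] P(1) by (intro P(2)) auto
      then show ?thesis using P.adjoin_mem[of a] by blast
    next
      case 2
      then have "{g \<in> polys S. g * a \<in> P} = P" using Q PQ P(1) by (intro P(2)) auto
      moreover have "b \<in> {g \<in> polys S. g * a \<in> P}" using ab by (simp add: mult.commute[of b a])
      ultimately show ?thesis by blast
    qed
  qed
  moreover have "1 \<notin> P" using growth_proper[OF S] P(1) by auto
  ultimately have "prime_in (polys S) P" using P(1) by (auto simp: prime_in_def)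
  then show thesis using that P(1) by blast
qed

text \<open>A prime with growth of positive degree cannot contain the maximal ideal of the origin.
  Adjoining an element of that ideal outside the prime costs one degree of growth and makes the next
  inclusion strict.\<close>

lemma growth_prime_chain:
  fixes S :: "'v::linorder set"
  assumes S: "finite S" and "ideal_in (polys S) I" "growth S t I"
  shows "\<exists>P. prime_chain (polys S) I t P"
  using assms(2-)
proof (induction t arbitrary: I)
  case 0
  obtain P where "prime_in (polys S) P" "I \<subseteq> P" using growth_prime[OF S 0] by blast
  then show ?case by (intro exI[of _ "\<lambda>_. P"]) (auto simp: prime_chain_def)
next
  case (Suc t)
  obtain P where P: "prime_in (polys S) P" "I \<subseteq> P" "growth S (Suc t) P"
    using growth_prime[OF S Suc.prems] by blast
  have "\<not> order_ge S 1 \<subseteq> P"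
  proof
    assume *: "order_ge S 1 \<subseteq> P"
    obtain c where c: "c > 0" "\<And>m. \<exists>k>m. c * real k ^ Suc t \<le> real (hs S P k)"
      using P(3) S by (auto simp: growth_def)
    \<comment> \<open>For \<open>k > 1 / c\<close> the growth exceeds 1, the bound that
      \<open>hs_le_1\<close> gives for an ideal containing \<open>order_ge S 1\<close>.\<close>
    obtain k where k: "k > nat \<lceil>1 / c\<rceil>" "c * real k ^ Suc t \<le> real (hs S P k)" using c(2) by blast
    have "1 / c < real k" using k(1) by linarith
    then have "1 < c * real k" using c(1) by (simp add: field_simps)
    also have "\<dots> \<le> c * real k ^ Suc t"
      using c(1) k(1) self_le_power[of "real k" "Suc t"] by (intro mult_left_mono) auto
    finally show False using k(2) hs_le_1[OF S *, of k] by simp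
  qed
  then obtain f where f: "f \<in> order_ge S 1" "f \<notin> P" by blast
  interpret K: subring "polys S" by unfold_locales (rule subring_of_polys)
  interpret P: ring_ideal "polys S" P using P(1) by (intro K.ring_idealI prime_in_ideal)
  let ?J = "ideal_adjoin (polys S) P f"
  have "f \<in> polys S" using f(1) by (simp add: order_ge_def)
  then obtain R where R: "prime_chain (polys S) ?J t R"
    using Suc.IH[OF P.adjoin_ideal growth_adjoin[OF S P.ideal f(1) P(3)]] by blast
  have "?J \<subseteq> R 0" using R by (auto simp: prime_chain_def)
  then have "P \<subset> R 0" using P.adjoin_superset[of f] P.adjoin_mem[of f] f(2) by blast
  have sub: "I \<subseteq> R i" if "i \<le> t" for i
    using R that P(2) P.adjoin_superset[of f] by (auto simp: prime_chain_def)
  have "prime_chain (polys S) I (Suc t) (\<lambda>i. case i of 0 \<Rightarrow> P | Suc i \<Rightarrow> R i)"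
    unfolding prime_chain_def
  proof (intro conjI allI impI)
    fix i assume "i \<le> Suc t"
    then show "prime_in (polys S) (case i of 0 \<Rightarrow> P | Suc i \<Rightarrow> R i)"
      "I \<subseteq> (case i of 0 \<Rightarrow> P | Suc i \<Rightarrow> R i)"
      using P R sub by (cases i; simp add: prime_chain_def)+
  next
    fix i assume "i < Suc t"
    then show "(case i of 0 \<Rightarrow> P | Suc i \<Rightarrow> R i) \<subset> (case Suc i of 0 \<Rightarrow> P | Suc i \<Rightarrow> R i)"
      using R \<open>P \<subset> R 0\<close> by (cases i) (auto simp: prime_chain_def)
  qed
  then show ?case by blast
qed

section \<open>The dimension of an intersection of hypersurfaces\<close>

text \<open>The zero ideal has growth of degree \<open>card S\<close>, and each equation vanishing
  at the origin costs at most one degree; what is left becomes a chain.\<close>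

lemma prime_chain_at_origin:
  fixes S :: "'v::linorder set"
  assumes S: "finite S" and F: "finite F" "F \<subseteq> order_ge S 1" "card F \<le> card S"
  shows "\<exists>P. prime_chain (polys S) F (card S - card F) P"
proof -
  have "\<exists>I. ideal_in (polys S) I \<and> F \<subseteq> I \<and> growth S (card S - card F) I"
    using F
  proof (induction F rule: finite_induct)
    case empty
    have "ideal_in (polys S) {0}" by (auto simp: ideal_in_def)
    then show ?case using growth_zero[OF S] by auto
  next
    case (insert f F)
    then obtain I where I: "ideal_in (polys S) I" "F \<subseteq> I" "growth S (card S - card F) I" by auto
    interpret K: subring "polys S" by unfold_locales (rule subring_of_polys)
    interpret I: ring_ideal "polys S" I using I by (intro K.ring_idealI)
    have f: "f \<in> order_ge S 1" "f \<in> polys S" using insert.prems by (auto simp: order_ge_def)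
    have "card S - card F = Suc (card S - card (insert f F))" using insert by simp
    then have "growth S (card S - card (insert f F)) (ideal_adjoin (polys S) I f)"
      using growth_adjoin[OF S I(1) f(1)] I(3) by simp
    moreover have "insert f F \<subseteq> ideal_adjoin (polys S) I f"
      using I(2) I.adjoin_superset[of f] I.adjoin_mem[of f] by blast
    ultimately show ?case using I.adjoin_ideal[OF f(2)] by blast
  qed
  then obtain I where I: "ideal_in (polys S) I" "F \<subseteq> I" "growth S (card S - card F) I" by blast
  then obtain P where "prime_chain (polys S) I (card S - card F) P"
    using growth_prime_chain[OF S] by blast
  then show ?thesis using I(2) by (intro exI[of _ P]) (auto simp: prime_chain_def)
qed

section \<open>Moving a zero to the origin\<close>

definition translate :: "('v \<Rightarrow> complex) \<Rightarrow> 'v cpoly \<Rightarrow> 'v cpoly" where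
  "translate a = insertion Const (\<lambda>v. Var v + Const (a v))"

lemma translate_hom: "comm_ring_hom (translate a)"
  unfolding translate_def by (rule insertion_comm_ring_hom[OF comm_ring_hom_Const])

lemma translate_polys: "p \<in> polys S \<Longrightarrow> translate a p \<in> polys S"
  unfolding translate_def by (rule insertion_polys) (auto intro: polys_add)

lemma translate_Const: "translate a (Const c) = Const c"
  by (simp add: translate_def insertion_Const[OF comm_ring_hom_Const])

lemma translate_Var: "translate a (Var v) = Var v + Const (a v)"
  by (simp add: translate_def insertion_Var[OF comm_ring_hom_Const])

lemma comm_ring_hom_compose:
  assumes "comm_ring_hom f" "comm_ring_hom g" shows "comm_ring_hom (\<lambda>x. f (g x))"
proof -
  interpret f: comm_ring_hom f by (rule assms)
  interpret g: comm_ring_hom g by (rule assms)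
  show ?thesis by unfold_locales (auto simp: f.hom_add g.hom_add f.hom_mult g.hom_mult)
qed

lemma translate_translate_uminus: "translate a (translate (\<lambda>v. - a v) p) = p"
proof (rule comm_ring_hom_eqI[OF comm_ring_hom_compose[OF translate_hom translate_hom], where g = "\<lambda>p. p" and S = UNIV])
  interpret t: comm_ring_hom "translate a" by (rule translate_hom)
  show "translate a (translate (\<lambda>v. - a v) (Var v)) = Var v" for v
    by (simp add: translate_Var t.hom_add t.hom_minus translate_Const Const.hom_uminus)
  show "comm_ring_hom (\<lambda>p :: 'a cpoly. p)" by unfold_locales auto
qed (auto simp: translate_Const polys_def)

lemma poly_eval_translate: "poly_eval (translate a p) x = poly_eval p (\<lambda>v. x v + a v)"
proof (rule comm_ring_hom_eqI[OF comm_ring_hom_compose[OF poly_eval.comm_ring_hom_axioms translate_hom]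
      poly_eval.comm_ring_hom_axioms, where S = UNIV])
qed (auto simp: translate_Const translate_Var poly_eval.hom_add polys_def)

lemma poly_eval_0: "poly_eval p (\<lambda>v. 0) = Poly_Mapping.lookup p 0"
proof (induction p rule: cpoly_induct)
  case (single_plus m c p)
  have "mono_val (\<lambda>v. 0 :: complex) m = (if m = 0 then 1 else 0)"
  proof (cases "m = 0")
    case False
    then obtain v where v: "Poly_Mapping.lookup m v \<noteq> 0"
      using poly_mapping_eqI[of m 0] by (metis lookup_zero)
    then have "v \<in> Poly_Mapping.keys m" "(0 :: complex) ^ Poly_Mapping.lookup m v = 0"
      by (auto simp: in_keys_iff)
    then have "mono_val (\<lambda>v. 0 :: complex) m = 0"
      unfolding mono_val_def by (intro prod_zero) (simp, blast)
    then show ?thesis using False by simp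
  qed simp
  then show ?case
    using single_plus by (simp add: poly_eval.hom_add lookup_add lookup_single when_def)
      (simp add: poly_eval_insertion insertion_single[OF comm_ring_hom_id])
qed simp

text \<open>Growth is measured at the origin, so the common zero \<open>a\<close> is moved there;
  the primes are pulled back along the translation, which is an automorphism.\<close>

theorem prime_chain_at_zero:
  fixes S :: "'v::linorder set"
  assumes S: "finite S" and F: "finite F" "F \<subseteq> polys S" "card F \<le> card S"
    and a: "\<And>f. f \<in> F \<Longrightarrow> poly_eval f a = 0"
  shows "\<exists>P. prime_chain (polys S) F (card S - card F) P"
proof -
  interpret t: comm_ring_hom "translate a" by (rule translate_hom)
  have inj: "inj (translate a)"
    using translate_translate_uminus[of "\<lambda>v. - a v"] by (intro inj_on_inverseI) simp
  have "translate a f \<in> order_ge S 1" if f: "f \<in> F" for f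
  proof -
    have "Poly_Mapping.lookup (translate a f) 0 = 0"
      using a[OF f] by (simp flip: poly_eval_0 add: poly_eval_translate)
    then have "1 \<le> mdeg m" if "m \<in> Poly_Mapping.keys (translate a f)" for m
      using that mdeg_eq_0_iff[of m] by (cases "m = 0") (auto simp: in_keys_iff)
    then show ?thesis using f F(2) translate_polys[of f S a] by (auto simp: order_ge_def)
  qed
  then obtain P where P: "prime_chain (polys S) (translate a ` F) (card S - card F) P"
    using prime_chain_at_origin[OF S, of "translate a ` F"] F(1,3)
    by (auto simp: card_image[OF inj_on_subset[OF inj]])
  define R where "R i = {p \<in> polys S. translate a p \<in> P i}" for i
  have R: "prime_in (polys S) (R i)" if "prime_in (polys S) (P i)" for i
    unfolding prime_in_def
  proof (intro conjI ballI impI)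
    show "ideal_in (polys S) (R i)"
      using that translate_polys[of _ S a] unfolding prime_in_def ideal_in_def R_def
      by (simp add: t.hom_add t.hom_mult polys_add polys_mult subset_iff)
    show "1 \<notin> R i" using that by (simp add: prime_in_def R_def)
    fix p q assume "p \<in> polys S" "q \<in> polys S" "p * q \<in> R i"
    then show "p \<in> R i \<or> q \<in> R i"
      using that translate_polys[of p S a] translate_polys[of q S a]
      unfolding prime_in_def R_def by (simp add: t.hom_mult)
  qed
  have "prime_chain (polys S) F (card S - card F) R"
    unfolding prime_chain_def
  proof (intro conjI allI impI)
    fix i assume "i \<le> card S - card F"
    then have i: "prime_in (polys S) (P i)" "translate a ` F \<subseteq> P i"
      using P by (auto simp: prime_chain_def)
    show "prime_in (polys S) (R i)" using R[OF i(1)] .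
    show "F \<subseteq> R i" using i(2) F(2) by (auto simp: R_def)
  next
    fix i assume "i < card S - card F"
    then have PP: "P i \<subset> P (Suc i)" "P (Suc i) \<subseteq> polys S"
      using P by (auto simp: prime_chain_def prime_in_def ideal_in_def)
    then obtain q where q: "q \<in> P (Suc i)" "q \<notin> P i" by blast
    let ?q = "translate (\<lambda>v. - a v) q"
    have "?q \<in> R (Suc i)" "?q \<notin> R i"
      using q PP translate_polys[of q S] by (auto simp: R_def translate_translate_uminus)
    moreover have "R i \<subseteq> R (Suc i)" using PP by (auto simp: R_def)
    ultimately show "R i \<subset> R (Suc i)" by blast
  qed
  then show ?thesis by blast
qed

section \<open>Dimension of projections under square roots\<close>

lemma polys_induct [consumes 1, case_names Const Var add mult]:
  assumes "p \<in> polys S" and "\<And>c. Q (Const c)" and "\<And>v. v \<in> S \<Longrightarrow> Q (Var v)"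
    and add: "\<And>p q. Q p \<Longrightarrow> Q q \<Longrightarrow> Q (p + q)" and mult: "\<And>p q. Q p \<Longrightarrow> Q q \<Longrightarrow> Q (p * q)"
  shows "Q p"
proof -
  have 0: "Q 0" and 1: "Q 1" using assms(2)[of 0] assms(2)[of 1] by simp_all
  have sum: "Q (sum f A)" if "\<And>i. i \<in> A \<Longrightarrow> Q (f i)" for f :: "('a \<Rightarrow>\<^sub>0 nat) \<Rightarrow> _" and A
    using that by (induction A rule: infinite_finite_induct) (auto intro: 0 add)
  have prod: "Q (prod f A)" if "\<And>i. i \<in> A \<Longrightarrow> Q (f i)" for f :: "'a \<Rightarrow> _" and A
    using that by (induction A rule: infinite_finite_induct) (auto intro: 1 mult)
  have power: "Q (p ^ k)" if "Q p" for p k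
    using that by (induction k) (auto intro: 1 mult)
  have "Q (insertion Const Var p)"
    unfolding insertion_def mono_val_def
  proof (intro sum mult prod power assms(2) assms(3))
    fix m v assume "m \<in> Poly_Mapping.keys p" "v \<in> Poly_Mapping.keys m"
    then show "v \<in> S" using assms(1) by (auto simp: polys_iff)
  qed
  then show ?thesis by (simp add: insertion_Const_Var)
qed

lemma coord_proj_extensional: "coord_proj S ` X \<subseteq> S \<rightarrow>\<^sub>E UNIV"
  by (auto simp: coord_proj_def)

lemma poly_eval_coord_proj:
  assumes "p \<in> polys S" "S \<subseteq> T"
  shows "poly_eval p (coord_proj T W) = poly_eval p (coord_proj S W)"
  by (rule poly_eval_cong) (use assms in \<open>auto simp: coord_proj_def polys_def\<close>)

text \<open>Contracting the ideal of the larger projection gives that of the smaller one, so chains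
  above both can be compared by \<open>square_root_extension\<close>.\<close>

lemma vanishing_coord_proj:
  assumes "S \<subseteq> T"
  shows "vanishing T (coord_proj T ` X) \<inter> polys S = vanishing S (coord_proj S ` X)"
  using poly_eval_coord_proj[OF _ assms] polys_mono[OF assms] by (auto simp: vanishing_def)

text \<open>On \<open>X\<close> the variable of \<open>e\<close> squares to \<open>q\<close>, so
  modulo the vanishing ideal every polynomial is linear in \<open>Var e\<close>: this class contains
  the generators and is closed under sums and products.\<close>

lemma square_root_extension_polys:
  fixes S :: "(nat \<times> nat) set"
  assumes q: "q \<in> polys S" and sq: "\<And>W. W \<in> X \<Longrightarrow> (W $$ e)\<^sup>2 = poly_eval q (coord_proj S W)"
  shows "square_root_extension (polys S) (polys (insert e S))
    (vanishing (insert e S) (coord_proj (insert e S) ` X)) (Var e) q"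
proof -
  let ?T = "insert e S" let ?Q = "vanishing ?T (coord_proj ?T ` X)"
  interpret B: subring "polys ?T" by unfold_locales (rule subring_of_polys)
  interpret Q: ring_ideal "polys ?T" ?Q by (rule B.ring_idealI[OF ideal_vanishing])
  have sub: "polys S \<subseteq> polys ?T" by (rule polys_mono) auto
  have y2: "Var e * Var e - q \<in> ?Q"
  proof -
    have "poly_eval (Var e * Var e - q) (coord_proj ?T W) = 0" if "W \<in> X" for W
    proof -
      have "coord_proj ?T W e = W $$ e" by (simp add: coord_proj_def)
      moreover have "poly_eval q (coord_proj ?T W) = (W $$ e)\<^sup>2"
        using poly_eval_coord_proj[OF q, of ?T W] sq[OF that] by auto
      ultimately show ?thesis by (simp add: poly_eval.hom_minus poly_eval.hom_mult power2_eq_square)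
    qed
    then show ?thesis using q sub by (auto simp: vanishing_def intro!: polys_diff polys_mult)
  qed
  have "\<exists>a\<in>polys S. \<exists>a'\<in>polys S. b - (a + a' * Var e) \<in> ?Q" if "b \<in> polys ?T" for b
    using that
  proof (induction rule: polys_induct)
    case (Const c)
    show ?case by (intro bexI[of _ "Const c"] bexI[of _ 0]) (simp_all add: Q.I_zero)
  next
    case (Var v)
    show ?case
    proof (cases "v \<in> S")
      case True
      then show ?thesis by (intro bexI[of _ "Var v"] bexI[of _ 0]) (simp_all add: Q.I_zero)
    next
      case False
      then show ?thesis using Var by (intro bexI[of _ 0] bexI[of _ 1]) (simp_all add: Q.I_zero)
    qed
  next
    case (add p p')
    then obtain a b c d where *: "a \<in> polys S" "b \<in> polys S" "c \<in> polys S" "d \<in> polys S"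
      "p - (a + b * Var e) \<in> ?Q" "p' - (c + d * Var e) \<in> ?Q" by blast
    have "(p - (a + b * Var e)) + (p' - (c + d * Var e)) \<in> ?Q" using * by (intro Q.I_add)
    then have "(p + p') - ((a + c) + (b + d) * Var e) \<in> ?Q" by (simp add: algebra_simps)
    then show ?case using * polys_add by blast
  next
    case (mult p p')
    then obtain a b c d where *: "a \<in> polys S" "b \<in> polys S" "c \<in> polys S" "d \<in> polys S"
      "p - (a + b * Var e) \<in> ?Q" "p' - (c + d * Var e) \<in> ?Q" by blast
    have mem: "a \<in> polys ?T" "b \<in> polys ?T" "c \<in> polys ?T" "d \<in> polys ?T" "Var e \<in> polys ?T"
      using * sub by auto
    \<comment> \<open>Membership is not carried by the induction; it is recovered from the
      representation of \<open>p'\<close> modulo \<open>?Q\<close>.\<close>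
    have p': "p' \<in> polys ?T"
      using B.add[OF Q.I_sub[OF *(6)] B.add[OF mem(3) B.mult[OF mem(4,5)]]] by simp
    have "(p * p') - ((a * c + b * d * q) + (a * d + b * c) * Var e) =
        (p - (a + b * Var e)) * p' + (a + b * Var e) * (p' - (c + d * Var e)) + b * d * (Var e * Var e - q)"
      by (simp add: algebra_simps)
    also have "\<dots> \<in> ?Q"
    proof (intro Q.I_add)
      show "(p - (a + b * Var e)) * p' \<in> ?Q" using p' *(5) by (rule Q.I_mult')
      show "(a + b * Var e) * (p' - (c + d * Var e)) \<in> ?Q"
        using mem by (intro Q.I_mult[OF _ *(6)] B.add B.mult)
      show "b * d * (Var e * Var e - q) \<in> ?Q" using mem by (intro Q.I_mult[OF _ y2] B.mult)
    qed
    finally have "(p * p') - ((a * c + b * d * q) + (a * d + b * c) * Var e) \<in> ?Q" .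
    moreover have "a * c + b * d * q \<in> polys S" "a * d + b * c \<in> polys S"
      using * q by (auto intro: polys_add polys_mult)
    ultimately show ?case by blast
  qed
  then show ?thesis
    by unfold_locales (use subring_of_polys sub ideal_vanishing y2 q in \<open>auto intro: subring_of_polys\<close>)
qed

lemma zariski_dim_insert_square_root:
  assumes S: "finite S" and q: "q \<in> polys S"
    and sq: "\<And>W. W \<in> X \<Longrightarrow> (W $$ e)\<^sup>2 = poly_eval q (coord_proj S W)"
  shows "zariski_dim (insert e S) (coord_proj (insert e S) ` X) = zariski_dim S (coord_proj S ` X)"
proof -
  let ?T = "insert e S" let ?Q = "vanishing ?T (coord_proj ?T ` X)"
  interpret R: square_root_extension "polys S" "polys ?T" ?Q "Var e" q
    by (rule square_root_extension_polys[OF q sq])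
  have Q: "?Q \<inter> polys S = vanishing S (coord_proj S ` X)" by (rule vanishing_coord_proj) auto
  have two: "a \<in> P" if P: "prime_in (polys ?T) P" and a: "a + a \<in> P" for a P
  proof -
    have "Const (1/2) * (a + a) \<in> P"
      using P a polys_Const[of "1/2" ?T] unfolding prime_in_def ideal_in_def by blast
    moreover have "Const (1/2) * (a + a) = a"
    proof -
      have "Const (1/2) * (a + a) = (Const (1/2) + Const (1/2)) * a" by (simp only: distrib_left distrib_right)
      also have "Const (1/2) + Const (1/2) = 1" by (simp flip: Const.hom_add)
      finally show ?thesis by simp
    qed
    ultimately show ?thesis by (simp only:)
  qed
  have "(\<exists>P. prime_chain (polys ?T) ?Q k P) \<longleftrightarrow>
      (\<exists>P. prime_chain (polys S) (vanishing S (coord_proj S ` X)) k P)" for k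
    using R.prime_chain_contract[OF two] R.prime_chain_lift unfolding Q by blast
  then show ?thesis
    using S by (simp add: zariski_dim_prime_chain coord_proj_extensional)
qed

text \<open>All squares are polynomials over the original \<open>S\<close>, hence also over every
  intermediate set when \<open>L\<close> is added one element at a time.\<close>

lemma zariski_dim_union_square_roots:
  assumes L: "finite L" and S: "finite S"
    and sq: "\<And>e. e \<in> L \<Longrightarrow> \<exists>q\<in>polys S. \<forall>W\<in>X. (W $$ e)\<^sup>2 = poly_eval q (coord_proj S W)"
  shows "zariski_dim (S \<union> L) (coord_proj (S \<union> L) ` X) = zariski_dim S (coord_proj S ` X)"
  using L sq
proof (induction L rule: finite_induct)
  case (insert e L)
  obtain q where q: "q \<in> polys S" "\<And>W. W \<in> X \<Longrightarrow> (W $$ e)\<^sup>2 = poly_eval q (coord_proj S W)"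
    using insert.prems[of e] by auto
  have q': "q \<in> polys (S \<union> L)" using q(1) polys_mono[of S "S \<union> L"] by auto
  have "zariski_dim (insert e (S \<union> L)) (coord_proj (insert e (S \<union> L)) ` X) =
      zariski_dim (S \<union> L) (coord_proj (S \<union> L) ` X)"
    by (rule zariski_dim_insert_square_root[OF _ q'])
      (use S insert.hyps q poly_eval_coord_proj[OF q(1), of "S \<union> L"] in auto)
  then show ?case using insert by simp
qed simp

section \<open>Finite unit norm tight frames\<close>

lemma funtf_iff:
  "W \<in> funtf n r \<longleftrightarrow> W \<in> carrier_mat n r \<and>
    (\<forall>a<n. \<forall>b<n. (\<Sum>j<r. W $$ (a, j) * W $$ (b, j)) = (if a = b then of_nat r / of_nat n else 0)) \<and>
    (\<forall>j<r. (\<Sum>i<n. (W $$ (i, j))\<^sup>2) = 1)"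
proof (cases "W \<in> carrier_mat n r")
  case True
  then have d: "dim_row W = n" "dim_col W = r" by auto
  have "W * transpose_mat W = (of_nat r / of_nat n) \<cdot>\<^sub>m 1\<^sub>m n \<longleftrightarrow>
      (\<forall>a<n. \<forall>b<n. (\<Sum>j<r. W $$ (a, j) * W $$ (b, j)) = (if a = b then of_nat r / of_nat n else 0))"
    unfolding mat_eq_iff
    by (auto simp: d scalar_prod_def lessThan_atLeast0 Matrix.row_def Matrix.col_def)
  moreover have "diag_mat (transpose_mat W * W) = diag_mat (1\<^sub>m r) \<longleftrightarrow>
      (\<forall>j<r. (\<Sum>i<n. (W $$ (i, j))\<^sup>2) = 1)"
    unfolding diag_mat_def list_eq_iff_nth_eq
    by (auto simp: d scalar_prod_def lessThan_atLeast0 Matrix.row_def Matrix.col_def power2_eq_square)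
  ultimately show ?thesis using True by (simp add: funtf_def)
qed (simp add: funtf_def)

section \<open>A point of the frame variety\<close>

lemma sum_roots_of_unity:
  fixes m :: int
  assumes "r > 0" "\<bar>m\<bar> < int r"
  shows "(\<Sum>j<r. exp (2 * pi * \<i> * of_int m * of_nat j / of_nat r)) = (if m = 0 then of_nat r else 0)"
proof (cases "m = 0")
  case False
  define z where "z = exp (2 * pi * \<i> * of_int m / of_nat r)"
  have pow: "z ^ j = exp (2 * pi * \<i> * of_int m * of_nat j / of_nat r)" for j
    unfolding z_def by (simp add: exp_of_nat_mult[symmetric] mult_ac)
  have "z ^ r = exp (2 * of_int m * pi * \<i>)" unfolding pow using assms(1) by (simp add: mult_ac)
  also have "\<dots> = 1" by (subst exp_eq_1) (auto intro!: exI[of _ m])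
  finally have zr: "z ^ r = 1" .
  have "z \<noteq> 1"
  proof
    assume "z = 1"
    then obtain k :: int where "Im (2 * pi * \<i> * of_int m / of_nat r) = of_int (2 * k) * pi"
      unfolding z_def exp_eq_1 by blast
    then have "real_of_int m = real_of_int k * real r" using assms(1) by (simp add: field_simps)
    then have "m = k * int r" by (metis of_int_eq_iff of_int_mult of_int_of_nat_eq)
    then have "int r \<le> \<bar>m\<bar>" using False by (cases "k = 0") (auto simp: abs_mult)
    then show False using assms(2) by simp
  qed
  then have "(\<Sum>j<r. z ^ j) = 0" using zr by (simp add: geometric_sum)
  then show ?thesis using False by (simp add: pow)
qed simp

text \<open>The rows \<open>U\<^sub>i\<close> with half-integer frequencies symmetric about \<open>0\<close> satisfy
  \<open>U U\<^sup>T = r F\<close> for the flip matrix \<open>F\<close>, and \<open>(a (1 + \<i> F)) F (a (1 + \<i> F)) = 2 \<i> a\<^sup>2\<close>.\<close>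

lemma funtf_nonempty:
  assumes n: "0 < n" "n \<le> r"
  shows "funtf n r \<noteq> {}"
proof -
  define U where "U i j = exp (2 * pi * \<i> * of_real (real i - (real n - 1) / 2) * of_nat j / of_nat r)"
    for i j :: nat
  \<comment> \<open>Fixed by \<open>2 * \<i> * a * a = 1 / n\<close>, which turns the factor
    \<open>r\<close> into \<open>r / n\<close>.\<close>
  define a where "a = csqrt (1 / (2 * \<i> * of_nat n))"
  define W where "W = Matrix.mat n r (\<lambda>(i, j). a * (U i j + \<i> * U (n - 1 - i) j))"
  have a2: "a * a = 1 / (2 * \<i> * of_nat n)" unfolding a_def by (metis power2_csqrt power2_eq_square)
  have UU: "U i j * U l j = exp (2 * pi * \<i> * of_int (int i + int l - (int n - 1)) * of_nat j / of_nat r)" for i l j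
    unfolding U_def exp_add[symmetric] using n by (intro arg_cong[where f = exp]) (simp add: field_simps)
  have sumU: "(\<Sum>j<r. U i j * U l j) = (if l = n - 1 - i then of_nat r else 0)" if "i < n" "l < n" for i l
  proof -
    \<comment> \<open>By \<open>n \<le> r\<close> the sum of two frequencies is a multiple of
      \<open>r\<close> only when it is zero, that is, when the frequencies are opposite.\<close>
    have "\<bar>int i + int l - (int n - 1)\<bar> < int r" using that n by linarith
    then have "(\<Sum>j<r. U i j * U l j) = (if int i + int l - (int n - 1) = 0 then of_nat r else 0)"
      unfolding UU using n by (intro sum_roots_of_unity) auto
    also have "int i + int l - (int n - 1) = 0 \<longleftrightarrow> l = n - 1 - i" using that by linarith
    finally show ?thesis .
  qed
  have flip: "U i j * U (n - 1 - i) j = 1" if "i < n" for i j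
    unfolding UU using that by (simp add: of_nat_diff)
  have rows: "(\<Sum>j<r. W $$ (i, j) * W $$ (l, j)) = (if i = l then of_nat r / of_nat n else 0)"
    if il: "i < n" "l < n" for i l
  proof -
    let ?i = "n - 1 - i" and ?l = "n - 1 - l"
    have "(\<Sum>j<r. W $$ (i, j) * W $$ (l, j)) =
        (\<Sum>j<r. a * a * (U i j * U l j + \<i> * (U i j * U ?l j) + \<i> * (U ?i j * U l j) - U ?i j * U ?l j))"
      using il by (intro sum.cong) (auto simp: W_def algebra_simps)
    also have "\<dots> = a * a * ((\<Sum>j<r. U i j * U l j) + \<i> * (\<Sum>j<r. U i j * U ?l j) +
        \<i> * (\<Sum>j<r. U ?i j * U l j) - (\<Sum>j<r. U ?i j * U ?l j))"
      by (simp only: sum.distrib sum_subtractf flip: sum_distrib_left)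
    also have "\<dots> = (if i = l then of_nat r / of_nat n else 0)"
      using il n by (auto simp: sumU a2)
    finally show ?thesis .
  qed
  have cols: "(\<Sum>i<n. (W $$ (i, j))\<^sup>2) = 1" if j: "j < r" for j
  proof -
    \<comment> \<open>By \<open>flip\<close> the cross terms add up to \<open>2 * \<i> * n\<close>,
      and the squares cancel after reversing the order of the rows; the choice of \<open>a\<close>
      normalizes the rest to 1.\<close>
    have "(\<Sum>i<n. (W $$ (i, j))\<^sup>2) = (\<Sum>i<n. a * a * ((U i j)\<^sup>2 + 2 * \<i> - (U (n - 1 - i) j)\<^sup>2))"
    proof (intro sum.cong refl)
      fix i assume "i \<in> {..<n}"
      then have i: "i < n" by simp
      have "(W $$ (i, j))\<^sup>2 = a * a * ((U i j)\<^sup>2 + 2 * \<i> * (U i j * U (n - 1 - i) j) - (U (n - 1 - i) j)\<^sup>2)"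
        using i j by (simp add: W_def power2_eq_square algebra_simps)
      then show "(W $$ (i, j))\<^sup>2 = a * a * ((U i j)\<^sup>2 + 2 * \<i> - (U (n - 1 - i) j)\<^sup>2)"
        by (simp only: flip[OF i] mult_1_right)
    qed
    also have "\<dots> = a * a * ((\<Sum>i<n. (U i j)\<^sup>2) + of_nat n * (2 * \<i>) - (\<Sum>i<n. (U (n - 1 - i) j)\<^sup>2))"
      by (simp add: sum.distrib sum_subtractf flip: sum_distrib_left)
    also have "(\<Sum>i<n. (U (n - 1 - i) j)\<^sup>2) = (\<Sum>i<n. (U i j)\<^sup>2)"
      using sum.nat_diff_reindex[of "\<lambda>i. (U i j)\<^sup>2" n] by simp
    finally show ?thesis using n by (simp add: a2)
  qed
  have "W \<in> funtf n r" unfolding funtf_iff using rows cols by (simp add: W_def)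
  then show ?thesis by blast
qed

section \<open>Equations and dimension of the frame variety\<close>

definition funtf_row_eq :: "nat \<Rightarrow> nat \<Rightarrow> nat \<Rightarrow> nat \<Rightarrow> (nat \<times> nat) cpoly" where
  "funtf_row_eq n r a b = (\<Sum>j<r. Var (a, j) * Var (b, j)) - Const (if a = b then of_nat r / of_nat n else 0)"

definition funtf_col_eq :: "nat \<Rightarrow> nat \<Rightarrow> (nat \<times> nat) cpoly" where
  "funtf_col_eq n j = (\<Sum>i<n. (Var (i, j))\<^sup>2) - Const 1"

text \<open>The last column equation is omitted, as the traces of \<open>W W\<^sup>T\<close> and \<open>W\<^sup>T W\<close> agree.\<close>

definition funtf_eqs :: "nat \<Rightarrow> nat \<Rightarrow> (nat \<times> nat) cpoly set" where
  "funtf_eqs n r = (\<lambda>(b, a). funtf_row_eq n r a b) ` (SIGMA b:{..<n}. {..b}) \<union> funtf_col_eq n ` {..<r - 1}"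

lemma poly_eval_row_eq: "poly_eval (funtf_row_eq n r a b) x =
    (\<Sum>j<r. x (a, j) * x (b, j)) - (if a = b then of_nat r / of_nat n else 0)"
  by (simp add: funtf_row_eq_def poly_eval.hom_minus poly_eval.hom_sum poly_eval.hom_mult)

lemma poly_eval_col_eq: "poly_eval (funtf_col_eq n j) x = (\<Sum>i<n. (x (i, j))\<^sup>2) - 1"
  by (simp add: funtf_col_eq_def poly_eval.hom_minus poly_eval.hom_sum poly_eval.hom_power)

lemma funtf_eqs_polys: "funtf_eqs n r \<subseteq> polys (grid n r)"
  unfolding funtf_eqs_def funtf_row_eq_def funtf_col_eq_def
  by (auto intro!: polys_diff polys_sum polys_mult polys_power)

lemma finite_funtf_eqs: "finite (funtf_eqs n r)"
  by (simp add: funtf_eqs_def)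

lemma card_funtf_eqs: "card (funtf_eqs n r) \<le> ((n + 1) choose 2) + (r - 1)"
proof -
  have "(\<Sum>b<n. Suc b) = (n + 1) choose 2"
    by (induction n) (auto simp: numeral_2_eq_2)
  then have "card (SIGMA b:{..<n}. {..b}) = (n + 1) choose 2" by simp
  then have "card ((\<lambda>(b, a). funtf_row_eq n r a b) ` (SIGMA b:{..<n}. {..b})) \<le> (n + 1) choose 2"
    by (metis card_image_le finite_SigmaI finite_lessThan finite_atMost)
  moreover have "card (funtf_col_eq n ` {..<r - 1}) \<le> r - 1"
    using card_image_le[of "{..<r - 1}" "funtf_col_eq n"] by simp
  ultimately show ?thesis
    unfolding funtf_eqs_def by (meson add_mono card_Un_le order_trans)
qed

lemma zero_set_funtf_eqs:
  assumes n: "0 < n"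
  shows "zero_set (grid n r) (funtf_eqs n r) = coord_proj (grid n r) ` funtf n r"
proof (intro equalityI subsetI)
  fix x assume "x \<in> zero_set (grid n r) (funtf_eqs n r)"
  then have x: "x \<in> grid n r \<rightarrow>\<^sub>E UNIV" "\<And>p. p \<in> funtf_eqs n r \<Longrightarrow> poly_eval p x = 0"
    by (auto simp: zero_set_def)
  have row: "(\<Sum>j<r. x (a, j) * x (b, j)) = (if a = b then of_nat r / of_nat n else 0)" if "a < n" "b < n" for a b
  proof -
    have *: "(\<Sum>j<r. x (a, j) * x (b, j)) = (if a = b then of_nat r / of_nat n else 0)" if "a \<le> b" "b < n" for a b
    proof -
      have "funtf_row_eq n r a b \<in> funtf_eqs n r" using that by (force simp: funtf_eqs_def)
      then show ?thesis using x(2) by (fastforce simp: poly_eval_row_eq)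
    qed
    show ?thesis using *[of a b] *[of b a] that by (cases "a \<le> b") (auto simp: mult.commute)
  qed
  have col': "(\<Sum>i<n. (x (i, j))\<^sup>2) = 1" if "j < r - 1" for j
    using x(2)[of "funtf_col_eq n j"] that by (auto simp: funtf_eqs_def poly_eval_col_eq)
  have col: "(\<Sum>i<n. (x (i, j))\<^sup>2) = 1" if "j < r" for j
  proof (cases "j < r - 1")
    case False
    then have j: "r = Suc j" using that by simp
    have "(\<Sum>k<r. \<Sum>i<n. (x (i, k))\<^sup>2) = (\<Sum>i<n. \<Sum>k<r. x (i, k) * x (i, k))"
      unfolding power2_eq_square by (rule sum.swap)
    also have "\<dots> = of_nat r" using n by (simp add: row)
    finally have "(\<Sum>k<j. \<Sum>i<n. (x (i, k))\<^sup>2) + (\<Sum>i<n. (x (i, j))\<^sup>2) = of_nat j + 1" by (simp add: j)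
    moreover have "(\<Sum>k<j. \<Sum>i<n. (x (i, k))\<^sup>2) = of_nat j" using col' by (simp add: j)
    ultimately show ?thesis by simp
  qed (rule col')
  let ?W = "Matrix.mat n r x"
  have "?W \<in> funtf n r" unfolding funtf_iff using row col by simp
  moreover have "x = coord_proj (grid n r) ?W"
    using x(1) by (auto simp: coord_proj_def restrict_def PiE_def extensional_def fun_eq_iff)
  ultimately show "x \<in> coord_proj (grid n r) ` funtf n r" by blast
next
  fix x assume "x \<in> coord_proj (grid n r) ` funtf n r"
  then obtain W where W: "W \<in> funtf n r" "x = coord_proj (grid n r) W" by blast
  have "poly_eval p x = 0" if "p \<in> funtf_eqs n r" for p
    using that W unfolding funtf_eqs_def funtf_iff
    by (auto simp: poly_eval_row_eq poly_eval_col_eq coord_proj_def less_diff_conv)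
  then show "x \<in> zero_set (grid n r) (funtf_eqs n r)"
    using W(2) coord_proj_extensional by (auto simp: zero_set_def coord_proj_def)
qed

text \<open>The vanishing ideal may be larger than the ideal of the equations, but by the
  Nullstellensatz every prime above the equations contains it; so the chain found over the equations
  is one over the vanishing ideal.\<close>

theorem funtf_dim_ge:
  assumes n: "0 < n" "n \<le> r" and d: "d + ((n + 1) choose 2) + (r - 1) \<le> n * r"
  shows "enat d \<le> mat_dim n r (funtf n r)"
proof -
  let ?S = "grid n r" and ?F = "funtf_eqs n r"
  have card: "card ?F \<le> card ?S" "d \<le> card ?S - card ?F" using card_funtf_eqs[of n r] d by auto
  obtain W where W: "W \<in> funtf n r" using funtf_nonempty[OF n] by blast
  then have "coord_proj ?S W \<in> zero_set ?S ?F" unfolding zero_set_funtf_eqs[OF n(1)] by blast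
  then have "poly_eval f (coord_proj ?S W) = 0" if "f \<in> ?F" for f using that by (auto simp: zero_set_def)
  then obtain P where P: "prime_chain (polys ?S) ?F (card ?S - card ?F) P"
    using prime_chain_at_zero[of ?S ?F, OF _ finite_funtf_eqs funtf_eqs_polys card(1)] by blast
  have "vanishing ?S (zero_set ?S ?F) \<subseteq> P i" if "i \<le> card ?S - card ?F" for i
  proof -
    have Pi: "prime_in (polys ?S) (P i)" "?F \<subseteq> P i" using P that by (auto simp: prime_chain_def)
    have "zero_set ?S (P i) \<subseteq> zero_set ?S ?F" using Pi(2) by (auto simp: zero_set_def)
    then have "vanishing ?S (zero_set ?S ?F) \<subseteq> vanishing ?S (zero_set ?S (P i))" by (auto simp: vanishing_def)
    then show ?thesis using vanishing_zero_set_prime[OF _ Pi(1)] by simp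
  qed
  then have "prime_chain (polys ?S) (vanishing ?S (coord_proj ?S ` funtf n r)) (card ?S - card ?F) P"
    using P unfolding prime_chain_def zero_set_funtf_eqs[OF n(1)] by blast
  then have "enat (card ?S - card ?F) \<le> mat_dim n r (funtf n r)"
    unfolding mat_dim_def by (rule zariski_dim_ge[rotated 2]) (simp_all add: coord_proj_extensional)
  then show ?thesis using card(2) by (meson enat_ord_simps(1) order_trans)
qed

section \<open>Pruning leaves\<close>

lemma funtf_row_square:
  assumes "W \<in> funtf n r" "i < n" "j < r"
  shows "(W $$ (i, j))\<^sup>2 = of_nat r / of_nat n - (\<Sum>k\<in>{..<r} - {j}. (W $$ (i, k))\<^sup>2)"
proof -
  have "(\<Sum>k<r. (W $$ (i, k))\<^sup>2) = of_nat r / of_nat n"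
    using assms by (simp add: funtf_iff power2_eq_square)
  moreover have "(\<Sum>k<r. (W $$ (i, k))\<^sup>2) = (W $$ (i, j))\<^sup>2 + (\<Sum>k\<in>{..<r} - {j}. (W $$ (i, k))\<^sup>2)"
    using assms by (intro sum.remove) auto
  ultimately show ?thesis by (simp add: eq_diff_eq)
qed

lemma funtf_col_square:
  assumes "W \<in> funtf n r" "i < n" "j < r"
  shows "(W $$ (i, j))\<^sup>2 = 1 - (\<Sum>k\<in>{..<n} - {i}. (W $$ (k, j))\<^sup>2)"
proof -
  have "(\<Sum>k<n. (W $$ (k, j))\<^sup>2) = 1" using assms by (simp add: funtf_iff)
  moreover have "(\<Sum>k<n. (W $$ (k, j))\<^sup>2) = (W $$ (i, j))\<^sup>2 + (\<Sum>k\<in>{..<n} - {i}. (W $$ (k, j))\<^sup>2)"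
    using assms by (intro sum.remove) auto
  ultimately show ?thesis by (simp add: eq_diff_eq)
qed

lemma prune_edges: "edges (prune G) \<subseteq> edges G"
  by (auto simp: prune_def)

lemma prune_edges_less:
  assumes "has_leaf G" shows "edges (prune G) \<subset> edges G"
proof -
  have "\<exists>e. e \<in> edges G \<and> e \<notin> edges (prune G)"
    using assms unfolding has_leaf_def
  proof
    assume "\<exists>i\<in>row_verts G. row_deg G i = 1"
    then obtain i j where i: "row_deg G i = 1" "{j. (i, j) \<in> edges G} = {j}"
      unfolding row_deg_def by (auto simp: card_1_singleton_iff)
    then have "(i, j) \<in> edges G" "(i, j) \<notin> edges (prune G)" by (auto simp: prune_def)
    then show ?thesis by blast
  next
    assume "\<exists>j\<in>col_verts G. col_deg G j = 1"
    then obtain i j where j: "col_deg G j = 1" "{i. (i, j) \<in> edges G} = {i}"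
      unfolding col_deg_def by (auto simp: card_1_singleton_iff)
    then have "(i, j) \<in> edges G" "(i, j) \<notin> edges (prune G)" by (auto simp: prune_def)
    then show ?thesis by blast
  qed
  then show ?thesis using prune_edges[of G] by blast
qed

text \<open>A removed edge is the only edge of its row or column, so all other entries of that line
  lie in \<open>S\<close> and its norm equation gives the square of the removed entry. Edges removed
  in the same round do not interfere, as each square uses entries of \<open>S\<close> only.\<close>

lemma zariski_dim_prune:
  assumes G: "edges G \<subseteq> grid n r"
  defines "S \<equiv> grid n r - edges G" and "T \<equiv> grid n r - edges (prune G)"
  shows "zariski_dim T (coord_proj T ` funtf n r) = zariski_dim S (coord_proj S ` funtf n r)"
proof -
  have fin: "finite (grid n r)" by simp
  have "T = S \<union> (edges G - edges (prune G))" using G prune_edges[of G] by (auto simp: S_def T_def)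
  moreover have "zariski_dim (S \<union> (edges G - edges (prune G))) (coord_proj (S \<union> (edges G - edges (prune G))) ` funtf n r) =
      zariski_dim S (coord_proj S ` funtf n r)"
  proof (rule zariski_dim_union_square_roots)
    show "finite (edges G - edges (prune G))" using G fin finite_subset by blast
    show "finite S" by (simp add: S_def)
    fix e assume e: "e \<in> edges G - edges (prune G)"
    obtain i j where ij: "e = (i, j)" by force
    have ijn: "i < n" "j < r" "(i, j) \<in> edges G" using e G by (auto simp: ij)
    have "row_deg G i = 1 \<or> col_deg G j = 1" using e by (auto simp: ij prune_def)
    then show "\<exists>q\<in>polys S. \<forall>W\<in>funtf n r. (W $$ e)\<^sup>2 = poly_eval q (coord_proj S W)"
    proof
      assume "row_deg G i = 1"
      then obtain k where "{k. (i, k) \<in> edges G} = {k}"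
        unfolding row_deg_def by (rule card_1_singletonE)
      then have "{k. (i, k) \<in> edges G} = {j}" using ijn(3) by (metis mem_Collect_eq singletonD)
      then have mem: "(i, k) \<in> S" if "k \<in> {..<r} - {j}" for k using that ijn(1) by (auto simp: S_def)
      let ?q = "Const (of_nat r / of_nat n) - (\<Sum>k\<in>{..<r} - {j}. (Var (i, k))\<^sup>2)"
      have "?q \<in> polys S" using mem by (intro polys_diff polys_sum polys_power) auto
      moreover have "poly_eval ?q (coord_proj S W) = (W $$ e)\<^sup>2" if "W \<in> funtf n r" for W
        using mem by (simp add: ij funtf_row_square[OF that ijn(1,2)] poly_eval.hom_minus
            poly_eval.hom_sum poly_eval.hom_power coord_proj_def)
      ultimately show ?thesis by metis
    next
      assume "col_deg G j = 1"
      then obtain k where "{k. (k, j) \<in> edges G} = {k}"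
        unfolding col_deg_def by (rule card_1_singletonE)
      then have "{k. (k, j) \<in> edges G} = {i}" using ijn(3) by (metis mem_Collect_eq singletonD)
      then have mem: "(k, j) \<in> S" if "k \<in> {..<n} - {i}" for k using that ijn(2) by (auto simp: S_def)
      let ?q = "Const 1 - (\<Sum>k\<in>{..<n} - {i}. (Var (k, j))\<^sup>2)"
      have "?q \<in> polys S" using mem by (intro polys_diff polys_sum polys_power) auto
      moreover have "poly_eval ?q (coord_proj S W) = (W $$ e)\<^sup>2" if "W \<in> funtf n r" for W
        using mem by (simp add: ij funtf_col_square[OF that ijn(1,2)] poly_eval.hom_minus
            poly_eval.hom_sum poly_eval.hom_power coord_proj_def)
      ultimately show ?thesis by metis
    qed
  qed
  ultimately show ?thesis by simp
qed

lemma zariski_dim_greater_core2: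
  assumes "E \<subseteq> grid n r"
  defines "T \<equiv> grid n r - edges (greater_core2 (compl_graph n r E))"
  shows "zariski_dim T (coord_proj T ` funtf n r) = zariski_dim E (coord_proj E ` funtf n r)"
proof -
  define dim where "dim S = zariski_dim S (coord_proj S ` funtf n r)" for S
  define I where "I G \<longleftrightarrow> edges G \<subseteq> grid n r \<and> dim (grid n r - edges G) = dim E"
    for G :: "(nat, nat) bigraph"
  have "I (greater_core2 (compl_graph n r E))"
    unfolding greater_core2_def
  proof (rule while_rule[where P = I and r = "measure (\<lambda>G. card (edges G))"])
    have "grid n r - (grid n r - E) = E" using assms(1) by blast
    then show "I (compl_graph n r E)" by (auto simp: I_def compl_graph_def)
    show "I (prune G)" if "I G" "has_leaf G" for G
      using that zariski_dim_prune[of G n r] prune_edges[of G] by (auto simp: I_def dim_def)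
    show "(prune G, G) \<in> measure (\<lambda>G. card (edges G))" if "I G" "has_leaf G" for G
    proof -
      have "finite (edges G)" using that(1) finite_subset[of "edges G" "grid n r"] by (auto simp: I_def)
      then show ?thesis using psubset_card_mono[OF _ prune_edges_less[OF that(2)]] by simp
    qed
  qed auto
  then show ?thesis by (simp add: I_def dim_def T_def)
qed

section \<open>Bases\<close>

lemma independent_in_iff: "independent_in X S \<longleftrightarrow> vanishing S (coord_proj S ` X) \<subseteq> {0}"
  by (auto simp: independent_in_def vanishing_def polys_def)

text \<open>\<open>d\<close> is the expected dimension, written additively to avoid truncated
  subtraction. Its positivity makes a set of that size nonempty, as \<open>zariski_dim_full\<close>
  requires.\<close>

lemma funtf_dim_arith:
  fixes n r :: nat
  assumes "n + 2 \<le> r" "3 \<le> n"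
  obtains d where "d > 0" "d + ((n + 1) choose 2) + (r - 1) = n * r"
proof -
  define c where "c = (n + 1) choose 2"
  have t: "2 * c = n * n + n" using choose_two[of "n + 1"] by (simp add: c_def algebra_simps)
  have "(n - 1) * (n + 2) \<le> (n - 1) * r" using assms by (intro mult_left_mono) auto
  moreover have "n * r = (n - 1) * r + r" "(n - 1) * (n + 2) + 2 = n * n + n"
    using assms by (cases n; simp add: algebra_simps)+
  moreover have "3 * n \<le> n * n" using assms by simp
  ultimately have "c + (r - 1) < n * r" using t assms by linarith
  then show thesis using that[of "n * r - (c + (r - 1))"] unfolding c_def by linarith
qed

lemma funtf_basis_iff_spanning:
  assumes nr: "n + 2 \<le> r" "3 \<le> n" and E: "E \<subseteq> grid n r"
    and card: "int (card E) = int n * int r - int ((n + 1) choose 2) - int r + 1"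
  shows "basis_of n r (funtf n r) E \<longleftrightarrow> spanning_in n r (funtf n r) E"
proof
  assume span: "spanning_in n r (funtf n r) E"
  obtain d where d: "d > 0" "d + ((n + 1) choose 2) + (r - 1) = n * r" using funtf_dim_arith[OF nr] .
  have "int (n * r) = int (d + ((n + 1) choose 2) + (r - 1))" using d(2) by simp
  then have cd: "card E = d" using card nr by (simp add: of_nat_diff)
  have "enat d \<le> mat_dim n r (funtf n r)" using nr d by (intro funtf_dim_ge) auto
  then have "enat (card E) \<le> zariski_dim E (coord_proj E ` funtf n r)"
    using span cd by (simp add: spanning_in_def)
  moreover have "finite E" "E \<noteq> {}" using E d(1) cd finite_subset[of E "grid n r"] by auto
  ultimately have "vanishing E (coord_proj E ` funtf n r) = {0}"
    by (intro zariski_dim_full coord_proj_extensional)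
  then show "basis_of n r (funtf n r) E" using span by (simp add: basis_of_def independent_in_iff)
qed (simp add: basis_of_def)

lemma basis_iff_greater_core_spanning:
  assumes nr: "n + 2 \<le> r" "3 \<le> n" and E: "E \<subseteq> grid n r"
    and card: "int (card E) = int n * int r - int ((n + 1) choose 2) - int r + 1"
    and E': "E' \<subseteq> grid n r" "compl_graph n r E' = greater_core2 (compl_graph n r E)"
  shows "basis_of n r (funtf n r) E \<longleftrightarrow> spanning_in n r (funtf n r) E'"
proof -
  have "edges (greater_core2 (compl_graph n r E)) = grid n r - E'"
    using arg_cong[OF E'(2), of edges] by (simp add: compl_graph_def)
  then have "E' = grid n r - edges (greater_core2 (compl_graph n r E))" using E'(1) by blast
  then have "spanning_in n r (funtf n r) E' \<longleftrightarrow> spanning_in n r (funtf n r) E"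
    using zariski_dim_greater_core2[OF E] by (simp add: spanning_in_def)
  then show ?thesis using funtf_basis_iff_spanning[OF nr E card] by simp
qed

text \<open>The projection to \<open>E\<close> has dimension at most \<open>card E\<close> and,
  since \<open>E\<close> is spanning, at least the expected one. This caps the size of the
  complement of \<open>E\<close>.\<close>

lemma basis_card_ge:
  assumes nr: "n + 2 \<le> r" "3 \<le> n" and E: "E \<subseteq> grid n r" and B: "basis_of n r (funtf n r) E"
  shows "n * r \<le> card E + ((n + 1) choose 2) + (r - 1)"
proof -
  obtain d where d: "d > 0" "d + ((n + 1) choose 2) + (r - 1) = n * r" using funtf_dim_arith[OF nr] .
  have "enat d \<le> mat_dim n r (funtf n r)" using nr d by (intro funtf_dim_ge) auto
  also have "\<dots> = zariski_dim E (coord_proj E ` funtf n r)"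
    using B by (simp add: basis_of_def spanning_in_def)
  also have "\<dots> \<le> enat (card E)"
    using E finite_subset[of E "grid n r"] by (intro zariski_dim_le_card coord_proj_extensional) auto
  finally show ?thesis using d(2) by simp
qed

text \<open>The norm equation of a column contained in \<open>E\<close> would be a relation on
  \<open>E\<close>, nonzero because its value at the origin is -1.\<close>

lemma independent_column_edge:
  assumes "independent_in (funtf n r) E" "j < r"
  shows "\<exists>i<n. (i, j) \<notin> E"
proof (rule ccontr)
  assume "\<not> ?thesis"
  then have E: "(i, j) \<in> E" if "i < n" for i using that by blast
  have "funtf_col_eq n j \<in> polys E"
    unfolding funtf_col_eq_def using E by (intro polys_diff polys_sum polys_power) auto
  moreover have "poly_eval (funtf_col_eq n j) (coord_proj E W) = 0" if "W \<in> funtf n r" for W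
    using that assms(2) E by (simp add: poly_eval_col_eq coord_proj_def funtf_iff)
  ultimately have "funtf_col_eq n j = 0"
    using assms(1) unfolding independent_in_iff by (auto simp: vanishing_def)
  then have "poly_eval (funtf_col_eq n j) (\<lambda>_. 0) = 0" by simp
  then show False by (simp add: poly_eval_col_eq)
qed

section \<open>Finiteness of cores\<close>

lemma sum_col_deg:
  assumes "finite C" "finite D" "edges G \<subseteq> D \<times> C"
  shows "card (edges G) = (\<Sum>j\<in>C. col_deg G j)"
proof -
  have "edges G = (\<lambda>(j, i). (i, j)) ` (SIGMA j:C. {i. (i, j) \<in> edges G})" using assms(3) by force
  then have "card (edges G) = card (SIGMA j:C. {i. (i, j) \<in> edges G})"
    by (metis card_image swap_inj_on)
  also have "\<dots> = (\<Sum>j\<in>C. col_deg G j)"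
    unfolding col_deg_def using assms
    by (intro card_SigmaI) (auto intro: finite_subset[of _ D])
  finally show ?thesis .
qed

lemma card_core_columns:
  assumes nr: "n + 2 \<le> r" "3 \<le> n" and E: "E \<subseteq> grid n r" and B: "basis_of n r (funtf n r) E"
  defines "H \<equiv> greater_core2 (compl_graph n r E)"
  shows "card {j\<in>{..<r}. col_deg H j \<noteq> 0} \<le> (n + 1) choose 2"
proof -
  let ?C = "{j\<in>{..<r}. col_deg H j \<noteq> 0}"
  have H: "col_verts H = {..<r}" "edges H \<subseteq> grid n r - E" "\<not> has_leaf H"
    using greater_core2_compl_graph[of n r E] by (auto simp: H_def)
  have fin: "finite {i. (i, j) \<in> edges H}" for j
    by (rule finite_subset[of _ "{..<n}"]) (use H(2) in auto)
  have "col_deg H j \<noteq> 0" if "(i, j) \<in> edges H" for i j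
    using that fin[of j] by (auto simp: col_deg_def card_eq_0_iff)
  then have HC: "edges H \<subseteq> {..<n} \<times> ?C" using H(2) by blast
  have "2 * card ?C = (\<Sum>j\<in>?C. 2)" by simp
  also have "\<dots> \<le> (\<Sum>j\<in>?C. col_deg H j)"
  proof (rule sum_mono)
    fix j assume "j \<in> ?C"
    then have "col_deg H j \<noteq> 0" "col_deg H j \<noteq> 1" using H(1,3) by (auto simp: has_leaf_def)
    then show "2 \<le> col_deg H j" by simp
  qed
  also have "\<dots> = card (edges H)" by (rule sum_col_deg[symmetric, OF _ _ HC]) auto
  finally have two: "2 * card ?C \<le> card (edges H)" .
  have "independent_in (funtf n r) E" using B by (simp add: basis_of_def)
  then have "\<forall>j<r. \<exists>i<n. (i, j) \<notin> E" using independent_column_edge by blast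
  then obtain s where s: "\<And>j. j < r \<Longrightarrow> s j < n \<and> (s j, j) \<notin> E" by metis
  \<comment> \<open>One missing entry for each column outside the core, disjoint from the core
    edges, which all lie over \<open>?C\<close>. So each core column takes one entry beyond the
    average of one per column.\<close>
  let ?L = "(\<lambda>j. (s j, j)) ` ({..<r} - ?C)"
  have "card ?L = card ({..<r} - ?C)" by (intro card_image) (auto simp: inj_on_def)
  also have "\<dots> = r - card ?C" by (subst card_Diff_subset) auto
  finally have L: "card ?L = r - card ?C" .
  have "card (edges H) + card ?L = card (edges H \<union> ?L)"
    using HC by (intro card_Un_disjoint[symmetric]) (auto intro: finite_subset[OF HC])
  also have "\<dots> \<le> card (grid n r - E)"
    using H(2) s by (intro card_mono) auto
  also have "\<dots> = n * r - card E" using E by (subst card_Diff_subset) (auto intro: finite_subset)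
  also have "\<dots> \<le> ((n + 1) choose 2) + (r - 1)" using basis_card_ge[OF nr E B] by simp
  finally have "2 * card ?C + (r - card ?C) \<le> ((n + 1) choose 2) + (r - 1)" using two L by simp
  moreover have "card ?C \<le> r" using card_mono[of "{..<r}" ?C] by auto
  ultimately show ?thesis by linarith
qed

text \<open>Representatives on initial segments. Pairs of \<open>D\<close> outside the two parts are
  harmless, since \<open>bipartite_iso\<close> compares edges between vertices only.\<close>

definition small_graphs :: "nat \<Rightarrow> nat \<Rightarrow> (nat, nat) bigraph set" where
  "small_graphs n k = (\<lambda>(a, b, D). \<lparr>row_verts = {..<a}, col_verts = {..<b}, edges = D\<rparr>) `
     ({..n} \<times> {..k} \<times> Pow ({..<n} \<times> {..<k}))"

lemma finite_small_graphs: "finite (small_graphs n k)"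
  unfolding small_graphs_def by (intro finite_imageI finite_cartesian_product) auto

lemma ex_bipartite_iso_small_graph:
  assumes "finite (row_verts G)" "finite (col_verts G)" "card (row_verts G) \<le> n" "card (col_verts G) \<le> k"
  shows "\<exists>H\<in>small_graphs n k. bipartite_iso G H"
proof -
  let ?a = "card (row_verts G)" and ?b = "card (col_verts G)"
  obtain f where f: "bij_betw f (row_verts G) {..<?a}"
    using ex_bij_betw_finite_nat[OF assms(1)] by (auto simp: lessThan_atLeast0)
  obtain g where g: "bij_betw g (col_verts G) {..<?b}"
    using ex_bij_betw_finite_nat[OF assms(2)] by (auto simp: lessThan_atLeast0)
  define D where "D = {(f i, g j) | i j. i \<in> row_verts G \<and> j \<in> col_verts G \<and> (i, j) \<in> edges G}"
  let ?H = "\<lparr>row_verts = {..<?a}, col_verts = {..<?b}, edges = D\<rparr>"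
  have "D \<subseteq> {..<?a} \<times> {..<?b}" using f g by (auto simp: D_def bij_betw_def)
  also have "\<dots> \<subseteq> {..<n} \<times> {..<k}" using assms(3,4) by auto
  finally have "?H \<in> small_graphs n k"
    unfolding small_graphs_def using assms(3,4) by (intro image_eqI[of _ _ "(?a, ?b, D)"]) auto
  moreover have "(i, j) \<in> edges G \<longleftrightarrow> (f i, g j) \<in> D" if "i \<in> row_verts G" "j \<in> col_verts G" for i j
    using that f g by (auto simp: D_def bij_betw_def dest: inj_onD)
  then have "bipartite_iso G ?H"
    unfolding bipartite_iso_def using f g by (intro exI[of _ f] exI[of _ g]) auto
  ultimately show ?thesis by blast
qed

theorem theorem4p5:
  shows "(\<forall>(n::nat) (r::nat) (E::(nat \<times> nat) set) (E'::(nat \<times> nat) set).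
            r \<ge> n + 2 \<and> n + 2 > 4 \<and> E \<subseteq> grid n r \<and>
            int (card E) = int n * int r - int ((n + 1) choose 2) - int r + 1 \<and>
            E \<subseteq> E' \<and> E' \<subseteq> grid n r \<and> compl_graph n r E' = greater_core2 (compl_graph n r E)
            \<longrightarrow> (basis_of n r (funtf n r) E \<longleftrightarrow> spanning_in n r (funtf n r) E'))
       \<and> (\<forall>(n::nat) \<ge> 3. \<exists>\<G>::(nat, nat) bigraph set. finite \<G> \<and>
            (\<forall>(r::nat) E. r \<ge> n + 2 \<and> E \<subseteq> grid n r \<and> basis_of n r (funtf n r) E
               \<longrightarrow> (\<exists>H\<in>\<G>. bipartite_iso (core2 (compl_graph n r E)) H)))"
proof (rule conjI)
  show "\<forall>(n::nat) (r::nat) (E::(nat \<times> nat) set) (E'::(nat \<times> nat) set).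
            r \<ge> n + 2 \<and> n + 2 > 4 \<and> E \<subseteq> grid n r \<and>
            int (card E) = int n * int r - int ((n + 1) choose 2) - int r + 1 \<and>
            E \<subseteq> E' \<and> E' \<subseteq> grid n r \<and> compl_graph n r E' = greater_core2 (compl_graph n r E)
            \<longrightarrow> (basis_of n r (funtf n r) E \<longleftrightarrow> spanning_in n r (funtf n r) E')"
    by (intro allI impI basis_iff_greater_core_spanning) auto
next
  \<comment> \<open>The family of representatives depends on \<open>n\<close> alone, because the
    bound on the number of core columns is uniform in \<open>r\<close>.\<close>
  have core: "\<exists>H\<in>small_graphs n ((n + 1) choose 2). bipartite_iso (core2 (compl_graph n r E)) H"
    if "3 \<le> n" "r \<ge> n + 2" "E \<subseteq> grid n r" "basis_of n r (funtf n r) E" for n r E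
  proof (rule ex_bipartite_iso_small_graph)
    let ?H = "greater_core2 (compl_graph n r E)"
    have rows: "row_verts (core2 (compl_graph n r E)) = {i\<in>{..<n}. row_deg ?H i \<noteq> 0}"
      and cols: "col_verts (core2 (compl_graph n r E)) = {j\<in>{..<r}. col_deg ?H j \<noteq> 0}"
      using greater_core2_compl_graph[of n r E] by (auto simp: core2_def delete_isolated_def)
    show "finite (row_verts (core2 (compl_graph n r E)))"
      "finite (col_verts (core2 (compl_graph n r E)))" by (simp_all add: rows cols)
    show "card (row_verts (core2 (compl_graph n r E))) \<le> n"
      using card_mono[of "{..<n}" "{i\<in>{..<n}. row_deg ?H i \<noteq> 0}"] by (auto simp: rows)
    show "card (col_verts (core2 (compl_graph n r E))) \<le> (n + 1) choose 2"
      unfolding cols by (rule card_core_columns[OF that(2,1,3,4)])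
  qed
  show "\<forall>(n::nat) \<ge> 3. \<exists>\<G>::(nat, nat) bigraph set. finite \<G> \<and>
            (\<forall>(r::nat) E. r \<ge> n + 2 \<and> E \<subseteq> grid n r \<and> basis_of n r (funtf n r) E
               \<longrightarrow> (\<exists>H\<in>\<G>. bipartite_iso (core2 (compl_graph n r E)) H))"
  proof (intro allI impI)
    fix n :: nat assume "3 \<le> n"
    then show "\<exists>\<G>::(nat, nat) bigraph set. finite \<G> \<and>
        (\<forall>(r::nat) E. r \<ge> n + 2 \<and> E \<subseteq> grid n r \<and> basis_of n r (funtf n r) E
           \<longrightarrow> (\<exists>H\<in>\<G>. bipartite_iso (core2 (compl_graph n r E)) H))"
      by (intro exI[of _ "small_graphs n ((n + 1) choose 2)"] conjI finite_small_graphs allI impI core) auto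
  qed
qed

end
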